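(* Let $n\ge 1$ and $k\ge 1$ be integers. Let $\tilde T_n=\sum_\gamma v_\gamma\gamma\in\mathcal R_n$ act like the $n$-th Hecke operator on periods, and suppose that all matrices occurring in $\tilde T_n$ have non-negative entries. Then for all $x>0$, $$\sum_{j=1}^k\binom{k-1}{j-1}\Big(\mathcal F_j\big|_1^{(k-j)}\tilde T_n\Big)(x)=\sqrt n\sum_{j=1}^k\binom{k-1}{j-1}\sigma_0^{(k-j)}(n)\,\mathcal F_j(x).$$
   Context: Notation: $\log$ is the principal logarithm, $\log^a x=(\log x)^a$ (equal to $1$ when $a=0$), $\zeta$ is the Riemann zeta function, and $\gamma_m$ are the Stieltjes (generalized Euler) constants, $\zeta(s)=\frac1{s-1}+\sum_{m\ge 0}\frac{(-1)^m\gamma_m}{m!}(s-1)^m$. Hecke operators on periods: let $S=\begin{pmatrix}0&-1\\1&0\end{pmatrix}$, $T=\begin{pmatrix}1&1\\0&1\end{pmatrix}$, generators of the full modular group. Let $\mathcal M_n$ be the set of $2\times2$ integer matrices of determinant $n$ modulo $\{\pm1\}$ and $\mathcal R_n=\mathbb Q[\mathcal M_n]$ the space of finite formal $\mathbb Q$-linear combinations of elements of $\mathcal M_n$ (matrix multiplication by modular group elements on the left and right extends linearly). An element $\tilde T_n\in\mathcal R_n$ acts like the $n$-th Hecke operator on periods if $$(1-S)\tilde T_n=T_n^\infty(1-S)+(1-T)Y\quad\text{for some }Y\in\mathcal R_n,\qquad T_n^\infty=\sum_{ad=n}\ \sum_{0\le b<d}\begin{bmatrix}a&b\\0&d\end{bmatrix}.$$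 Slash operator: for an integer $l\ge 0$ and $\gamma=\begin{bmatrix}a&b\\c&d\end{bmatrix}\in\mathcal M_n$ (represented by the matrix with non-negative entries), $$(f|_1^{(l)}\gamma)(x)=\frac{(ad-bc)^{1/2}}{cx+d}\,\log^l\!\Big(\frac1{cx+d}\Big)f\!\Big(\frac{ax+b}{cx+d}\Big),$$ extended linearly: $f|_1^{(l)}\sum_\gamma v_\gamma\gamma=\sum_\gamma v_\gamma\,(f|_1^{(l)}\gamma)$. $\sigma_0^{(j)}(n)$ denotes the $j$-th derivative with respect to $s$, at $s=1$, of $\sigma_{1-s}(n)=\sum_{d\mid n}d^{1-s}$. Generalized gamma function: for $k\ge 0$ and $x\in\mathbb C\setminus(-\infty,0]$, $$\Gamma_k(x)=\lim_{m\to\infty}\frac{\exp\!\big(\frac{\log^{k+1}m}{k+1}x\big)\prod_{j=1}^m\exp\!\big(\frac{\log^{k+1}j}{k+1}\big)}{\prod_{j=0}^m\exp\!\big(\frac{\log^{k+1}(j+x)}{k+1}\big)},\qquad \psi_k(x)=\frac{\Gamma_k'(x)}{\Gamma_k(x)}$$ (so $\psi_k(x)=\lim_{m\to\infty}\big(\frac{\log^{k+1}m}{k+1}-\sum_{j=0}^m\frac{\log^k(j+x)}{j+x}\big)$). For $k\ge 1$ and $x\in\mathbb C\setminus(-\infty,0]$, $$\mathfrak F_k^0(x)=\sum_{m=1}^\infty\left[\psi_{k-1}(mx)+\frac{\log^{k-1}(mx)}{2mx}-\frac{\log^k(mx)}{k}\right],$$ $$\mathcal F_k(x)=(-1)^{k-1}\mathfrak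 F_k^0(x)-\sum_{l=0}^k\frac{(-1)^l}{k}\binom kl\log^l(x)\,\zeta^{(k-l)}(0)-\frac12(-1)^{k-1}\gamma_{k-1}.$$ *)

theory Defs
  imports "HOL-Complex_Analysis.Complex_Analysis" "HOL-Library.Poly_Mapping"
begin

section \<open>Integer matrices modulo sign\<close>

quotient_type pmat = "int^2^2" / "\<lambda>A B. A = B \<or> A = - B"
  by (rule equivpI) (auto simp: reflp_def symp_def transp_def)

definition mat2 :: "int \<Rightarrow> int \<Rightarrow> int \<Rightarrow> int \<Rightarrow> int^2^2" where
  "mat2 a b c d = vector [vector [a, b], vector [c, d]]"

lift_definition pmat2 :: "int \<Rightarrow> int \<Rightarrow> int \<Rightarrow> int \<Rightarrow> pmat" is mat2 .

lift_definition pdet :: "pmat \<Rightarrow> int" is det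
  by (auto simp: det_2)

lemma matrix_mul_minus_left: "(- A) ** B = - (A ** B)" for A B :: "int^2^2"
  by (simp add: matrix_matrix_mult_def vec_eq_iff sum_negf)

lemma matrix_mul_minus_right: "A ** (- B) = - (A ** B)" for A B :: "int^2^2"
  by (simp add: matrix_matrix_mult_def vec_eq_iff sum_negf)

lift_definition pmul :: "pmat \<Rightarrow> pmat \<Rightarrow> pmat" is "\<lambda>A B. A ** B"
  by (auto simp: matrix_mul_minus_left matrix_mul_minus_right)

definition mat_nonneg :: "int^2^2 \<Rightarrow> bool" where
  "mat_nonneg A \<longleftrightarrow> (\<forall>i j. 0 \<le> A $ i $ j)"

lift_definition pnonneg :: "pmat \<Rightarrow> bool" is "\<lambda>A. mat_nonneg A \<or> mat_nonneg (- A)"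
  by auto

text \<open>Every class satisfying \<^const>\<open>pnonneg\<close> has exactly one non-negative representative.\<close>

definition nonneg_rep :: "pmat \<Rightarrow> int^2^2" where
  "nonneg_rep \<gamma> = (THE A. abs_pmat A = \<gamma> \<and> mat_nonneg A)"


section \<open>Hecke operators on periods\<close>

definition hecke_mats :: "nat \<Rightarrow> pmat set" where
  "hecke_mats n = {\<gamma>. pdet \<gamma> = int n}"

definition hecke_module :: "nat \<Rightarrow> (pmat \<Rightarrow>\<^sub>0 rat) set" where
  "hecke_module n = {v. Poly_Mapping.keys v \<subseteq> hecke_mats n}"

definition lmul :: "pmat \<Rightarrow> (pmat \<Rightarrow>\<^sub>0 rat) \<Rightarrow> (pmat \<Rightarrow>\<^sub>0 rat)" where
  "lmul g v = (\<Sum>\<gamma>\<in>Poly_Mapping.keys v.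
     Poly_Mapping.single (pmul g \<gamma>) (Poly_Mapping.lookup v \<gamma>))"

definition rmul :: "(pmat \<Rightarrow>\<^sub>0 rat) \<Rightarrow> pmat \<Rightarrow> (pmat \<Rightarrow>\<^sub>0 rat)" where
  "rmul v g = (\<Sum>\<gamma>\<in>Poly_Mapping.keys v.
     Poly_Mapping.single (pmul \<gamma> g) (Poly_Mapping.lookup v \<gamma>))"

definition S_mat :: pmat where "S_mat = pmat2 0 (-1) 1 0"

definition T_mat :: pmat where "T_mat = pmat2 1 1 0 1"

definition T_infty :: "nat \<Rightarrow> (pmat \<Rightarrow>\<^sub>0 rat)" where
  "T_infty n = (\<Sum>(a, b, d) \<in> {(a, b, d). a * d = n \<and> b < d}.
     Poly_Mapping.single (pmat2 (int a) (int b) 0 (int d)) 1)"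

definition acts_like_hecke :: "nat \<Rightarrow> (pmat \<Rightarrow>\<^sub>0 rat) \<Rightarrow> bool" where
  "acts_like_hecke n v \<longleftrightarrow> v \<in> hecke_module n \<and>
     (\<exists>Y \<in> hecke_module n.
        v - lmul S_mat v = (T_infty n - rmul (T_infty n) S_mat) + (Y - lmul T_mat Y))"


section \<open>The slash operator\<close>

definition slash_mat ::
    "(complex \<Rightarrow> complex) \<Rightarrow> nat \<Rightarrow> int^2^2 \<Rightarrow> complex \<Rightarrow> complex" where
  "slash_mat f l A x =
     (let a = of_int (A $ 1 $ 1); b = of_int (A $ 1 $ 2);
          c = of_int (A $ 2 $ 1); d = of_int (A $ 2 $ 2)
      in csqrt (a * d - b * c) / (c * x + d) * Ln (1 / (c * x + d)) ^ l
           * f ((a * x + b) / (c * x + d)))"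

definition slash ::
    "(complex \<Rightarrow> complex) \<Rightarrow> nat \<Rightarrow> (pmat \<Rightarrow>\<^sub>0 rat) \<Rightarrow> complex \<Rightarrow> complex" where
  "slash f l v x = (\<Sum>\<gamma>\<in>Poly_Mapping.keys v.
     of_rat (Poly_Mapping.lookup v \<gamma>) * slash_mat f l (nonneg_rep \<gamma>) x)"


section \<open>Special functions\<close>

definition sigma0_deriv :: "nat \<Rightarrow> nat \<Rightarrow> complex" where
  "sigma0_deriv j n =
     (deriv ^^ j) (\<lambda>s. \<Sum>d | d dvd n. of_nat d powr (1 - s)) 1"

text \<open>
  The value at the pole is fixed to be 0, which makes the meromorphic continuation of the
  Dirichlet series unique as a total function.
\<close>

definition riemann_zeta :: "complex \<Rightarrow> complex" where
  "riemann_zeta = (THE f. f holomorphic_on (- {1}) \<and> f 1 = 0 \<and>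
     (\<forall>s. Re s > 1 \<longrightarrow> f s = suminf (\<lambda>m. 1 / of_nat (Suc m) powr s)))"

definition stieltjes :: "nat \<Rightarrow> complex" where
  "stieltjes = (THE g. \<forall>s. s \<noteq> 1 \<longrightarrow>
     (\<lambda>m. (-1) ^ m * g m / fact m * (s - 1) ^ m) sums (riemann_zeta s - 1 / (s - 1)))"

definition gen_Gamma :: "nat \<Rightarrow> complex \<Rightarrow> complex" where
  "gen_Gamma k x = lim (\<lambda>m::nat.
     exp (Ln (of_nat m) ^ (k + 1) / of_nat (k + 1) * x)
       * (\<Prod>j=1..m. exp (Ln (of_nat j) ^ (k + 1) / of_nat (k + 1)))
       / (\<Prod>j=0..m. exp (Ln (of_nat j + x) ^ (k + 1) / of_nat (k + 1))))"

definition gen_psi :: "nat \<Rightarrow> complex \<Rightarrow> complex" where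
  "gen_psi k x = deriv (gen_Gamma k) x / gen_Gamma k x"

text \<open>The series is indexed from 0, hence the argument \<open>Suc m\<close> below.\<close>

definition herglotz0 :: "nat \<Rightarrow> complex \<Rightarrow> complex" where
  "herglotz0 k x = suminf (\<lambda>m. let y = of_nat (Suc m) * x in
     gen_psi (k - 1) y + Ln y ^ (k - 1) / (2 * y) - Ln y ^ k / of_nat k)"

definition herglotz :: "nat \<Rightarrow> complex \<Rightarrow> complex" where
  "herglotz k x =
     (-1) ^ (k - 1) * herglotz0 k x
     - (\<Sum>l=0..k. (-1) ^ l / of_nat k * of_nat (k choose l) * Ln x ^ l
                   * (deriv ^^ (k - l)) riemann_zeta 0)
     - 1 / 2 * (-1) ^ (k - 1) * stieltjes (k - 1)"

end

theory Submission
  imports Defs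
begin

text \<open>
  Up to sign \<open>F\<^sub>k(x)\<close> is the \<open>(k-1)\<close>-st derivative at \<open>s = 1\<close> of the period function
  \<open>\<Psi>(s, x) = \<zeta>(s) (1 + x\<^sup>-\<^sup>s) / 2 + \<Sum> (m x + n)\<^sup>-\<^sup>s\<close> (sum over \<open>m, n \<ge> 1\<close>) of an Eisenstein series,
  continued in \<open>s\<close> by Euler--Maclaurin summation. By Leibniz' rule the claim is therefore the
  \<open>(k-1)\<close>-st derivative at \<open>s = 1\<close> of \<open>\<Sum>\<^sub>\<gamma> v\<^sub>\<gamma> (c x + d)\<^sup>-\<^sup>s \<Psi>(s, \<gamma> x) = \<sigma>\<^bsub>1-s\<^esub>(n) \<Psi>(s, x)\<close>, and by
  analytic continuation it suffices to prove this identity for \<open>Re s > 2\<close>. There both sides are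
  sums of \<open>(p\<^sub>1 x + p\<^sub>2)\<^sup>-\<^sup>s\<close> over lattice points \<open>p\<close> of the first quadrant, and they agree term by
  term: for fixed \<open>p\<close>, the coefficient is a linear functional of \<open>\<gamma> - S \<gamma>\<close> which is invariant under
  \<open>\<gamma> \<mapsto> T \<gamma>\<close>, so the defining relation of a Hecke operator on periods reduces it to the upper
  triangular matrices, where it is a divisor sum.
\<close>

unbundle no Formal_Power_Series.fps_syntax
unbundle no Formal_Laurent_Series.fps_syntax

section \<open>The period relation on lattice points\<close>

text \<open>The matrices occurring in \<open>Y\<close> may have entries of any sign, and for those
  the slash operator has no meaning. Hence the defining relation is not applied to functions but to
  a functional that is defined on all of \<open>pmat\<close>. Its origin: for p = q \<gamma> with q
  in the first quadrant, half of sgn q1 + sgn q2 is the weight of p in the lattice sum of (c x +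
  d)^(-s) Psi(s, \<gamma> x), the axes counting one half because of the term zeta(s) (1 + x^(-s)) /
  2. The coefficient q1 = (p1 d - p2 c) / n involves only the bottom row, so it is blind to T, while
  S exchanges q1 and q2 up to sign. Thus \<gamma> - S \<gamma> yields both signs from a single
  T-invariant function. The pieces from which Psi is built have poles at s = 1 that cancel only in
  the sum, so everything is multiplied by s - 1. The price is one more differentiation: F_k becomes
  -1/k times a k-th derivative, and j C(k, j) = k C(k - 1, j - 1) restores the binomial coefficients
  of the claim.\<close>

definition lin_ext :: "(pmat \<Rightarrow> rat) \<Rightarrow> (pmat \<Rightarrow>\<^sub>0 rat) \<Rightarrow> rat" where
  "lin_ext \<phi> v = (\<Sum>\<gamma>\<in>Poly_Mapping.keys v. Poly_Mapping.lookup v \<gamma> * \<phi> \<gamma>)"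

lemma lin_ext_superset:
  assumes "finite A" "Poly_Mapping.keys v \<subseteq> A"
  shows "lin_ext \<phi> v = (\<Sum>\<gamma>\<in>A. Poly_Mapping.lookup v \<gamma> * \<phi> \<gamma>)"
  unfolding lin_ext_def
  by (rule sum.mono_neutral_left) (use assms in \<open>auto simp: in_keys_iff\<close>)

lemma lin_ext_zero [simp]: "lin_ext \<phi> 0 = 0"
  by (simp add: lin_ext_def)

lemma lin_ext_single [simp]: "lin_ext \<phi> (Poly_Mapping.single \<gamma> c) = c * \<phi> \<gamma>"
  by (simp add: lin_ext_def)

lemma lin_ext_add: "lin_ext \<phi> (u + v) = lin_ext \<phi> u + lin_ext \<phi> v"
proof -
  let ?A = "Poly_Mapping.keys u \<union> Poly_Mapping.keys v"
  have "lin_ext \<phi> w = (\<Sum>\<gamma>\<in>?A. Poly_Mapping.lookup w \<gamma> * \<phi> \<gamma>)"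
    if "Poly_Mapping.keys w \<subseteq> ?A" for w
    by (rule lin_ext_superset) (use that in auto)
  then show ?thesis
    using Poly_Mapping.keys_add[of u v]
    by (simp add: lookup_add distrib_right sum.distrib)
qed

lemma lin_ext_diff: "lin_ext \<phi> (u - v) = lin_ext \<phi> u - lin_ext \<phi> v"
  using lin_ext_add[of \<phi> "u - v" v] by simp

lemma lin_ext_sum: "lin_ext \<phi> (sum f A) = (\<Sum>i\<in>A. lin_ext \<phi> (f i))"
  by (induction A rule: infinite_finite_induct) (simp_all add: lin_ext_add)

lemma lin_ext_lmul: "lin_ext \<phi> (lmul g v) = lin_ext (\<lambda>\<gamma>. \<phi> (pmul g \<gamma>)) v"
  by (simp add: lmul_def lin_ext_sum) (simp add: lin_ext_def)

lemma lin_ext_rmul: "lin_ext \<phi> (rmul v g) = lin_ext (\<lambda>\<gamma>. \<phi> (pmul \<gamma> g)) v"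
  by (simp add: rmul_def lin_ext_sum) (simp add: lin_ext_def)

lemma lin_ext_cong:
  assumes "\<And>\<gamma>. \<gamma> \<in> Poly_Mapping.keys v \<Longrightarrow> \<phi> \<gamma> = \<phi>2 \<gamma>"
  shows "lin_ext \<phi> v = lin_ext \<phi>2 v"
  unfolding lin_ext_def using assms by (intro sum.cong) auto

lemma lin_ext_diff_fun: "lin_ext (\<lambda>\<gamma>. \<phi> \<gamma> - \<phi>2 \<gamma>) v = lin_ext \<phi> v - lin_ext \<phi>2 v"
  by (simp add: lin_ext_def right_diff_distrib sum_subtractf)

section \<open>Explicit entries for matrix classes\<close>

lemma mat2_components [simp]:
  "mat2 a b c d $ 1 $ 1 = a" "mat2 a b c d $ 1 $ 2 = b"
  "mat2 a b c d $ 2 $ 1 = c" "mat2 a b c d $ 2 $ 2 = d"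
  by (simp_all add: mat2_def)

lemma mat2_eta: "mat2 (A $ 1 $ 1) (A $ 1 $ 2) (A $ 2 $ 1) (A $ 2 $ 2) = A"
  by (simp add: vec_eq_iff forall_2)

lemma mat2_mult:
  "mat2 a b c d ** mat2 a' b' c' d' =
     mat2 (a * a' + b * c') (a * b' + b * d') (c * a' + d * c') (c * b' + d * d')"
  by (simp add: vec_eq_iff forall_2 matrix_matrix_mult_def sum_2)

lemma pmat2_mult:
  "pmul (pmat2 a b c d) (pmat2 a' b' c' d') =
     pmat2 (a * a' + b * c') (a * b' + b * d') (c * a' + d * c') (c * b' + d * d')"
  by transfer (simp add: mat2_mult)

lemma pmat2_cases:
  obtains a b c d where "\<gamma> = pmat2 a b c d"
proof (transfer fixing: thesis)
  fix A :: "int^2^2"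
  assume *: "\<And>a b c d. A = mat2 a b c d \<or> A = - mat2 a b c d \<Longrightarrow> thesis"
  show thesis
    by (rule *[of "A $ 1 $ 1" "A $ 1 $ 2" "A $ 2 $ 1" "A $ 2 $ 2"]) (simp add: mat2_eta)
qed

lemma pdet_pmat2: "pdet (pmat2 a b c d) = a * d - b * c"
  by transfer (simp add: det_2)

section \<open>A sign functional invariant under \<open>T\<close>\<close>

definition lex_sgn :: "int \<Rightarrow> int \<Rightarrow> int" where
  "lex_sgn c d = (if c = 0 then sgn d else sgn c)"

lemma lex_sgn_minus: "lex_sgn (- c) (- d) = - lex_sgn c d"
  by (simp add: lex_sgn_def)

text \<open>
  The condition says that \<open>p\<close> is an integral combination of the rows of the matrix; the first
  coefficient is then a positive multiple of \<open>p\<^sub>1 d - p\<^sub>2 c\<close>. The factor \<^const>\<open>lex_sgn\<close> is the sign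
  of \<open>c x + d\<close> for large \<open>x\<close>, which makes the functional insensitive to the sign of the matrix.
\<close>
definition row_sign :: "nat \<Rightarrow> int \<Rightarrow> int \<Rightarrow> int^2^2 \<Rightarrow> int" where
  "row_sign n p1 p2 A =
     (if int n dvd p1 * A $ 2 $ 2 - p2 * A $ 2 $ 1 \<and> int n dvd p2 * A $ 1 $ 1 - p1 * A $ 1 $ 2
      then sgn (p1 * A $ 2 $ 2 - p2 * A $ 2 $ 1) * lex_sgn (A $ 2 $ 1) (A $ 2 $ 2) else 0)"

lemma row_sign_minus: "row_sign n p1 p2 (- A) = row_sign n p1 p2 A"
proof -
  have "p1 * (- A) $ 2 $ 2 - p2 * (- A) $ 2 $ 1 = - (p1 * A $ 2 $ 2 - p2 * A $ 2 $ 1)"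
       "p2 * (- A) $ 1 $ 1 - p1 * (- A) $ 1 $ 2 = - (p2 * A $ 1 $ 1 - p1 * A $ 1 $ 2)"
       "lex_sgn ((- A) $ 2 $ 1) ((- A) $ 2 $ 2) = - lex_sgn (A $ 2 $ 1) (A $ 2 $ 2)"
    by (simp_all add: lex_sgn_minus)
  then show ?thesis
    unfolding row_sign_def by (simp only: dvd_minus_iff idom_abs_sgn_class.sgn_minus minus_mult_minus)
qed

lift_definition period_sign :: "nat \<Rightarrow> int \<Rightarrow> int \<Rightarrow> pmat \<Rightarrow> rat"
  is "\<lambda>n p1 p2 A. of_int (row_sign n p1 p2 A)"
  by (auto simp: row_sign_minus)

lemma period_sign_pmat2:
  "period_sign n p1 p2 (pmat2 a b c d) =
     (if int n dvd p1 * d - p2 * c \<and> int n dvd p2 * a - p1 * b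
      then of_int (sgn (p1 * d - p2 * c) * lex_sgn c d) else 0)"
  by transfer (simp add: row_sign_def)

text \<open>Adding the bottom row to the top row leaves the first coefficient of p, which is all
  that the sign sees, unchanged; the second coefficient drops by the first, so integrality is
  preserved.\<close>

lemma period_sign_T: "period_sign n p1 p2 (pmul T_mat \<gamma>) = period_sign n p1 p2 \<gamma>"
proof -
  obtain a b c d where \<gamma>: "\<gamma> = pmat2 a b c d" by (rule pmat2_cases)
  have eq: "p2 * (a + c) - p1 * (b + d) = (p2 * a - p1 * b) - (p1 * d - p2 * c)"
    by (simp add: algebra_simps)
  have "int n dvd p2 * (a + c) - p1 * (b + d) \<longleftrightarrow> int n dvd p2 * a - p1 * b"
    if "int n dvd p1 * d - p2 * c"
    unfolding eq using that by (rule dvd_diff_left_iff)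
  then show ?thesis
    by (auto simp: \<gamma> T_mat_def pmat2_mult period_sign_pmat2)
qed

text \<open>\<open>S\<close> moves the top row to the bottom and the negated bottom row to the top.
  The two integrality conditions are only permuted, and the sign now reads off the second
  coefficient, negated because its numerator appears as \<open>p1 * b - p2 * a\<close>.\<close>

lemma period_sign_S:
  "period_sign n p1 p2 (pmul S_mat (pmat2 a b c d)) =
     (if int n dvd p1 * d - p2 * c \<and> int n dvd p2 * a - p1 * b
      then - of_int (sgn (p2 * a - p1 * b) * lex_sgn a b) else 0)"
proof -
  have S: "pmul S_mat (pmat2 a b c d) = pmat2 (- c) (- d) a b"
    by (simp add: S_mat_def pmat2_mult)
  have "p2 * (- c) - p1 * (- d) = p1 * d - p2 * c"
       "p1 * b - p2 * a = - (p2 * a - p1 * b)"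
    by simp_all
  then show ?thesis
    unfolding S period_sign_pmat2
    by (simp only: dvd_minus_iff idom_abs_sgn_class.sgn_minus conj_commute
          minus_mult_left [symmetric] of_int_minus)
qed

section \<open>Counting solutions of linear congruences\<close>

lemma card_mod_eq:
  fixes g e c :: nat
  assumes "c < e"
  shows "card {b. b < g * e \<and> b mod e = c} = g"
proof -
  have "{b. b < g * e \<and> b mod e = c} = (\<lambda>i. c + i * e) ` {..<g}"
  proof (intro equalityI subsetI)
    fix b assume b: "b \<in> {b. b < g * e \<and> b mod e = c}"
    then have "b = c + (b div e) * e" by auto
    moreover have "b div e < g" using b by (simp add: less_mult_imp_div_less)
    ultimately show "b \<in> (\<lambda>i. c + i * e) ` {..<g}" by blast
  next
    fix b assume "b \<in> (\<lambda>i. c + i * e) ` {..<g}"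
    then obtain i where i: "i < g" "b = c + i * e" by auto
    have "b < e + i * e" using i assms by simp
    also have "\<dots> = Suc i * e" by simp
    also have "\<dots> \<le> g * e" using i by (intro mult_right_mono) auto
    finally show "b \<in> {b. b < g * e \<and> b mod e = c}" using i assms by simp
  qed
  moreover have "inj_on (\<lambda>i. c + i * e) {..<g}"
    using assms by (auto simp: inj_on_def)
  ultimately show ?thesis by (simp add: card_image)
qed

text \<open>After division by g = gcd(d, u), a Bezout coefficient \<open>t\<close> inverts u/g
  modulo e = d/g. The solutions thus form one residue class modulo e, which has g members below d =
  g e.\<close>

lemma card_linear_congruence:
  fixes d :: nat and u v :: int
  assumes "d > 0"
  shows "card {b. b < d \<and> int d dvd v - u * int b} =
           (if gcd (int d) u dvd v then nat (gcd (int d) u) else 0)"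
proof (cases "gcd (int d) u dvd v")
  case False
  have "\<not> int d dvd v - u * int b" for b
  proof
    assume "int d dvd v - u * int b"
    then have "gcd (int d) u dvd (v - u * int b) + u * int b"
      by (meson dvd_add dvd_mult2 dvd_trans gcd_dvd1 gcd_dvd2)
    with False show False by simp
  qed
  with False show ?thesis by simp
next
  case True
  define g where "g = nat (gcd (int d) u)"
  have g: "int g = gcd (int d) u" by (simp add: g_def)
  have g0: "g > 0" using assms by (simp add: g_def)
  obtain e where e: "d = g * e"
    by (metis dvdE g gcd_dvd1 int_dvd_int_iff)
  obtain u' where u': "u = int g * u'" by (metis dvdE g gcd_dvd2)
  obtain v' where v': "v = int g * v'" using True g by (metis dvdE)
  have e0: "e > 0" using e assms by (cases e) auto
  obtain s t where "s * int d + t * u = int g"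
    using bezout_int[of "int d" u] g by auto
  then have "int g * (s * int e + t * u') = int g * 1"
    by (simp add: e u' algebra_simps)
  then have bez: "s * int e + t * u' = 1" using g0 by simp
  have iff: "int d dvd v - u * int b \<longleftrightarrow> b mod e = nat ((t * v') mod int e)" for b
  proof -
    have "int d dvd v - u * int b \<longleftrightarrow> int g * int e dvd int g * (v' - u' * int b)"
      by (simp add: e u' v' algebra_simps)
    also have "\<dots> \<longleftrightarrow> int e dvd v' - u' * int b"
      using g0 by simp
    also have "\<dots> \<longleftrightarrow> int e dvd t * v' - int b"
    proof
      assume "int e dvd v' - u' * int b"
      then have "int e dvd t * (v' - u' * int b) - int e * (s * int b)"
        by (intro dvd_diff) auto
      also have "t * (v' - u' * int b) - int e * (s * int b) = t * v' - (s * int e + t * u') * int b"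
        by (simp add: algebra_simps)
      finally show "int e dvd t * v' - int b" by (simp add: bez)
    next
      assume "int e dvd t * v' - int b"
      then have "int e dvd u' * (t * v' - int b) + int e * (s * v')"
        by (intro dvd_add) auto
      also have "u' * (t * v' - int b) + int e * (s * v') = (s * int e + t * u') * v' - u' * int b"
        by (simp add: algebra_simps)
      finally show "int e dvd v' - u' * int b" by (simp add: bez)
    qed
    also have "\<dots> \<longleftrightarrow> int b mod int e = (t * v') mod int e"
      by (metis mod_eq_dvd_iff)
    also have "\<dots> \<longleftrightarrow> b mod e = nat ((t * v') mod int e)"
      using e0 by (metis eq_nat_nat_iff nat_int of_nat_0_less_iff pos_mod_sign zmod_int of_nat_0_le_iff)
    finally show ?thesis .
  qed
  have "nat ((t * v') mod int e) < e"
    using e0 by (simp add: nat_less_iff)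
  then have "card {b. b < d \<and> int d dvd v - u * int b} = g"
    unfolding iff unfolding e by (rule card_mod_eq)
  then show ?thesis
    using True by (simp only: g_def if_True)
qed

lemma lin_ext_T_infty:
  "lin_ext \<phi> (T_infty n) = (\<Sum>(a, b, d) \<in> {(a, b, d). a * d = n \<and> b < d}.
     \<phi> (pmat2 (int a) (int b) 0 (int d)))"
  by (simp add: T_infty_def lin_ext_sum case_prod_unfold)


text \<open>
  With \<open>G = gcd(n, u)\<close>, the first coordinate forces \<open>a\<close> to divide \<open>G\<close>, and then \<open>gcd(n/a, u/a) = G/a\<close>;
  so the count becomes a divisor sum in the complementary divisor.
\<close>
lemma sum_upper_triangular:
  fixes n :: nat and u v :: int
  assumes "n > 0"
  shows "(\<Sum>(a, b, d) \<in> {(a, b, d). a * d = n \<and> b < d}.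
            if int n dvd u * int d \<and> int n dvd v * int a - u * int b then 1 else 0) =
         (\<Sum>e | e dvd n \<and> int e dvd u \<and> int e dvd v. of_nat e :: rat)"
proof -
  define P where "P = (\<lambda>a b. int n dvd u * int (n div a) \<and> int n dvd v * int a - u * int b)"
  define G where "G = nat (gcd (int n) u)"
  have G: "int G = gcd (int n) u" by (simp add: G_def)
  have G0: "G > 0" using assms by (simp add: G_def)
  have Gn: "G dvd n" by (metis G gcd_dvd1 int_dvd_int_iff)
  have GG: "G div (G div e) = e" "G div e dvd G" if "e dvd G" for e
  proof -
    obtain f where "G = e * f" using \<open>e dvd G\<close> ..
    then show "G div (G div e) = e" "G div e dvd G" using G0 by auto
  qed
  have fin: "finite {a. a dvd n}" using assms by simp
  have "(\<Sum>(a, b, d) \<in> {(a, b, d). a * d = n \<and> b < d}.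
            if int n dvd u * int d \<and> int n dvd v * int a - u * int b then 1 else 0 :: rat) =
        (\<Sum>(a, b) \<in> Sigma {a. a dvd n} (\<lambda>a. {..<n div a}). if P a b then 1 else 0)"
    by (rule sum.reindex_bij_witness[of _ "\<lambda>(a, b). (a, b, n div a)" "\<lambda>(a, b, d). (a, b)"])
       (use assms in \<open>auto simp: P_def\<close>)
  also have "\<dots> = (\<Sum>a | a dvd n. \<Sum>b<n div a. if P a b then 1 else 0)"
    by (subst sum.Sigma) (use fin in auto)
  also have "\<dots> = (\<Sum>a | a dvd n. of_nat (card {b. b < n div a \<and> P a b}))"
  proof (intro sum.cong refl)
    fix a
    have "{..<n div a} \<inter> {b. P a b} = {b. b < n div a \<and> P a b}" by auto
    then show "(\<Sum>b<n div a. if P a b then 1 else 0 :: rat) = of_nat (card {b. b < n div a \<and> P a b})"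
      by (simp flip: sum.inter_filter add: sum.If_cases)
  qed
  also have "\<dots> = (\<Sum>a | a dvd n. if a dvd G \<and> int (G div a) dvd v then of_nat (G div a) else 0)"
  proof (intro sum.cong refl)
    fix a assume "a \<in> {a. a dvd n}"
    then obtain d where d: "n = a * d" by auto
    with assms have a0: "a > 0" and d0: "d > 0" by auto
    have nd: "n div a = d" using a0 d by simp
    have dvd_iff: "a dvd G \<longleftrightarrow> int a dvd u"
      using d G by (metis dvd_triv_left gcd_greatest_iff int_dvd_int_iff)
    show "of_nat (card {b. b < n div a \<and> P a b}) =
       (if a dvd G \<and> int (G div a) dvd v then of_nat (G div a) else (0::rat))"
    proof (cases "int a dvd u")
      case False
      then have "\<not> int n dvd u * int d" using d0 by (simp add: d)
      then have "\<not> P a b" for b by (simp add: P_def nd)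
      then show ?thesis using False dvd_iff by simp
    next
      case True
      then obtain u' where u': "u = int a * u'" by auto
      have "P a b \<longleftrightarrow> int d dvd v - u' * int b" for b
      proof -
        have "v * int a - u * int b = int a * (v - u' * int b)"
          by (simp add: u' algebra_simps)
        then show ?thesis using a0 by (simp add: P_def nd d u')
      qed
      moreover have "int (G div a) = gcd (int d) u'"
      proof -
        have "int G = int a * gcd (int d) u'"
          by (simp add: G d u' gcd_mult_left abs_mult)
        then show ?thesis using a0 by (simp add: zdiv_int)
      qed
      moreover have "nat (gcd (int d) u') = G div a"
        by (metis calculation(2) nat_int)
      ultimately show ?thesis
        using card_linear_congruence[OF d0, of v u'] True dvd_iff by (simp add: nd)
    qed
  qed
  also have "\<dots> = (\<Sum>a | a dvd G. if int (G div a) dvd v then of_nat (G div a) else 0)"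
    by (rule sum.mono_neutral_cong_right) (use fin in \<open>auto intro: dvd_trans[OF _ Gn]\<close>)
  also have "\<dots> = (\<Sum>e | e dvd G. if int e dvd v then of_nat e else 0)"
    by (rule sum.reindex_bij_witness[of _ "\<lambda>e. G div e" "\<lambda>a. G div a"])
       (use GG in auto)
  also have "\<dots> = (\<Sum>e | e dvd G \<and> int e dvd v. of_nat e)"
    using G0 by (subst sum.inter_filter [symmetric]) (auto intro: sum.cong)
  also have "{e. e dvd G \<and> int e dvd v} = {e. e dvd n \<and> int e dvd u \<and> int e dvd v}"
  proof -
    have "e dvd G \<longleftrightarrow> e dvd n \<and> int e dvd u" for e
      using gcd_greatest_iff[of "int e" "int n" u] by (simp flip: G)
    then show ?thesis by auto
  qed
  finally show ?thesis .
qed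

text \<open>The value of the functional on \<gamma> - S \<gamma>: up to the lexicographic signs of
  the two rows, the sum of the signs of the two coefficients of p.\<close>

definition row_weight :: "nat \<Rightarrow> int \<Rightarrow> int \<Rightarrow> pmat \<Rightarrow> rat" where
  "row_weight n p1 p2 \<gamma> = period_sign n p1 p2 \<gamma> - period_sign n p1 p2 (pmul S_mat \<gamma>)"

lemma row_weight_pmat2:
  "row_weight n p1 p2 (pmat2 a b c d) =
    (if int n dvd p1 * d - p2 * c \<and> int n dvd p2 * a - p1 * b
     then of_int (sgn (p1 * d - p2 * c) * lex_sgn c d + sgn (p2 * a - p1 * b) * lex_sgn a b) else 0)"
  by (simp add: row_weight_def period_sign_S period_sign_pmat2)

text \<open>The part Y - T Y drops out by invariance, and upper triangular matrices can be
  evaluated: \<open>T_infty n\<close> sees only sgn p1, its product with \<open>S\<close> only sgn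
  p2, each times the sum of the common divisors of n, p1 and p2.\<close>

lemma hecke_row_weight:
  assumes "n > 0" "acts_like_hecke n v"
  shows "lin_ext (row_weight n p1 p2) v =
           of_int (sgn p1 + sgn p2) * (\<Sum>e | e dvd n \<and> int e dvd p1 \<and> int e dvd p2. of_nat e)"
proof -
  let ?\<phi> = "period_sign n p1 p2"
  let ?U = "{(a :: nat, b :: nat, d). a * d = n \<and> b < d}"
  let ?\<sigma> = "\<Sum>e | e dvd n \<and> int e dvd p1 \<and> int e dvd p2. of_nat e :: rat"
  obtain Y where Y: "v - lmul S_mat v = (T_infty n - rmul (T_infty n) S_mat) + (Y - lmul T_mat Y)"
    using assms(2) unfolding acts_like_hecke_def by (elim conjE bexE)
  have "lin_ext (row_weight n p1 p2) v = lin_ext ?\<phi> (v - lmul S_mat v)"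
  proof -
    have "lin_ext (row_weight n p1 p2) v = lin_ext (\<lambda>\<gamma>. ?\<phi> \<gamma> - ?\<phi> (pmul S_mat \<gamma>)) v"
      by (rule lin_ext_cong) (rule row_weight_def)
    also have "\<dots> = lin_ext ?\<phi> v - lin_ext (\<lambda>\<gamma>. ?\<phi> (pmul S_mat \<gamma>)) v"
      by (rule lin_ext_diff_fun)
    also have "\<dots> = lin_ext ?\<phi> (v - lmul S_mat v)"
      by (simp only: lin_ext_lmul lin_ext_diff)
    finally show ?thesis .
  qed
  also have "\<dots> = lin_ext ?\<phi> (T_infty n) - lin_ext ?\<phi> (rmul (T_infty n) S_mat)"
  proof -
    have "lin_ext ?\<phi> (lmul T_mat Y) = lin_ext ?\<phi> Y"
      unfolding lin_ext_lmul period_sign_T ..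
    then show ?thesis
      by (simp only: Y lin_ext_diff lin_ext_add diff_self add_0_right)
  qed
  also have "lin_ext ?\<phi> (T_infty n) = of_int (sgn p1) * ?\<sigma>"
  proof -
    have "lin_ext ?\<phi> (T_infty n) = (\<Sum>(a, b, d) \<in> ?U. of_int (sgn p1) *
            (if int n dvd p1 * int d \<and> int n dvd p2 * int a - p1 * int b then 1 else 0))"
      unfolding lin_ext_T_infty
    proof (intro sum.cong refl, clarify)
      fix a b d :: nat assume "b < d"
      then show "period_sign (a * d) p1 p2 (pmat2 (int a) (int b) 0 (int d)) =
          of_int (sgn p1) * (if int (a * d) dvd p1 * int d \<and>
             int (a * d) dvd p2 * int a - p1 * int b then 1 else 0)"
        by (simp add: period_sign_pmat2 lex_sgn_def sgn_mult)
    qed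
    also have "\<dots> = of_int (sgn p1) * ?\<sigma>"
      unfolding sum_upper_triangular[OF assms(1), symmetric]
      by (simp only: sum_distrib_left case_prod_unfold)
    finally show ?thesis .
  qed
  \<comment> \<open>Right multiplication by \<open>S\<close> can be moved to the point: the rows (b,
    -a) and (d, 0) turn the conditions at (p1, p2) into those of the original matrix at (-p2,
    p1).\<close>
  also have "lin_ext ?\<phi> (rmul (T_infty n) S_mat) = - of_int (sgn p2) * ?\<sigma>"
  proof -
    have "lin_ext ?\<phi> (rmul (T_infty n) S_mat) = (\<Sum>(a, b, d) \<in> ?U. - of_int (sgn p2) *
            (if int n dvd (- p2) * int d \<and> int n dvd p1 * int a - (- p2) * int b then 1 else 0))"
      unfolding lin_ext_rmul lin_ext_T_infty
    proof (intro sum.cong refl, clarify)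
      fix a b d :: nat assume "b < d"
      have "pmul (pmat2 (int a) (int b) 0 (int d)) S_mat = pmat2 (int b) (- int a) (int d) 0"
        by (simp add: S_mat_def pmat2_mult)
      then show "period_sign (a * d) p1 p2 (pmul (pmat2 (int a) (int b) 0 (int d)) S_mat) =
          - of_int (sgn p2) * (if int (a * d) dvd (- p2) * int d \<and>
             int (a * d) dvd p1 * int a - (- p2) * int b then 1 else 0)"
        using \<open>b < d\<close>
        by (simp add: period_sign_pmat2 lex_sgn_def sgn_mult idom_abs_sgn_class.sgn_minus add.commute)
    qed
    also have "\<dots> = - of_int (sgn p2) *
        (\<Sum>e | e dvd n \<and> int e dvd - p2 \<and> int e dvd p1. of_nat e)"
      unfolding sum_upper_triangular[OF assms(1), symmetric]
      by (simp only: sum_distrib_left case_prod_unfold)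
    also have "{e. e dvd n \<and> int e dvd - p2 \<and> int e dvd p1} =
               {e. e dvd n \<and> int e dvd p1 \<and> int e dvd p2}"
      by auto
    finally show ?thesis .
  qed
  finally show ?thesis by (simp add: algebra_simps)
qed

section \<open>Series of holomorphic functions\<close>

lemma uniform_limit_dominated_series:
  fixes f :: "nat \<Rightarrow> complex \<Rightarrow> complex"
  assumes "open A" "z \<in> A"
    and "\<exists>r>0. \<exists>M. summable M \<and> (\<forall>n. \<forall>w\<in>A. dist z w \<le> r \<longrightarrow> norm (f n w) \<le> M n)"
  obtains d where "d > 0" "cball z d \<subseteq> A"
    "uniform_limit (cball z d) (\<lambda>n w. \<Sum>i<n. f i w) (\<lambda>w. suminf (\<lambda>i. f i w)) sequentially"
proof -
  obtain r M where r: "r > 0" "summable M" "\<And>n w. w \<in> A \<Longrightarrow> dist z w \<le> r \<Longrightarrow> norm (f n w) \<le> M n"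
    using assms(3) by blast
  obtain e where e: "e > 0" "cball z e \<subseteq> A"
    using assms(1,2) by (meson open_contains_cball)
  show ?thesis
  proof (rule that[of "min r e"])
    show "uniform_limit (cball z (min r e)) (\<lambda>n w. \<Sum>i<n. f i w) (\<lambda>w. suminf (\<lambda>i. f i w)) sequentially"
      by (rule Weierstrass_m_test[OF _ r(2)], rule r(3)) (use e in auto)
  qed (use r e in auto)
qed

lemma holomorphic_on_suminf:
  fixes f :: "nat \<Rightarrow> complex \<Rightarrow> complex"
  assumes "open A" "\<And>n. f n holomorphic_on A"
    and "\<And>z. z \<in> A \<Longrightarrow> \<exists>r>0. \<exists>M. summable M \<and> (\<forall>n. \<forall>w\<in>A. dist z w \<le> r \<longrightarrow> norm (f n w) \<le> M n)"
  shows "(\<lambda>w. suminf (\<lambda>n. f n w)) holomorphic_on A"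
proof (rule holomorphic_uniform_sequence[OF assms(1)])
  show "(\<lambda>w. \<Sum>i<n. f i w) holomorphic_on A" for n
    by (intro holomorphic_intros assms)
  show "\<exists>d>0. cball z d \<subseteq> A \<and>
          uniform_limit (cball z d) (\<lambda>n w. \<Sum>i<n. f i w) (\<lambda>w. suminf (\<lambda>n. f n w)) sequentially"
    if "z \<in> A" for z
    using uniform_limit_dominated_series[OF assms(1) that assms(3)[OF that]] by metis
qed

lemma higher_deriv_sum:
  fixes f :: "'a \<Rightarrow> complex \<Rightarrow> complex"
  assumes "\<And>i. i \<in> I \<Longrightarrow> f i holomorphic_on A" "open A" "z \<in> A"
  shows "(deriv ^^ m) (\<lambda>w. \<Sum>i\<in>I. f i w) z = (\<Sum>i\<in>I. (deriv ^^ m) (f i) z)"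
  using assms(1)
proof (induction I rule: infinite_finite_induct)
  case (insert i I)
  have "(deriv ^^ m) (\<lambda>w. f i w + (\<Sum>i\<in>I. f i w)) z =
          (deriv ^^ m) (f i) z + (deriv ^^ m) (\<lambda>w. \<Sum>i\<in>I. f i w) z"
    using insert.prems by (intro higher_deriv_add[OF _ _ assms(2,3)] holomorphic_intros) auto
  with insert show ?case by simp
qed auto

lemma higher_deriv_sums:
  fixes f :: "nat \<Rightarrow> complex \<Rightarrow> complex"
  assumes "open A" "\<And>n. f n holomorphic_on A" "z \<in> A"
    and "\<exists>r>0. \<exists>M. summable M \<and> (\<forall>n. \<forall>w\<in>A. dist z w \<le> r \<longrightarrow> norm (f n w) \<le> M n)"
  shows "(\<lambda>n. (deriv ^^ m) (f n) z) sums (deriv ^^ m) (\<lambda>w. suminf (\<lambda>n. f n w)) z"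
proof -
  obtain d where d: "d > 0" "cball z d \<subseteq> A"
    "uniform_limit (cball z d) (\<lambda>n w. \<Sum>i<n. f i w) (\<lambda>w. suminf (\<lambda>i. f i w)) sequentially"
    by (rule uniform_limit_dominated_series[OF assms(1,3,4)])
  have "ball z d \<subseteq> A" using d(2) by auto
  have "(\<lambda>n. (deriv ^^ m) (\<lambda>w. \<Sum>i<n. f i w) z) \<longlonglongrightarrow> (deriv ^^ m) (\<lambda>w. suminf (\<lambda>i. f i w)) z"
  proof (rule higher_deriv_complex_uniform_limit[where A = "ball z d"])
    show "uniform_limit (ball z d) (\<lambda>n w. \<Sum>i<n. f i w) (\<lambda>w. suminf (\<lambda>i. f i w)) sequentially"
      using d(3) by (rule uniform_limit_on_subset) auto
    show "\<forall>\<^sub>F n in sequentially. (\<lambda>w. \<Sum>i<n. f i w) holomorphic_on ball z d"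
      by (intro always_eventually allI holomorphic_intros holomorphic_on_subset[OF assms(2) \<open>ball z d \<subseteq> A\<close>])
  qed (use d in auto)
  moreover have "(deriv ^^ m) (\<lambda>w. \<Sum>i<n. f i w) z = (\<Sum>i<n. (deriv ^^ m) (f i) z)" for n
    by (rule higher_deriv_sum[OF _ assms(1,3)]) (rule assms(2))
  ultimately show ?thesis by (simp add: sums_def)
qed

section \<open>Integrals of shifted powers\<close>

lemma has_field_derivative_powr_minus_right:
  fixes c :: complex
  assumes "c \<noteq> 0"
  shows "((\<lambda>w. c powr (-w)) has_field_derivative - Ln c * c powr (-w)) (at w within A)"
proof -
  have "((\<lambda>w. c powr (-w)) has_field_derivative (Ln c * c powr (-w)) * (-1)) (at w within A)"
    by (rule DERIV_chain2[OF has_field_derivative_powr_right[OF assms]]) (auto intro!: derivative_eq_intros)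
  then show ?thesis by simp
qed

text \<open>The base point is complex because \<open>gen_psi\<close> is a complex derivative, so
  remainders are needed in a neighbourhood of the positive axis.\<close>

definition powr_integral :: "(real \<Rightarrow> complex) \<Rightarrow> complex \<Rightarrow> complex \<Rightarrow> complex" where
  "powr_integral \<beta> w z = integral {0..1} (\<lambda>t. \<beta> t * (z + of_real t) powr (-w))"

lemma continuous_on_powr_integrand:
  assumes "continuous_on {0..1} \<beta>" "Re z > 0"
  shows "continuous_on {0..1} (\<lambda>t. \<beta> t * (z + of_real t) powr (-w))"
  by (intro continuous_intros assms(1)) (use assms(2) in \<open>auto simp: complex_eq_iff\<close>)

lemma holomorphic_powr_integral:
  assumes "continuous_on {0..1} \<beta>" "Re z > 0"
  shows "(\<lambda>w. powr_integral \<beta> w z) holomorphic_on A"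
proof -
  have nz: "z + of_real t \<noteq> 0" "z + of_real t \<notin> \<real>\<^sub>\<le>\<^sub>0" if "t \<ge> 0" for t
    using assms(2) that by (auto simp: complex_eq_iff complex_nonpos_Reals_iff)
  have "(\<lambda>w. integral (cbox 0 1) (\<lambda>t. \<beta> t * (z + of_real t) powr (-w))) holomorphic_on UNIV"
  proof (rule leibniz_rule_holomorphic)
    fix w :: complex and t :: real assume "t \<in> cbox 0 1"
    then show "((\<lambda>w. \<beta> t * (z + of_real t) powr (-w)) has_field_derivative
        \<beta> t * (- Ln (z + of_real t)) * (z + of_real t) powr (-w)) (at w within UNIV)"
      unfolding mult.assoc
      using nz[of t] by (intro DERIV_cmult has_field_derivative_powr_minus_right) auto
  next
    fix w :: complex
    show "(\<lambda>t. \<beta> t * (z + of_real t) powr (-w)) integrable_on cbox 0 1"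
      using continuous_on_powr_integrand[OF assms] by (intro integrable_continuous) simp
  next
    have "continuous_on (UNIV \<times> {0..1::real}) (\<lambda>p. \<beta> (snd p))"
      by (intro continuous_on_compose2[OF assms(1)] continuous_intros) auto
    then show "continuous_on (UNIV \<times> cbox 0 1)
        (\<lambda>(w, t). \<beta> t * (- Ln (z + of_real t)) * (z + of_real t) powr (-w))"
      unfolding case_prod_unfold
      by (intro continuous_intros) (use assms(2) nz in \<open>auto simp: complex_eq_iff\<close>)
  qed auto
  then show ?thesis
    unfolding powr_integral_def cbox_interval by (rule holomorphic_on_subset) auto
qed

text \<open>The modulus of u^(-w) is |u|^(-Re w) exp(Im w Arg u). Bounding the argument by pi
  suffices, since w will stay in bounded sets; and |z + t| >= Re z.\<close>

lemma norm_powr_integral_le: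
  assumes "continuous_on {0..1} \<beta>" "Re z > 0" "\<And>t. t \<in> {0..1} \<Longrightarrow> norm (\<beta> t) \<le> B" "Re w \<ge> 0"
  shows "norm (powr_integral \<beta> w z) \<le> B * (exp (pi * \<bar>Im w\<bar>) * Re z powr (- Re w))"
proof -
  have "norm (powr_integral \<beta> w z) \<le>
          integral {0..1} (\<lambda>t::real. B * (exp (pi * \<bar>Im w\<bar>) * Re z powr (- Re w)))"
    unfolding powr_integral_def
  proof (rule integral_norm_bound_integral)
    show "(\<lambda>t. \<beta> t * (z + of_real t) powr (-w)) integrable_on {0..1}"
      using continuous_on_powr_integrand[OF assms(1,2)] by (intro integrable_continuous_real)
    fix t :: real assume t: "t \<in> {0..1}"
    have "Re z \<le> Re (z + of_real t)" using t by simp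
    also have "\<dots> \<le> norm (z + of_real t)" by (rule complex_Re_le_cmod)
    finally have le: "Re z \<le> norm (z + of_real t)" .
    have "Im w * Arg (z + of_real t) \<le> \<bar>Im w * Arg (z + of_real t)\<bar>" by simp
    also have "\<dots> \<le> \<bar>Im w\<bar> * pi"
      unfolding abs_mult
      by (rule mult_left_mono) (use Arg_bounded[of "z + of_real t"] in auto)
    finally have "norm ((z + of_real t) powr (-w)) \<le> Re z powr (- Re w) * exp (pi * \<bar>Im w\<bar>)"
      unfolding norm_powr_complex
      using le assms(2,4) powr_mono2'[of "- Re w" "Re z" "norm (z + of_real t)"]
      by (intro mult_mono) (auto simp: mult.commute)
    then show "norm (\<beta> t * (z + of_real t) powr (-w)) \<le> B * (exp (pi * \<bar>Im w\<bar>) * Re z powr (- Re w))"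
      unfolding norm_mult
      using assms(3)[OF t] order_trans[OF norm_ge_zero assms(3)[OF t]]
      by (intro mult_mono) (auto simp: mult.commute)
  qed auto
  then show ?thesis by simp
qed

lemma powr_integral_diff:
  assumes "continuous_on {0..1} \<beta>" "continuous_on {0..1} \<gamma>" "Re z > 0"
  shows "powr_integral (\<lambda>t. \<beta> t - \<gamma> t) w z = powr_integral \<beta> w z - powr_integral \<gamma> w z"
  unfolding powr_integral_def left_diff_distrib
  by (intro integral_diff integrable_continuous_real continuous_on_powr_integrand assms)

lemma powr_integral_cmult:
  "powr_integral (\<lambda>t. c * \<beta> t) w z = c * powr_integral \<beta> w z"
  unfolding powr_integral_def mult.assoc by (rule integral_mult_right)

text \<open>Each use replaces the weight by an antiderivative and raises the exponent by one; this
  gains decay in z and so enlarges half planes of convergence.\<close>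

lemma powr_integral_by_parts:
  assumes "\<And>t. t \<in> {0..1} \<Longrightarrow> (B has_vector_derivative b t) (at t within {0..1})"
    and "continuous_on {0..1} b" "Re z > 0"
  shows "powr_integral b w z = B 1 * (z + 1) powr (-w) - B 0 * z powr (-w) + w * powr_integral B (w + 1) z"
proof -
  have contB: "continuous_on {0..1} B"
    using assms(1) by (rule continuous_on_vector_derivative)
  have nz: "z + of_real t \<notin> \<real>\<^sub>\<le>\<^sub>0" if "t \<ge> 0" for t
    using assms(3) that by (auto simp: complex_nonpos_Reals_iff)
  have "((\<lambda>t. B t * (-w * (z + of_real t) powr (-w - 1)) + b t * (z + of_real t) powr (-w))
          has_integral (B 1 * (z + of_real 1) powr (-w) - B 0 * (z + of_real 0) powr (-w))) {0..1}"
  proof (rule fundamental_theorem_of_calculus)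
    fix t :: real assume t: "t \<in> {0..1}"
    have "((\<lambda>t. (z + of_real t) powr (-w)) has_vector_derivative
            1 * (-w * (z + of_real t) powr (-w - 1))) (at t within {0..1})"
    proof (rule field_vector_diff_chain_within[where f = "\<lambda>t. z + of_real t" and g = "\<lambda>u. u powr (-w)", unfolded o_def])
      show "((\<lambda>t. z + of_real t) has_vector_derivative 1) (at t within {0..1})"
        by (auto intro!: derivative_eq_intros has_vector_derivative_of_real)
      show "((\<lambda>u. u powr - w) has_field_derivative - w * (z + of_real t) powr (- w - 1))
              (at (z + of_real t) within (\<lambda>t. z + of_real t) ` {0..1})"
        by (rule has_field_derivative_at_within, rule has_field_derivative_powr) (use nz[of t] t in auto)
    qed
    from has_vector_derivative_mult[OF assms(1)[OF t] this]
    show "((\<lambda>t. B t * (z + of_real t) powr (-w)) has_vector_derivative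
           B t * (-w * (z + of_real t) powr (-w - 1)) + b t * (z + of_real t) powr (-w)) (at t within {0..1})"
      by simp
  qed auto
  then have "B 1 * (z + 1) powr (-w) - B 0 * z powr (-w) =
     integral {0..1} (\<lambda>t. B t * (-w * (z + of_real t) powr (-w - 1)) + b t * (z + of_real t) powr (-w))"
    by (simp add: has_integral_iff)
  also have "(\<lambda>t. B t * (-w * (z + of_real t) powr (-w - 1)) + b t * (z + of_real t) powr (-w)) =
     (\<lambda>t. b t * (z + of_real t) powr (-w) - w * (B t * (z + of_real t) powr (-(w + 1))))"
  proof -
    have "-(w + 1) = -w - 1" by simp
    then show ?thesis by (simp only:) (simp add: fun_eq_iff algebra_simps)
  qed
  also have "integral {0..1} \<dots> = powr_integral b w z - w * powr_integral B (w + 1) z"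
  proof -
    have "(\<lambda>t. b t * (z + of_real t) powr (-w)) integrable_on {0..1}"
      by (intro integrable_continuous_real continuous_on_powr_integrand assms)
    moreover have "(\<lambda>t. w * (B t * (z + of_real t) powr (-(w + 1)))) integrable_on {0..1}"
      by (intro integrable_continuous_real continuous_on_mult_left continuous_on_powr_integrand assms contB)
    ultimately show ?thesis
      unfolding powr_integral_def by (simp only: integral_diff integral_mult_right)
  qed
  finally show ?thesis by (simp add: algebra_simps)
qed

lemma powr_integral_one:
  assumes "Re z > 0"
  shows "(w - 1) * powr_integral (\<lambda>_. 1) w z = z powr (1 - w) - (z + 1) powr (1 - w)"
proof -
  \<comment> \<open>The weight 0 has the constant 1 as an antiderivative; this gives the formula
    without a division by w - 1.\<close>
  have "powr_integral (\<lambda>_. 0) (w - 1) z = 1 * (z + 1) powr (-(w - 1)) - 1 * z powr (-(w - 1)) +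
          (w - 1) * powr_integral (\<lambda>_. 1) (w - 1 + 1) z"
    by (rule powr_integral_by_parts) (use assms in auto)
  then show ?thesis by (simp add: powr_integral_def algebra_simps)
qed

section \<open>The zeta function and the Stieltjes constants\<close>

lemma summable_Suc_powr:
  assumes "a > 1"
  shows "summable (\<lambda>n. real (Suc n) powr (-a))"
proof -
  have "summable (\<lambda>n. real n powr (-a))"
    using assms by (simp only: summable_real_powr_iff)
  then show ?thesis by (simp only: summable_Suc_iff[where f = "\<lambda>n. real n powr (-a)"])
qed

text \<open>One factor is constant on bounded sets of w, the other,
  \<open>N powr (-\<sigma>)\<close>, is left for summation. Splitting the lower bound c N with c <=
  1 <= N permits the worst exponent for each: -S for c and -\<sigma> for N.\<close>

lemma norm_powr_integral_uniform:
  assumes "continuous_on {0..1} \<beta>" "\<And>t. t \<in> {0..1} \<Longrightarrow> norm (\<beta> t) \<le> B"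
    and "0 < c" "c \<le> 1" "1 \<le> N" "c * N \<le> Re z" "0 \<le> \<sigma>" "\<sigma> \<le> Re w" "norm w \<le> S"
  shows "norm (powr_integral \<beta> w z) \<le> B * exp (pi * S) * c powr (-S) * N powr (-\<sigma>)"
proof -
  have B: "B \<ge> 0" using assms(2)[of 0] by (rule order_trans[rotated]) auto
  have z: "0 < c * N" using assms(3,5) by simp
  have S: "\<bar>Im w\<bar> \<le> S" "Re w \<le> S"
    using abs_Im_le_cmod[of w] complex_Re_le_cmod[of w] assms(9) by linarith+
  have "Re z powr (- Re w) \<le> (c * N) powr (- Re w)"
    by (rule powr_mono2') (use assms z in auto)
  also have "\<dots> = c powr (- Re w) * N powr (- Re w)"
    using assms(3,5) by (simp add: powr_mult)
  also have "\<dots> \<le> c powr (-S) * N powr (-\<sigma>)"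
    by (intro mult_mono powr_mono' powr_mono) (use assms S in auto)
  finally have *: "Re z powr (- Re w) \<le> c powr (-S) * N powr (-\<sigma>)" .
  have "norm (powr_integral \<beta> w z) \<le> B * (exp (pi * \<bar>Im w\<bar>) * Re z powr (- Re w))"
    by (rule norm_powr_integral_le[OF assms(1) _ assms(2)]) (use z assms(6-8) in linarith)+
  also have "\<dots> \<le> B * (exp (pi * S) * (c powr (-S) * N powr (-\<sigma>)))"
    by (intro mult_left_mono mult_mono *) (use B S in auto)
  finally show ?thesis by (simp add: mult_ac)
qed

text \<open>Half the distance to the line Re = \<sigma> serves as radius of domination: on this disc
  real parts keep a fixed margin above \<sigma>.\<close>

lemma dist_le_half_plane:
  assumes "dist z w \<le> (Re z - \<sigma>) / 2"
  shows "(Re z + \<sigma>) / 2 \<le> Re w" "norm w \<le> norm z + (Re z - \<sigma>) / 2"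
proof -
  have "Re (z - w) \<le> (Re z - \<sigma>) / 2"
    using complex_Re_le_cmod[of "z - w"] assms by (simp add: dist_norm)
  then show "(Re z + \<sigma>) / 2 \<le> Re w" by (simp add: field_simps)
  show "norm w \<le> norm z + (Re z - \<sigma>) / 2"
    using norm_triangle_ineq[of z "w - z"] assms by (simp add: dist_norm norm_minus_commute field_simps)
qed

text \<open>The integral over [1, infinity) of u^(-w) against the 1-periodic extension of \<beta>,
  cut at the integers.\<close>

definition powr_series :: "(real \<Rightarrow> complex) \<Rightarrow> complex \<Rightarrow> complex" where
  "powr_series \<beta> w = suminf (\<lambda>n. powr_integral \<beta> w (of_nat (Suc n)))"

lemma powr_series_dominated:
  assumes "continuous_on {0..1} \<beta>" "1 < Re z"
  shows "\<exists>r>0. \<exists>M. summable M \<and> (\<forall>n. \<forall>w\<in>A. dist z w \<le> r \<longrightarrow>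
           norm (powr_integral \<beta> w (of_nat (Suc n))) \<le> M n)"
proof -
  have "bounded (\<beta> ` {0..1})"
    by (rule compact_imp_bounded[OF compact_continuous_image[OF assms(1) compact_Icc]])
  then obtain B where B: "\<And>t. t \<in> {0..1} \<Longrightarrow> norm (\<beta> t) \<le> B"
    unfolding bounded_iff by blast
  define r where "r = (Re z - 1) / 2"
  let ?M = "\<lambda>n. B * exp (pi * (norm z + r)) * 1 powr (-(norm z + r)) * real (Suc n) powr (-((Re z + 1) / 2))"
  have "summable ?M"
    using assms(2) by (intro summable_mult summable_Suc_powr) simp
  moreover have "norm (powr_integral \<beta> w (of_nat (Suc n))) \<le> ?M n" if "dist z w \<le> r" for n w
    by (rule norm_powr_integral_uniform[OF assms(1) B])
       (use dist_le_half_plane[OF that[unfolded r_def]] assms(2) in \<open>auto simp: r_def\<close>)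
  ultimately show ?thesis
    using assms(2) by (intro exI[of _ r] conjI exI[of _ ?M]) (auto simp: r_def)
qed

lemma powr_series_summable:
  assumes "continuous_on {0..1} \<beta>" "1 < Re w"
  shows "summable (\<lambda>n. powr_integral \<beta> w (of_nat (Suc n)))"
proof -
  obtain r M where "r > 0" "summable M" "\<forall>n. \<forall>v\<in>UNIV. dist w v \<le> r \<longrightarrow>
           norm (powr_integral \<beta> v (of_nat (Suc n))) \<le> M n"
    using powr_series_dominated[OF assms, of UNIV] by blast
  then show ?thesis by - (rule summable_comparison_test'[where g = M and N = 0], auto)
qed

lemma holomorphic_powr_series:
  assumes "continuous_on {0..1} \<beta>"
  shows "powr_series \<beta> holomorphic_on {w. Re w > 1}"
  unfolding powr_series_def[abs_def]
proof (rule holomorphic_on_suminf)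
  show "\<exists>r>0. \<exists>M. summable M \<and> (\<forall>n. \<forall>w\<in>{w. Re w > 1}. dist z w \<le> r \<longrightarrow>
           norm (powr_integral \<beta> w (of_nat (Suc n))) \<le> M n)" if "z \<in> {w. Re w > 1}" for z
    by (rule powr_series_dominated[OF assms]) (use that in simp)
qed (auto intro!: holomorphic_powr_integral assms open_halfspace_Re_gt)

lemma powr_tendsto_0:
  assumes "Re w < 0"
  shows "(\<lambda>n. of_nat (Suc n) powr w) \<longlonglongrightarrow> (0 :: complex)"
proof (rule tendsto_norm_zero_cancel)
  have "(\<lambda>n. real (Suc n) powr Re w) \<longlonglongrightarrow> 0"
    using assms by (intro tendsto_neg_powr filterlim_compose[OF filterlim_real_sequentially] filterlim_Suc)
  moreover have "norm (of_nat (Suc n) powr w :: complex) = real (Suc n) powr Re w" for n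
    by (subst norm_powr_real_powr) auto
  ultimately show "(\<lambda>n. norm (of_nat (Suc n) powr w :: complex)) \<longlonglongrightarrow> 0" by simp
qed

text \<open>The series telescopes by \<open>powr_integral_one\<close>. Constant weights are the
  source of the pole at w = 1, which is why the mean of \<beta> is split off later.\<close>

lemma powr_series_const:
  assumes "Re w > 1"
  shows "(w - 1) * powr_series (\<lambda>_. c) w = c"
proof -
  have "(\<lambda>n. of_nat (Suc (Suc n)) powr (1 - w) - of_nat (Suc n) powr (1 - w)) sums (0 - of_nat (Suc 0) powr (1 - w) :: complex)"
    by (intro telescope_sums powr_tendsto_0) (use assms in auto)
  then have "(\<lambda>n. - (of_nat (Suc (Suc n)) powr (1 - w) - of_nat (Suc n) powr (1 - w))) sums (- (0 - of_nat (Suc 0) powr (1 - w)) :: complex)"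
    by (rule sums_minus)
  moreover have "- (of_nat (Suc (Suc n)) powr (1 - w) - of_nat (Suc n) powr (1 - w)) =
                   (w - 1) * powr_integral (\<lambda>_. 1) w (of_nat (Suc n))" for n
    by (subst powr_integral_one) (auto simp: add_ac)
  ultimately have "(\<lambda>n. (w - 1) * powr_integral (\<lambda>_. 1) w (of_nat (Suc n))) sums 1" by simp
  then have "(\<lambda>n. c * ((w - 1) * powr_integral (\<lambda>_. 1) w (of_nat (Suc n)))) sums (c * 1)"
    by (rule sums_mult)
  moreover have "(\<lambda>n. (w - 1) * powr_integral (\<lambda>_. c) w (of_nat (Suc n))) sums ((w - 1) * powr_series (\<lambda>_. c) w)"
    unfolding powr_series_def using assms
    by (intro sums_mult summable_sums powr_series_summable) auto
  moreover have "(w - 1) * powr_integral (\<lambda>_. c) w z = c * ((w - 1) * powr_integral (\<lambda>_. 1) w z)" for z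
    using powr_integral_cmult[of c "\<lambda>_. 1" w z] by simp
  ultimately show ?thesis by (simp add: sums_iff)
qed

text \<open>
  Integrating by parts against the antiderivative of \<open>\<beta>\<close> minus its mean moves the exponent from
  \<open>w\<close> to \<open>w + 1\<close>, so the half plane of holomorphy grows by one at each step.
\<close>
lemma powr_series_step:
  assumes "continuous_on {0..1} \<beta>"
  obtains m B where "continuous_on {0..1} B"
    "\<And>w. Re w > 1 \<Longrightarrow> (w - 1) * powr_series \<beta> w = m + (w - 1) * (w * powr_series B (w + 1))"
proof -
  define m where "m = integral {0..1} \<beta>"
  define B where "B = (\<lambda>t. integral {0..t} (\<lambda>u. \<beta> u - m))"
  have cont: "continuous_on {0..1} (\<lambda>t. \<beta> t - m)"
    by (rule continuous_on_diff[OF assms continuous_on_const])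
  have deriv: "(B has_vector_derivative \<beta> t - m) (at t within {0..1})" if "t \<in> {0..1}" for t
    unfolding B_def by (rule integral_has_vector_derivative[OF cont that])
  \<comment> \<open>Subtracting the mean makes the antiderivative vanish at both ends, so
    integration by parts leaves no boundary terms.\<close>
  have B0: "B 0 = 0" by (simp add: B_def)
  have "integral {0..1} (\<lambda>u. \<beta> u - m) = integral {0..1} \<beta> - integral {0..1::real} (\<lambda>_. m)"
    by (intro integral_diff integrable_continuous_real assms continuous_intros)
  then have B1: "B 1 = 0" unfolding B_def by (simp flip: m_def)
  have contB: "continuous_on {0..1} B"
    by (rule continuous_on_vector_derivative) (rule deriv)
  have eq: "(w - 1) * powr_series \<beta> w = m + (w - 1) * (w * powr_series B (w + 1))" if w: "Re w > 1" for w
  proof -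
    have summand: "powr_integral \<beta> w (of_nat (Suc n)) =
        powr_integral (\<lambda>_. m) w (of_nat (Suc n)) + w * powr_integral B (w + 1) (of_nat (Suc n))" for n
    proof -
      have "powr_integral (\<lambda>t. \<beta> t - m) w (of_nat (Suc n)) = w * powr_integral B (w + 1) (of_nat (Suc n))"
        using powr_integral_by_parts[OF deriv cont, of "of_nat (Suc n)" w] by (simp add: B0 B1)
      moreover have "powr_integral (\<lambda>t. \<beta> t - m) w (of_nat (Suc n)) =
          powr_integral \<beta> w (of_nat (Suc n)) - powr_integral (\<lambda>_. m) w (of_nat (Suc n))"
        by (rule powr_integral_diff) (use assms in auto)
      ultimately show ?thesis by (simp add: algebra_simps)
    qed
    have "(\<lambda>n. powr_integral (\<lambda>_. m) w (of_nat (Suc n)) + w * powr_integral B (w + 1) (of_nat (Suc n)))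
            sums (powr_series (\<lambda>_. m) w + w * powr_series B (w + 1))"
      unfolding powr_series_def
      by (intro sums_add sums_mult summable_sums powr_series_summable contB) (use w in auto)
    then have "powr_series \<beta> w = powr_series (\<lambda>_. m) w + w * powr_series B (w + 1)"
      unfolding summand[symmetric] powr_series_def by (simp add: sums_iff)
    then show ?thesis using powr_series_const[OF w, of m] by (simp add: distrib_left)
  qed
  show thesis by (rule that[OF contB eq])
qed

lemma powr_series_extension:
  assumes "continuous_on {0..1} \<beta>"
  shows "\<exists>f. f holomorphic_on {w. Re w > 1 - real N} \<and>
           (\<forall>w. Re w > 1 \<longrightarrow> f w = (w - 1) * powr_series \<beta> w)"
  using assms
proof (induction N arbitrary: \<beta>)
  case 0
  have "(\<lambda>w. (w - 1) * powr_series \<beta> w) holomorphic_on {w. Re w > 1}"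
    by (rule holomorphic_on_mult[OF _ holomorphic_powr_series[OF 0]]) (intro holomorphic_intros)
  then show ?case by (intro exI[of _ "\<lambda>w. (w - 1) * powr_series \<beta> w"]) simp
next
  case (Suc N)
  obtain m B where B: "continuous_on {0..1} B"
    "\<And>w. Re w > 1 \<Longrightarrow> (w - 1) * powr_series \<beta> w = m + (w - 1) * (w * powr_series B (w + 1))"
    by (rule powr_series_step[OF Suc.prems], rule that)
  obtain f where f: "f holomorphic_on {w. Re w > 1 - real N}"
      "\<And>w. Re w > 1 \<Longrightarrow> f w = (w - 1) * powr_series B w"
    using Suc.IH[OF B(1)] by (elim exE conjE) simp
  have "(\<lambda>w. f (w + 1)) holomorphic_on {w. Re w > 1 - real (Suc N)}"
    by (rule holomorphic_on_compose_gen[OF _ f(1), unfolded o_def])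
       (auto intro!: holomorphic_intros)
  then have "(\<lambda>w. m + (w - 1) * f (w + 1)) holomorphic_on {w. Re w > 1 - real (Suc N)}"
    by (intro holomorphic_intros)
  \<comment> \<open>At w + 1 the factor w - 1 of the induction hypothesis becomes the factor w that
    stands before \<open>powr_series B (w + 1)\<close>.\<close>
  moreover have "m + (w - 1) * f (w + 1) = (w - 1) * powr_series \<beta> w" if "Re w > 1" for w
    using that by (simp add: f(2) B(2))
  ultimately show ?case by (intro exI[of _ "\<lambda>w. m + (w - 1) * f (w + 1)"]) simp
qed

text \<open>Two extensions agree on the smaller half plane by the identity theorem, since both equal
  g for Re w > a. The value at w can therefore be taken from any N whose half plane contains
  w.\<close>

lemma entire_extension:
  fixes g :: "complex \<Rightarrow> complex"
  assumes "\<And>N::nat. \<exists>f. f holomorphic_on {w. Re w > a - real N} \<and> (\<forall>w. Re w > a \<longrightarrow> f w = g w)"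
  obtains F where "F holomorphic_on UNIV" "\<And>w. Re w > a \<Longrightarrow> F w = g w"
proof -
  obtain f where f: "\<And>N. f N holomorphic_on {w. Re w > a - real N}"
      "\<And>N w. Re w > a \<Longrightarrow> f N w = g w"
    using assms by metis
  have agree: "f N w = f M w" if "N \<le> M" "Re w > a - real N" for N M w
  proof (rule analytic_continuation_open[where s = "{w. Re w > a}" and s' = "{w. Re w > a - real N}"
            and f = "f N" and g = "f M"])
    show "f M holomorphic_on {w. Re w > a - real N}"
      using f(1)[of M] by (rule holomorphic_on_subset) (use that(1) in auto)
    show "{w. Re w > a} \<noteq> {}" by (auto intro!: exI[of _ "of_real (a + 1)"])
  qed (use f that(2) in \<open>auto simp: open_halfspace_Re_gt intro!: convex_connected convex_halfspace_Re_gt\<close>)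
  define F where "F = (\<lambda>w. f (nat \<lceil>a - Re w + 1\<rceil>) w)"
  have F: "F w = f N w" if "Re w > a - real N" for N w
  proof -
    define K where "K = nat \<lceil>a - Re w + 1\<rceil>"
    have "real K \<ge> a - Re w + 1" unfolding K_def by (rule order_trans[OF le_of_int_ceiling]) simp
    then have "Re w > a - real K" by simp
    then have "f K w = f N w"
      using agree[of N K w] agree[of K N w] that by (metis nle_le)
    then show ?thesis by (simp add: F_def K_def)
  qed
  show thesis
  proof (rule that)
    show "F holomorphic_on UNIV"
    proof (rule holomorphic_onI)
      fix w :: complex
      obtain N :: nat where N: "real N > a - Re w" using reals_Archimedean2 by blast
      have "F holomorphic_on {w. Re w > a - real N}"
        using f(1)[of N] by (rule holomorphic_transform) (simp add: F)
      moreover have "w \<in> {w. Re w > a - real N}" using N by simp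
      ultimately show "F field_differentiable at w within UNIV"
        using holomorphic_on_imp_differentiable_at open_halfspace_Re_gt by blast
    qed
    show "F w = g w" if "Re w > a" for w
      using F[of 0 w] f(2)[OF that, of 0] that by simp
  qed
qed

lemma zeta_series_summable:
  assumes "Re s > 1"
  shows "summable (\<lambda>m. 1 / of_nat (Suc m) powr s :: complex)"
proof (rule summable_norm_cancel)
  have "norm (1 / of_nat (Suc m) powr s :: complex) = real (Suc m) powr (- Re s)" for m
    by (subst norm_divide, subst norm_powr_real_powr) (auto simp: powr_minus field_simps)
  then show "summable (\<lambda>m. norm (1 / of_nat (Suc m) powr s :: complex))"
    using summable_Suc_powr[OF assms] by simp
qed

text \<open>First order Euler-Maclaurin summation: the antiderivative 1 - t of -1 vanishes at t = 1,
  so integration by parts over an interval between consecutive integers leaves only the power at its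
  left end.\<close>

lemma zeta_series_eq_powr_series:
  assumes "Re s > 1"
  shows "suminf (\<lambda>m. 1 / of_nat (Suc m) powr s) = 1 / (s - 1) + s * powr_series (\<lambda>t. 1 - of_real t) (s + 1)"
proof -
  have cont: "continuous_on {0..1} (\<lambda>t. 1 - complex_of_real t)" by (intro continuous_intros)
  have summand: "1 / of_nat (Suc n) powr s =
      powr_integral (\<lambda>_. 1) s (of_nat (Suc n)) + s * powr_integral (\<lambda>t. 1 - of_real t) (s + 1) (of_nat (Suc n))" for n
  proof -
    have "powr_integral (\<lambda>_. -1) s (of_nat (Suc n)) =
            (1 - of_real 1) * (of_nat (Suc n) + 1) powr (-s) - (1 - of_real 0) * of_nat (Suc n) powr (-s) +
            s * powr_integral (\<lambda>t. 1 - of_real t) (s + 1) (of_nat (Suc n))"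
      by (rule powr_integral_by_parts) (auto intro!: derivative_eq_intros has_vector_derivative_of_real)
    moreover have "powr_integral (\<lambda>_. -1) s (of_nat (Suc n)) = - powr_integral (\<lambda>_. 1) s (of_nat (Suc n))"
      using powr_integral_cmult[of "-1" "\<lambda>_. 1"] by simp
    ultimately show ?thesis by (simp add: powr_minus field_simps)
  qed
  have "(\<lambda>n. powr_integral (\<lambda>_. 1) s (of_nat (Suc n)) + s * powr_integral (\<lambda>t. 1 - of_real t) (s + 1) (of_nat (Suc n)))
          sums (powr_series (\<lambda>_. 1) s + s * powr_series (\<lambda>t. 1 - of_real t) (s + 1))"
    unfolding powr_series_def
    by (intro sums_add sums_mult summable_sums powr_series_summable cont) (use assms in auto)
  then have "suminf (\<lambda>m. 1 / of_nat (Suc m) powr s) = powr_series (\<lambda>_. 1) s + s * powr_series (\<lambda>t. 1 - of_real t) (s + 1)"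
    unfolding summand[symmetric] by (simp add: sums_iff)
  moreover have "powr_series (\<lambda>_. 1) s = 1 / (s - 1)"
    using powr_series_const[OF assms, of 1] assms
    by (subst eq_divide_eq) (auto simp: mult.commute)
  ultimately show ?thesis by simp
qed

lemma zeta_continuation:
  obtains E where "E holomorphic_on UNIV"
    "\<And>s. Re s > 1 \<Longrightarrow> suminf (\<lambda>m. 1 / of_nat (Suc m) powr s) = 1 / (s - 1) + E s"
proof -
  have "continuous_on {0..1} (\<lambda>t. 1 - complex_of_real t)" by (intro continuous_intros)
  then obtain F where F: "F holomorphic_on UNIV"
      "\<And>w. Re w > 1 \<Longrightarrow> F w = (w - 1) * powr_series (\<lambda>t. 1 - of_real t) w"
    using entire_extension[of 1 "\<lambda>w. (w - 1) * powr_series (\<lambda>t. 1 - of_real t) w"] powr_series_extension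
    by blast
  show thesis
  proof (rule that)
    show "(\<lambda>s. F (s + 1)) holomorphic_on UNIV"
      by (rule holomorphic_on_compose_gen[OF _ F(1), unfolded o_def]) (auto intro!: holomorphic_intros)
    show "suminf (\<lambda>m. 1 / of_nat (Suc m) powr s) = 1 / (s - 1) + F (s + 1)" if "Re s > 1" for s
      using that by (simp add: zeta_series_eq_powr_series F(2) del: of_nat_Suc)
  qed
qed

text \<open>The entire function zeta(s) - 1 / (s - 1), determined by the identity theorem. It
  replaces zeta wherever the pole at 1 would interfere.\<close>

definition zeta_regular :: "complex \<Rightarrow> complex" where
  "zeta_regular = (SOME E. E holomorphic_on UNIV \<and>
     (\<forall>s. Re s > 1 \<longrightarrow> suminf (\<lambda>m. 1 / of_nat (Suc m) powr s) = 1 / (s - 1) + E s))"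

lemma zeta_regular:
  "zeta_regular holomorphic_on UNIV \<and>
     (\<forall>s. Re s > 1 \<longrightarrow> suminf (\<lambda>m. 1 / of_nat (Suc m) powr s) = 1 / (s - 1) + zeta_regular s)"
proof -
  let ?P = "\<lambda>E. E holomorphic_on UNIV \<and>
    (\<forall>s. Re s > 1 \<longrightarrow> suminf (\<lambda>m. 1 / of_nat (Suc m) powr s) = 1 / (s - 1) + E s)"
  obtain E where "?P E" by (rule zeta_continuation) blast
  then show ?thesis unfolding zeta_regular_def by (rule someI[of ?P])
qed

lemma holomorphic_zeta_regular: "zeta_regular holomorphic_on A"
  using zeta_regular holomorphic_on_subset[of zeta_regular UNIV A] by blast

lemma zeta_series_eq:
  "Re s > 1 \<Longrightarrow> suminf (\<lambda>m. 1 / of_nat (Suc m) powr s) = 1 / (s - 1) + zeta_regular s"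
  using zeta_regular by blast

text \<open>This resolves the definite description of \<open>riemann_zeta\<close>: uniqueness is the
  identity theorem on the punctured plane, which is connected, together with the prescribed value at
  1.\<close>

lemma riemann_zeta_eq:
  "riemann_zeta s = (if s = 1 then 0 else 1 / (s - 1) + zeta_regular s)"
proof -
  define f where "f = (\<lambda>s. if s = 1 then 0 else 1 / (s - 1) + zeta_regular s)"
  have "riemann_zeta = f"
    unfolding riemann_zeta_def
  proof (rule the_equality)
    have "(\<lambda>s. 1 / (s - 1) + zeta_regular s) holomorphic_on - {1}"
      by (intro holomorphic_intros holomorphic_zeta_regular) auto
    then have "f holomorphic_on - {1}"
      by (rule holomorphic_transform) (simp add: f_def)
    then show "f holomorphic_on - {1} \<and> f 1 = 0 \<and>
        (\<forall>s. 1 < Re s \<longrightarrow> f s = suminf (\<lambda>m. 1 / of_nat (Suc m) powr s))"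
      by (auto simp: f_def zeta_series_eq simp del: of_nat_Suc)
    fix g
    assume g: "g holomorphic_on - {1} \<and> g 1 = 0 \<and>
        (\<forall>s. 1 < Re s \<longrightarrow> g s = suminf (\<lambda>m. 1 / of_nat (Suc m) powr s))"
    have "g s = f s" if "s \<noteq> 1" for s
    proof (rule analytic_continuation_open[where s = "{s. Re s > 1}" and s' = "- {1}" and f = g and g = f])
      show "{s. Re s > 1} \<noteq> {}" by (auto intro!: exI[of _ 2])
      show "connected (- {1 :: complex})" by (rule connected_punctured_universe) simp
    qed (use that g \<open>f holomorphic_on - {1}\<close> in \<open>auto simp: open_halfspace_Re_gt f_def zeta_series_eq simp del: of_nat_Suc\<close>)
    then show "g = f" using g by (auto simp: fun_eq_iff f_def)
  qed
  then have "riemann_zeta s = f s" by (rule fun_cong)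
  then show ?thesis by (simp add: f_def)
qed

text \<open>The sums are known only for z \<noteq> 0, as the defining property of the Stieltjes
  constants excludes s = 1. So the constant coefficient is found as a limit for z -> 0; then a
  factor z is divided out and the induction goes on.\<close>

lemma powser_zero_coeff:
  fixes a :: "nat \<Rightarrow> complex"
  assumes "\<And>z. z \<noteq> 0 \<Longrightarrow> (\<lambda>m. a m * z ^ m) sums 0"
  shows "a m = 0"
  using assms
proof (induction m arbitrary: a)
  case 0
  have "((\<lambda>z. 0) \<longlongrightarrow> a 0) (at (0 :: complex))"
    by (rule powser_limit_0_strong[where s = 1]) (use 0 in auto)
  then show ?case by (metis LIM_const_eq)
next
  case (Suc m)
  have a0: "a 0 = 0"
  proof -
    have "((\<lambda>z. 0) \<longlongrightarrow> a 0) (at (0 :: complex))"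
      by (rule powser_limit_0_strong[where s = 1]) (use Suc.prems in auto)
    then show ?thesis by (metis LIM_const_eq)
  qed
  show ?case
  proof (rule Suc.IH)
    fix z :: complex assume "z \<noteq> 0"
    have "(\<lambda>m. a (Suc m) * z ^ Suc m) sums 0"
      using Suc.prems[OF \<open>z \<noteq> 0\<close>] a0 by (subst sums_Suc_iff) simp
    from sums_mult[OF this, of "1 / z"] show "(\<lambda>m. a (Suc m) * z ^ m) sums 0"
      using \<open>z \<noteq> 0\<close> by simp
  qed
qed

text \<open>Coefficients of a convergent power series are unique, so the definite description of
  \<open>stieltjes\<close> picks out the Taylor coefficients of \<open>zeta_regular\<close> at
  1.\<close>

lemma stieltjes_eq: "stieltjes m = (-1) ^ m * (deriv ^^ m) zeta_regular 1"
proof -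
  let ?g = "\<lambda>m. (-1) ^ m * (deriv ^^ m) zeta_regular 1"
  have zeta: "riemann_zeta s - 1 / (s - 1) = zeta_regular s" if "s \<noteq> 1" for s
    using that by (simp add: riemann_zeta_eq)
  have taylor: "(\<lambda>m. (deriv ^^ m) zeta_regular 1 / fact m * (s - 1) ^ m) sums zeta_regular s" for s
    by (rule holomorphic_power_series[where r = "norm (s - 1) + 1"])
       (auto simp: holomorphic_zeta_regular dist_norm norm_minus_commute)
  have sgn: "(-1) ^ m * ((-1) ^ m * x) = (x :: complex)" for m x
    by (simp flip: mult.assoc power_mult_distrib)
  have "stieltjes = ?g"
    unfolding stieltjes_def
  proof (rule the_equality)
    show "\<forall>s. s \<noteq> 1 \<longrightarrow> (\<lambda>m. (-1) ^ m * ?g m / fact m * (s - 1) ^ m) sums (riemann_zeta s - 1 / (s - 1))"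
      using taylor by (simp add: zeta sgn)
    fix g assume g: "\<forall>s. s \<noteq> 1 \<longrightarrow>
      (\<lambda>m. (-1) ^ m * g m / fact m * (s - 1) ^ m) sums (riemann_zeta s - 1 / (s - 1))"
    define a where "a = (\<lambda>m. (-1) ^ m * g m / fact m - (deriv ^^ m) zeta_regular 1 / fact m)"
    have "(\<lambda>m. a m * z ^ m) sums 0" if "z \<noteq> 0" for z
    proof -
      have "(\<lambda>m. (-1) ^ m * g m / fact m * z ^ m) sums zeta_regular (1 + z)"
        using g[rule_format, of "1 + z"] zeta[of "1 + z"] that by simp
      from sums_diff[OF this taylor[of "1 + z"]] show ?thesis
        by (simp add: a_def left_diff_distrib)
    qed
    then have "a m = 0" for m by (rule powser_zero_coeff)
    then have "(-1) ^ m * g m = (deriv ^^ m) zeta_regular 1" for m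
      by (simp add: a_def)
    then show "g = ?g" using sgn by (metis (no_types, lifting))
  qed
  then show ?thesis by (rule fun_cong)
qed

section \<open>Euler--Maclaurin remainders\<close>

text \<open>
  The error of the trapezoidal rule for \<open>u\<^sup>-\<^sup>s\<close> on \<open>[z, z + 1]\<close>; hence \<open>em_tail s y\<close> below continues
  \<open>\<zeta>(s, y) - y\<^sup>1\<^sup>-\<^sup>s / (s - 1) - y\<^sup>-\<^sup>s / 2\<close> to \<open>Re s > -1\<close>, with decay in \<open>y\<close> that makes the sum over
  \<open>y = m x\<close> converge for \<open>Re s > 0\<close>.
\<close>
definition em_term :: "complex \<Rightarrow> complex \<Rightarrow> complex" where
  "em_term s z = s * (s + 1) / 2 * powr_integral (\<lambda>t. of_real (t * (1 - t))) (s + 2) z"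

definition em_tail :: "complex \<Rightarrow> complex \<Rightarrow> complex" where
  "em_tail s y = suminf (\<lambda>j. em_term s (y + of_nat j))"

text \<open>Two integrations by parts. The first antiderivative, (1 - 2 t) / 2, takes the values 1/2
  and -1/2 at the ends and gives the trapezoidal mean; the second, t (1 - t) / 2, vanishes at both
  ends.\<close>

lemma em_term_times:
  assumes "Re z > 0"
  shows "(s - 1) * em_term s z =
           (s - 1) * ((z powr (-s) + (z + 1) powr (-s)) / 2) - (z powr (1 - s) - (z + 1) powr (1 - s))"
proof -
  let ?b = "\<lambda>t. (1 - 2 * of_real t) / 2 :: complex" and ?B = "\<lambda>t. of_real (t * (1 - t)) / 2 :: complex"
  have "powr_integral ?b (s + 1) z = ?B 1 * (z + 1) powr (-(s + 1)) - ?B 0 * z powr (-(s + 1)) +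
          (s + 1) * powr_integral ?B (s + 1 + 1) z"
    by (rule powr_integral_by_parts)
       (auto intro!: derivative_eq_intros has_vector_derivative_of_real continuous_intros
          has_vector_derivative_real_field assms simp: field_simps)
  also have "powr_integral ?B (s + 1 + 1) z = 1 / 2 * powr_integral (\<lambda>t. of_real (t * (1 - t))) (s + 2) z"
    using powr_integral_cmult[of "1 / 2" "\<lambda>t. of_real (t * (1 - t))" "s + 2" z] by (simp add: add.assoc)
  finally have 1: "s * powr_integral ?b (s + 1) z = em_term s z"
    by (simp add: em_term_def)
  have "powr_integral (\<lambda>_. -1) s z = ?b 1 * (z + 1) powr (-s) - ?b 0 * z powr (-s) + s * powr_integral ?b (s + 1) z"
    by (rule powr_integral_by_parts)
       (auto intro!: derivative_eq_intros has_vector_derivative_of_real assms)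
  moreover have "powr_integral (\<lambda>_. -1) s z = - powr_integral (\<lambda>_. 1) s z"
    using powr_integral_cmult[of "-1" "\<lambda>_. 1"] by simp
  ultimately have "em_term s z = (z powr (-s) + (z + 1) powr (-s)) / 2 - powr_integral (\<lambda>_. 1) s z"
    unfolding 1 by (simp add: field_simps)
  then show ?thesis
    by (simp only: right_diff_distrib powr_integral_one[OF assms])
qed

lemma continuous_on_em_weight: "continuous_on A (\<lambda>t. complex_of_real (t * (1 - t)))"
  by (intro continuous_intros)

lemma holomorphic_em_term:
  assumes "Re z > 0"
  shows "(\<lambda>s. em_term s z) holomorphic_on A"
proof -
  have "(\<lambda>w. powr_integral (\<lambda>t. of_real (t * (1 - t))) w z) holomorphic_on UNIV"
    by (rule holomorphic_powr_integral[OF continuous_on_em_weight assms])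
  then have "(\<lambda>s. powr_integral (\<lambda>t. of_real (t * (1 - t))) (s + 2) z) holomorphic_on A"
    by (rule holomorphic_on_compose_gen[of "\<lambda>s. s + 2", unfolded o_def, rotated])
       (auto intro!: holomorphic_intros)
  then show ?thesis
    unfolding em_term_def[abs_def] by (intro holomorphic_intros) auto
qed

lemma norm_em_term_le:
  assumes "0 < c" "c \<le> 1" "1 \<le> N" "c * N \<le> Re z" "-2 \<le> \<sigma>" "\<sigma> \<le> Re s" "norm s \<le> S"
  shows "norm (em_term s z) \<le> S * (S + 1) / 2 * (exp (pi * (S + 2)) * c powr (-(S + 2))) * N powr (-(\<sigma> + 2))"
proof -
  have S: "norm (s + 1) \<le> S + 1" "norm (s + 2) \<le> S + 2" "0 \<le> S"
    using norm_triangle_ineq[of s 1] norm_triangle_ineq[of s 2] assms(7) order_trans[OF norm_ge_zero assms(7)] by auto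
  have "norm (powr_integral (\<lambda>t. of_real (t * (1 - t))) (s + 2) z) \<le>
          1 * exp (pi * (S + 2)) * c powr (-(S + 2)) * N powr (-(\<sigma> + 2))"
  proof (rule norm_powr_integral_uniform[OF continuous_on_em_weight])
    fix t :: real assume "t \<in> {0..1}"
    then have "t * (1 - t) \<le> 1 * 1" by (intro mult_mono) auto
    then show "norm (complex_of_real (t * (1 - t))) \<le> 1"
      unfolding norm_of_real using \<open>t \<in> {0..1}\<close> by (simp add: abs_mult)
  qed (use assms S in auto)
  moreover have "norm s * norm (s + 1) / 2 \<le> S * (S + 1) / 2"
    by (intro divide_right_mono mult_mono) (use S assms(7) in auto)
  ultimately have "norm s * norm (s + 1) / 2 * norm (powr_integral (\<lambda>t. of_real (t * (1 - t))) (s + 2) z) \<le>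
       S * (S + 1) / 2 * (1 * exp (pi * (S + 2)) * c powr (-(S + 2)) * N powr (-(\<sigma> + 2)))"
    by (intro mult_mono) (use S in auto)
  then show ?thesis by (simp add: em_term_def norm_mult norm_divide mult_ac)
qed

lemma em_term_shift_bound:
  assumes "0 < c" "c \<le> 1" "c \<le> Re y" "-2 \<le> \<sigma>" "\<sigma> \<le> Re s" "norm s \<le> S"
  shows "norm (em_term s (y + of_nat j)) \<le>
     S * (S + 1) / 2 * (exp (pi * (S + 2)) * c powr (-(S + 2))) * real (Suc j) powr (-(\<sigma> + 2))"
proof (rule norm_em_term_le)
  have "c * real (Suc j) \<le> c + 1 * real j"
    using mult_right_mono[OF assms(2), of "real j"] by (simp add: algebra_simps)
  also have "\<dots> \<le> Re (y + of_nat j)" using assms(3) by simp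
  finally show "c * real (Suc j) \<le> Re (y + of_nat j)" .
qed (use assms in auto)

lemma em_tail_dominated:
  assumes "Re y > 0" "Re z > -1"
  shows "\<exists>r>0. \<exists>M. summable M \<and> (\<forall>j. \<forall>s\<in>A. dist z s \<le> r \<longrightarrow> norm (em_term s (y + of_nat j)) \<le> M j)"
proof -
  define r where "r = (Re z - (-1)) / 2"
  define S where "S = norm z + r"
  define c where "c = min 1 (Re y)"
  let ?M = "\<lambda>j. S * (S + 1) / 2 * (exp (pi * (S + 2)) * c powr (-(S + 2))) * real (Suc j) powr (-((Re z + (-1)) / 2 + 2))"
  have "summable ?M"
    by (intro summable_mult summable_Suc_powr) (use assms(2) in \<open>simp add: field_simps\<close>)
  moreover have "norm (em_term s (y + of_nat j)) \<le> ?M j" if "dist z s \<le> r" for s j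
    by (rule em_term_shift_bound)
       (use dist_le_half_plane[OF that[unfolded r_def]] assms in \<open>auto simp: S_def r_def c_def\<close>)
  moreover have "r > 0" using assms(2) by (simp add: r_def)
  ultimately show ?thesis by (intro exI[of _ r] conjI exI[of _ ?M]) auto
qed

lemma em_tail_summable:
  assumes "Re y > 0" "Re s > -1"
  shows "summable (\<lambda>j. em_term s (y + of_nat j))"
proof -
  obtain r M where "r > 0" "summable M"
      "\<forall>j. \<forall>v\<in>UNIV. dist s v \<le> r \<longrightarrow> norm (em_term v (y + of_nat j)) \<le> M j"
    using em_tail_dominated[OF assms, of UNIV] by blast
  then show ?thesis by - (rule summable_comparison_test'[where g = M and N = 0], auto)
qed

lemma holomorphic_em_tail:
  assumes "Re y > 0"
  shows "(\<lambda>s. em_tail s y) holomorphic_on {s. Re s > -1}"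
  unfolding em_tail_def
proof (rule holomorphic_on_suminf)
  show "\<exists>r>0. \<exists>M. summable M \<and> (\<forall>n. \<forall>s\<in>{s. Re s > -1}. dist z s \<le> r \<longrightarrow>
           norm (em_term s (y + of_nat n)) \<le> M n)" if "z \<in> {s. Re s > -1}" for z
    by (rule em_tail_dominated[OF assms]) (use that in simp)
qed (auto intro!: holomorphic_em_term open_halfspace_Re_gt simp: assms add_pos_nonneg)

lemma higher_deriv_em_tail:
  assumes "Re y > 0" "Re s > -1"
  shows "(\<lambda>j. (deriv ^^ m) (\<lambda>s. em_term s (y + of_nat j)) s) sums (deriv ^^ m) (\<lambda>s. em_tail s y) s"
  unfolding em_tail_def
proof (rule higher_deriv_sums)
  show "\<exists>r>0. \<exists>M. summable M \<and> (\<forall>n. \<forall>w\<in>{s. Re s > -1}. dist s w \<le> r \<longrightarrow>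
           norm (em_term w (y + of_nat n)) \<le> M n)"
    by (rule em_tail_dominated[OF assms])
qed (use assms in \<open>auto intro!: holomorphic_em_term open_halfspace_Re_gt simp: add_pos_nonneg\<close>)

text \<open>Here (m + 1) x + j is at least c N with N = m + 1 + j, and the decay N^(-(\<sigma> + 2))
  is shared equally between the two indices. Each gets the exponent \<sigma>/2 + 1 > 1, so inner and
  outer sums both converge once \<sigma> > 0.\<close>

lemma norm_em_tail_le:
  assumes "x > 0" "0 < \<sigma>" "\<sigma> \<le> Re s" "norm s \<le> S"
  shows "norm (em_tail s (of_nat (Suc m) * of_real x)) \<le>
     S * (S + 1) / 2 * (exp (pi * (S + 2)) * min 1 x powr (-(S + 2))) *
       suminf (\<lambda>j. real (Suc j) powr (-(\<sigma> / 2 + 1))) * real (Suc m) powr (-(\<sigma> / 2 + 1))"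
proof -
  define c where "c = min 1 x"
  define K where "K = S * (S + 1) / 2 * (exp (pi * (S + 2)) * c powr (-(S + 2)))"
  have c: "0 < c" "c \<le> 1" "c \<le> x" using assms(1) by (auto simp: c_def)
  have "0 \<le> S" using assms(4) norm_ge_zero order_trans by blast
  then have K: "K \<ge> 0" by (auto simp: K_def)
  let ?p = "\<lambda>j. real (Suc j) powr (-(\<sigma> / 2 + 1))"
  have sum: "summable ?p" by (rule summable_Suc_powr) (use assms(2) in simp)
  have bound: "norm (em_term s (of_nat (Suc m) * of_real x + of_nat j)) \<le> K * ?p m * ?p j" for j
  proof -
    define N where "N = real (Suc m) + real j"
    have "norm (em_term s (of_nat (Suc m) * of_real x + of_nat j)) \<le> K * N powr (-(\<sigma> + 2))"
      unfolding K_def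
    proof (rule norm_em_term_le)
      have "c * N \<le> x * real (Suc m) + 1 * real j"
        unfolding N_def distrib_left by (intro add_mono mult_right_mono) (use c in auto)
      then show "c * N \<le> Re (of_nat (Suc m) * of_real x + of_nat j)" by (simp add: mult.commute)
    qed (use assms c in \<open>auto simp: N_def\<close>)
    also have "N powr (-(\<sigma> + 2)) = N powr (-(\<sigma> / 2 + 1)) * N powr (-(\<sigma> / 2 + 1))"
      by (simp flip: powr_add)
    also have "\<dots> \<le> ?p m * ?p j"
      by (intro mult_mono powr_mono2') (use assms in \<open>auto simp: N_def\<close>)
    finally show ?thesis using K by (simp add: mult.assoc mult_left_mono)
  qed
  have "norm (em_tail s (of_nat (Suc m) * of_real x)) \<le> suminf (\<lambda>j. K * ?p m * ?p j)"
    unfolding em_tail_def by (rule norm_suminf_le) (use bound sum in \<open>auto intro!: summable_mult\<close>)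
  also have "\<dots> = K * ?p m * suminf ?p" by (rule suminf_mult[OF sum])
  finally show ?thesis by (simp add: K_def c_def mult_ac)
qed

section \<open>Remainders summed over the multiples of x\<close>

definition lattice_tail :: "complex \<Rightarrow> real \<Rightarrow> complex" where
  "lattice_tail s x = suminf (\<lambda>m. em_tail s (of_nat (Suc m) * of_real x))"

lemma lattice_tail_dominated:
  assumes "x > 0" "Re z > 0"
  shows "\<exists>r>0. \<exists>M. summable M \<and> (\<forall>m. \<forall>s\<in>A. dist z s \<le> r \<longrightarrow>
           norm (em_tail s (of_nat (Suc m) * of_real x)) \<le> M m)"
proof -
  define r where "r = (Re z - 0) / 2"
  define S where "S = norm z + r"
  define \<sigma> where "\<sigma> = (Re z + 0) / 2"
  let ?M = "\<lambda>m. S * (S + 1) / 2 * (exp (pi * (S + 2)) * min 1 x powr (-(S + 2))) *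
       suminf (\<lambda>j. real (Suc j) powr (-(\<sigma> / 2 + 1))) * real (Suc m) powr (-(\<sigma> / 2 + 1))"
  have "summable ?M"
    by (intro summable_mult summable_Suc_powr) (use assms(2) in \<open>simp add: \<sigma>_def\<close>)
  moreover have "norm (em_tail s (of_nat (Suc m) * of_real x)) \<le> ?M m" if "dist z s \<le> r" for s m
    by (rule norm_em_tail_le[OF assms(1)])
       (use dist_le_half_plane[OF that[unfolded r_def]] assms in \<open>auto simp: S_def r_def \<sigma>_def\<close>)
  moreover have "r > 0" using assms(2) by (simp add: r_def)
  ultimately show ?thesis by (intro exI[of _ r] conjI exI[of _ ?M]) auto
qed

lemma lattice_tail_summable:
  assumes "x > 0" "Re s > 0"
  shows "summable (\<lambda>m. em_tail s (of_nat (Suc m) * of_real x))"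
proof -
  obtain r M where "r > 0" "summable M"
      "\<forall>m. \<forall>v\<in>UNIV. dist s v \<le> r \<longrightarrow> norm (em_tail v (of_nat (Suc m) * of_real x)) \<le> M m"
    using lattice_tail_dominated[OF assms, of UNIV] by blast
  then show ?thesis by - (rule summable_comparison_test'[where g = M and N = 0], auto)
qed

lemma holomorphic_em_tail':
  assumes "x > 0"
  shows "(\<lambda>s. em_tail s (of_nat (Suc m) * of_real x)) holomorphic_on {s. Re s > 0}"
  by (rule holomorphic_on_subset[OF holomorphic_em_tail]) (use assms in \<open>auto simp: add_pos_nonneg\<close>)

lemma holomorphic_lattice_tail:
  assumes "x > 0"
  shows "(\<lambda>s. lattice_tail s x) holomorphic_on {s. Re s > 0}"
  unfolding lattice_tail_def
proof (rule holomorphic_on_suminf)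
  show "\<exists>r>0. \<exists>M. summable M \<and> (\<forall>n. \<forall>s\<in>{s. Re s > 0}. dist z s \<le> r \<longrightarrow>
           norm (em_tail s (of_nat (Suc n) * of_real x)) \<le> M n)" if "z \<in> {s. Re s > 0}" for z
    by (rule lattice_tail_dominated[OF assms]) (use that in simp)
qed (rule open_halfspace_Re_gt holomorphic_em_tail'[OF assms])+

lemma higher_deriv_lattice_tail:
  assumes "x > 0" "Re s > 0"
  shows "(\<lambda>m. (deriv ^^ k) (\<lambda>s. em_tail s (of_nat (Suc m) * of_real x)) s) sums
           (deriv ^^ k) (\<lambda>s. lattice_tail s x) s"
  unfolding lattice_tail_def
proof (rule higher_deriv_sums)
  show "\<exists>r>0. \<exists>M. summable M \<and> (\<forall>n. \<forall>w\<in>{s. Re s > 0}. dist s w \<le> r \<longrightarrow>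
           norm (em_tail w (of_nat (Suc n) * of_real x)) \<le> M n)"
    by (rule lattice_tail_dominated[OF assms])
qed (use assms in \<open>auto intro!: holomorphic_em_tail' open_halfspace_Re_gt simp del: of_nat_Suc\<close>)

section \<open>Derivatives at s = 1 of truncated sums\<close>

lemma higher_deriv_powr_diff:
  fixes c :: complex
  assumes "c \<noteq> 0"
  shows "(deriv ^^ k) (\<lambda>s. c powr (a - s)) = (\<lambda>s. (- Ln c) ^ k * c powr (a - s))"
proof (induction k)
  case (Suc k)
  have "((\<lambda>s. (- Ln c) ^ k * c powr (a - s)) has_field_derivative (- Ln c) ^ Suc k * c powr (a - s)) (at s)" for s
  proof -
    have "((\<lambda>s. c powr (a - s)) has_field_derivative (Ln c * c powr (a - s)) * (-1)) (at s)"
      by (rule DERIV_chain2[OF has_field_derivative_powr_right[OF assms]]) (auto intro!: derivative_eq_intros)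
    from DERIV_cmult[OF this, of "(- Ln c) ^ k"] show ?thesis by (simp add: mult_ac)
  qed
  then have "deriv (\<lambda>s. (- Ln c) ^ k * c powr (a - s)) = (\<lambda>s. (- Ln c) ^ Suc k * c powr (a - s))"
    by (intro ext DERIV_imp_deriv)
  then show ?case using Suc by simp
qed simp

lemma higher_deriv_powr_minus:
  fixes c :: complex
  assumes "c \<noteq> 0"
  shows "(deriv ^^ k) (\<lambda>s. c powr (- s)) s = (- Ln c) ^ k * c powr (- s)"
  using fun_cong[OF higher_deriv_powr_diff[OF assms, of k 0], of s] by simp

lemma holomorphic_on_powr_diff:
  "c \<noteq> 0 \<Longrightarrow> (\<lambda>s. c powr (a - s)) holomorphic_on A" for c :: complex
  by (cases "c = 0") (auto intro!: holomorphic_intros simp: powr_def)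

lemma holomorphic_on_powr_minus:
  "c \<noteq> 0 \<Longrightarrow> (\<lambda>s. c powr (- s)) holomorphic_on A" for c :: complex
  using holomorphic_on_powr_diff[of c 0 A] by simp

text \<open>In Leibniz' rule only the first derivative of s - a survives at a. This is how
  identities multiplied by s - 1 are exploited at s = 1 itself.\<close>

lemma higher_deriv_times_linear:
  assumes "f holomorphic_on A" "open A" "a \<in> A"
  shows "(deriv ^^ k) (\<lambda>s. (s - a) * f s) a = of_nat k * (deriv ^^ (k - 1)) f a"
proof -
  have "(deriv ^^ i) (\<lambda>s. s - a) a = (if i = 1 then 1 else 0)" for i
    using higher_deriv_diff[of "\<lambda>s. s" UNIV "\<lambda>_. a" a i] by simp
  then have "(deriv ^^ k) (\<lambda>s. (s - a) * f s) a =
      (\<Sum>i=0..k. of_nat (k choose i) * (if i = 1 then 1 else 0) * (deriv ^^ (k - i)) f a)"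
    by (subst higher_deriv_mult[OF _ assms(1,2,3)]) (auto intro!: holomorphic_intros)
  also have "\<dots> = (\<Sum>i=0..k. if i = 1 then of_nat (k choose 1) * (deriv ^^ (k - 1)) f a else 0)"
    by (intro sum.cong) auto
  also have "\<dots> = of_nat k * (deriv ^^ (k - 1)) f a"
    by (cases k) simp_all
  finally show ?thesis .
qed

text \<open>The composite trapezoidal rule: inner nodes have weight 1 and the two end nodes 1/2,
  which is the sum over j < M corrected by half the difference of the end values; the integrals
  telescope.\<close>

lemma em_partial_sum:
  assumes "Re y > 0"
  shows "(s - 1) * (\<Sum>j<M. em_term s (y + of_nat j)) =
    (s - 1) * ((\<Sum>j<M. (y + of_nat j) powr (-s)) - (y powr (-s) - (y + of_nat M) powr (-s)) / 2)
      - (y powr (1 - s) - (y + of_nat M) powr (1 - s))"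
proof (induction M)
  case (Suc M)
  have "Re (y + of_nat M) > 0" using assms by (simp add: add_pos_nonneg)
  from em_term_times[OF this, of s] have
    "(s - 1) * (\<Sum>j<Suc M. em_term s (y + of_nat j)) =
     (s - 1) * ((\<Sum>j<M. (y + of_nat j) powr (-s)) - (y powr (-s) - (y + of_nat M) powr (-s)) / 2)
       - (y powr (1 - s) - (y + of_nat M) powr (1 - s)) +
     ((s - 1) * (((y + of_nat M) powr (-s) + (y + of_nat M + 1) powr (-s)) / 2) -
       ((y + of_nat M) powr (1 - s) - (y + of_nat M + 1) powr (1 - s)))"
    by (simp only: sum.lessThan_Suc distrib_left[of "s - 1" "sum _ _"] Suc)
  also have "y + of_nat M + 1 = y + of_nat (Suc M)" by simp
  also have "t * (A - (a - p) / 2) - (Y - P) + (t * ((p + r) / 2) - (P - R)) =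
               t * ((A + p) - (a - r) / 2) - (Y - R)" for t A a p r Y P R :: complex
    by (simp add: field_simps)
  finally show ?case by (simp only: sum.lessThan_Suc)
qed simp

text \<open>Obtained by differentiating \<open>em_partial_sum\<close> \<open>k\<close> times at \<open>s = 1\<close>.\<close>
lemma deriv_em_partial_sum:
  assumes "Re y > 0" "k \<ge> 1"
  defines "L \<equiv> \<lambda>j. Ln (y + of_nat j)"
  shows "(-1) ^ (k - 1) * (\<Sum>j<M. (deriv ^^ (k - 1)) (\<lambda>s. em_term s (y + of_nat j)) 1) =
    (\<Sum>j<M. L j ^ (k - 1) / (y + of_nat j)) - L 0 ^ (k - 1) / y / 2 + L M ^ (k - 1) / (y + of_nat M) / 2
      + (L 0 ^ k - L M ^ k) / of_nat k"
proof -
  have nz: "y + of_nat j \<noteq> 0" "Re (y + of_nat j) > 0" for j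
    using assms(1) by (auto simp: complex_eq_iff)
  have y0: "y \<noteq> 0" using nz(1)[of 0] by simp
  note holo = holomorphic_on_powr_minus[OF nz(1)] holomorphic_on_powr_minus[OF y0]
    holomorphic_on_powr_diff[OF nz(1)] holomorphic_on_powr_diff[OF y0]
  define Q where "Q = (\<lambda>s. \<Sum>j<M. em_term s (y + of_nat j))"
  define f where "f = (\<lambda>s. (\<Sum>j<M. (y + of_nat j) powr (-s)) - 1/2 * (y powr (-s) - (y + of_nat M) powr (-s)))"
  define g where "g = (\<lambda>s. y powr (1 - s) - (y + of_nat M) powr (1 - s))"
  have Q: "Q holomorphic_on UNIV" unfolding Q_def
    by (intro holomorphic_intros holomorphic_em_term nz)
  have f: "f holomorphic_on UNIV" unfolding f_def
    by (intro holomorphic_on_diff holomorphic_on_sum holomorphic_on_mult holo holomorphic_on_const)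
  have g: "g holomorphic_on UNIV" unfolding g_def
    by (intro holomorphic_on_diff holo)
  have dQ: "(deriv ^^ m) Q 1 = (\<Sum>j<M. (deriv ^^ m) (\<lambda>s. em_term s (y + of_nat j)) 1)" for m
    unfolding Q_def by (rule higher_deriv_sum[where A = UNIV]) (auto intro!: holomorphic_em_term nz)
  have df: "(deriv ^^ m) f 1 = (\<Sum>j<M. (- L j) ^ m / (y + of_nat j)) - 1/2 * ((- L 0) ^ m / y - (- L M) ^ m / (y + of_nat M))" for m
  proof -
    have p: "(deriv ^^ m) (\<lambda>s. (y + of_nat j) powr (-s)) 1 = (- L j) ^ m / (y + of_nat j)" for j
      by (subst higher_deriv_powr_minus[OF nz(1)]) (simp add: L_def powr_minus nz divide_simps)
    have h: "(\<lambda>s. y powr (-s) - (y + of_nat M) powr (-s)) holomorphic_on UNIV"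
      by (intro holomorphic_on_diff holo)
    have "(deriv ^^ m) f 1 = (deriv ^^ m) (\<lambda>s. \<Sum>j<M. (y + of_nat j) powr (-s)) 1 -
        (deriv ^^ m) (\<lambda>s. 1/2 * (y powr (-s) - (y + of_nat M) powr (-s))) 1"
      unfolding f_def by (rule higher_deriv_diff[where S = UNIV])
        (intro holomorphic_on_sum holomorphic_on_mult[OF holomorphic_on_const h] holo open_UNIV UNIV_I)+
    also have "(deriv ^^ m) (\<lambda>s. \<Sum>j<M. (y + of_nat j) powr (-s)) 1 = (\<Sum>j<M. (- L j) ^ m / (y + of_nat j))"
      by (subst higher_deriv_sum[where A = UNIV]) (auto intro!: holo simp: p)
    also have "(deriv ^^ m) (\<lambda>s. 1/2 * (y powr (-s) - (y + of_nat M) powr (-s))) 1 =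
        1/2 * (deriv ^^ m) (\<lambda>s. y powr (-s) - (y + of_nat M) powr (-s)) 1"
      by (rule higher_deriv_cmult[OF h]) auto
    also have "(deriv ^^ m) (\<lambda>s. y powr (-s) - (y + of_nat M) powr (-s)) 1 =
        (- L 0) ^ m / y - (- L M) ^ m / (y + of_nat M)"
      using p[of 0] p[of M] by (subst higher_deriv_diff[where S = UNIV]) (auto intro!: holo)
    finally show ?thesis .
  qed
  have dg: "(deriv ^^ m) g 1 = (- L 0) ^ m - (- L M) ^ m" for m
  proof -
    have "(deriv ^^ m) g 1 = (deriv ^^ m) (\<lambda>s. y powr (1 - s)) 1 - (deriv ^^ m) (\<lambda>s. (y + of_nat M) powr (1 - s)) 1"
      unfolding g_def by (rule higher_deriv_diff[where S = UNIV]) (auto intro!: holo)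
    then show ?thesis
      using y0 nz by (simp add: higher_deriv_powr_diff L_def)
  qed
  \<comment> \<open>At s = 1 both sides vanish, so the identity is differentiated before the factor
    s - 1 is removed.\<close>
  have "(\<lambda>s. (s - 1) * Q s) = (\<lambda>s. (s - 1) * f s - g s)"
    unfolding Q_def f_def g_def using em_partial_sum[OF assms(1), of _ M] by (simp add: fun_eq_iff)
  then have "(deriv ^^ k) (\<lambda>s. (s - 1) * Q s) 1 = (deriv ^^ k) (\<lambda>s. (s - 1) * f s - g s) 1"
    by simp
  also have "\<dots> = (deriv ^^ k) (\<lambda>s. (s - 1) * f s) 1 - (deriv ^^ k) g 1"
    by (rule higher_deriv_diff[where S = UNIV]) (auto intro!: holomorphic_intros f g)
  finally have "of_nat k * (deriv ^^ (k - 1)) Q 1 = of_nat k * (deriv ^^ (k - 1)) f 1 - ((- L 0) ^ k - (- L M) ^ k)"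
    by (simp add: higher_deriv_times_linear[OF Q] higher_deriv_times_linear[OF f] dg)
  then have "(deriv ^^ (k - 1)) Q 1 = (deriv ^^ (k - 1)) f 1 - ((- L 0) ^ k - (- L M) ^ k) / of_nat k"
    using assms(2) by (simp add: field_simps)
  then have "(-1) ^ (k - 1) * (deriv ^^ (k - 1)) Q 1 =
      (-1) ^ (k - 1) * (deriv ^^ (k - 1)) f 1 - (-1) ^ (k - 1) * ((- L 0) ^ k - (- L M) ^ k) / of_nat k"
    by (simp add: right_diff_distrib)
  also have "(-1) ^ (k - 1) * (deriv ^^ (k - 1)) f 1 =
      (\<Sum>j<M. L j ^ (k - 1) / (y + of_nat j)) - L 0 ^ (k - 1) / y / 2 + L M ^ (k - 1) / (y + of_nat M) / 2"
  proof -
    have e: "(-1) ^ (k - 1) * ((- L j) ^ (k - 1) / z) = L j ^ (k - 1) / z" for j z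
      by (simp flip: power_mult_distrib)
    have "c * (sum a {..<M} - 1/2 * (b - d)) = (\<Sum>j<M. c * a j) - c * b / 2 + c * d / 2"
      for a :: "nat \<Rightarrow> complex" and b c d
      by (simp add: sum_distrib_left right_diff_distrib)
    then show ?thesis unfolding df by (simp only: e)
  qed
  also have "(-1) ^ (k - 1) * ((- L 0) ^ k - (- L M) ^ k) = - (L 0 ^ k - L M ^ k)"
  proof -
    have "(-1) ^ (k - 1) * (- z) ^ k = - (z ^ k)" for z :: complex
      using assms(2) by (cases k) (simp_all flip: power_mult_distrib mult.assoc)
    then show ?thesis by (simp add: right_diff_distrib)
  qed
  finally show ?thesis
    unfolding dQ by (simp only: minus_divide_left [symmetric] diff_minus_eq_add)
qed

section \<open>The generalized digamma function\<close>

lemma norm_Ln_le: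
  assumes "1 \<le> norm z"
  shows "norm (Ln z) \<le> ln (norm z) + pi"
proof -
  have "z \<noteq> 0" using assms by auto
  have "norm (Ln z) \<le> \<bar>Re (Ln z)\<bar> + \<bar>Im (Ln z)\<bar>" by (rule cmod_le)
  also have "\<bar>Re (Ln z)\<bar> = ln (norm z)" using \<open>z \<noteq> 0\<close> assms by simp
  also have "\<bar>Im (Ln z)\<bar> \<le> pi"
    using mpi_less_Im_Ln[OF \<open>z \<noteq> 0\<close>] Im_Ln_le_pi[OF \<open>z \<noteq> 0\<close>] by simp
  finally show ?thesis by simp
qed

lemma norm_Ln_power_div_le:
  assumes "1 \<le> n" "real n \<le> Re z" "norm z \<le> real n + R"
  shows "norm (Ln z ^ p / z) \<le> (ln (real n + R) + pi) ^ p / real n"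
proof -
  have nz: "real n \<le> norm z" using assms(2) complex_Re_le_cmod[of z] by linarith
  have "norm (Ln z) \<le> ln (norm z) + pi" using nz assms(1) by (intro norm_Ln_le) simp
  also have "ln (norm z) \<le> ln (real n + R)" using nz assms by (intro ln_mono) auto
  finally have "norm (Ln z) \<le> ln (real n + R) + pi" by simp
  then show ?thesis
    unfolding norm_divide norm_power
    using nz assms(1) order_trans[OF norm_ge_zero, of "Ln z" "ln (real n + R) + pi"]
    by (intro frac_le power_mono) auto
qed

text \<open>With u = ln (n + R) + pi, the quotient u^p / exp u tends to 0 while exp u / n tends to
  exp pi.\<close>

lemma ln_power_over_id_tendsto_0:
  fixes R :: real
  shows "(\<lambda>n. (ln (real n + R) + pi) ^ p / real n) \<longlonglongrightarrow> 0"
proof -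
  have shift: "filterlim (\<lambda>n. real n + R) at_top sequentially"
    using filterlim_tendsto_add_at_top[OF tendsto_const[of R] filterlim_real_sequentially]
    by (simp add: add.commute)
  have "filterlim (\<lambda>n. ln (real n + R)) at_top sequentially"
    by (rule filterlim_compose[OF ln_at_top shift])
  then have lim: "filterlim (\<lambda>n. ln (real n + R) + pi) at_top sequentially"
    using filterlim_tendsto_add_at_top[OF tendsto_const[of pi]] by (simp add: add.commute)
  have "(\<lambda>n. (ln (real n + R) + pi) ^ p / exp (ln (real n + R) + pi)) \<longlonglongrightarrow> 0"
    by (rule filterlim_compose[OF tendsto_power_div_exp_0 lim])
  moreover have "(\<lambda>n. exp pi * (1 + R / real n)) \<longlonglongrightarrow> exp pi * (1 + 0)"
    by (intro tendsto_intros lim_const_over_n)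
  ultimately have "(\<lambda>n. (ln (real n + R) + pi) ^ p / exp (ln (real n + R) + pi) * (exp pi * (1 + R / real n))) \<longlonglongrightarrow> 0 * (exp pi * (1 + 0))"
    by (rule tendsto_mult)
  moreover have "\<forall>\<^sub>F n in sequentially. (ln (real n + R) + pi) ^ p / exp (ln (real n + R) + pi) * (exp pi * (1 + R / real n))
      = (ln (real n + R) + pi) ^ p / real n"
    using filterlim_at_top_dense[THEN iffD1, OF shift, rule_format, of 0] eventually_gt_at_top[of 0]
  proof eventually_elim
    case (elim n)
    then have "exp pi * (1 + R / real n) = exp (ln (real n + R) + pi) / real n"
      by (simp add: exp_add field_simps)
    then show ?case by simp
  qed
  ultimately show ?thesis by (simp add: filterlim_cong)
qed

text \<open>A mean value estimate on the convex set \<open>C\<close>, which contains both points and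
  avoids the branch cut. The shift is \<open>Suc n\<close> because the product in
  \<open>gen_Gamma\<close> has the n + 1 factors j = 0, ..., n, so that the trapezoidal sum ends at
  y + n + 1.\<close>

lemma norm_Ln_power_diff_le:
  assumes "1 \<le> n" "0 \<le> Re y" "norm y \<le> R"
  shows "norm (Ln (of_nat n) ^ k - Ln (y + of_nat (Suc n)) ^ k) \<le>
           real k * ((ln (real n + (R + 1)) + pi) ^ (k - 1) / real n) * (R + 1)"
proof -
  define C where "C = {z. real n \<le> Re z} \<inter> cball 0 (real n + (R + 1))"
  have R: "0 \<le> R" using assms(3) norm_ge_zero order_trans by blast
  have conv: "convex C" unfolding C_def by (intro convex_Int convex_halfspace_Re_ge convex_cball)
  have nz: "z \<notin> \<real>\<^sub>\<le>\<^sub>0" if "z \<in> C" for z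
    using that assms(1) by (auto simp: C_def complex_nonpos_Reals_iff)
  have "norm (Ln (of_nat n) ^ k - Ln (y + of_nat (Suc n)) ^ k) \<le>
      (real k * ((ln (real n + (R + 1)) + pi) ^ (k - 1) / real n)) * norm (of_nat n - (y + of_nat (Suc n)))"
  proof (rule field_differentiable_bound[OF conv])
    fix z assume z: "z \<in> C"
    have z0: "z \<noteq> 0" using nz[OF z] by auto
    show "((\<lambda>z. Ln z ^ k) has_field_derivative of_nat k * (Ln z ^ (k - 1) / z)) (at z within C)"
      using nz[OF z] z0 by (auto intro!: derivative_eq_intros simp: field_simps)
    have "norm (Ln z ^ (k - 1) / z) \<le> (ln (real n + (R + 1)) + pi) ^ (k - 1) / real n"
      by (rule norm_Ln_power_div_le) (use z assms in \<open>auto simp: C_def\<close>)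
    then show "norm (of_nat k * (Ln z ^ (k - 1) / z)) \<le> real k * ((ln (real n + (R + 1)) + pi) ^ (k - 1) / real n)"
      unfolding norm_mult norm_of_nat by (rule mult_left_mono) simp
  next
    show "of_nat n \<in> C" using R by (simp add: C_def)
    have "norm (y + of_nat (Suc n)) \<le> norm y + norm (of_nat (Suc n) :: complex)"
      by (rule norm_triangle_ineq)
    also have "\<dots> = norm y + real (Suc n)" by (simp only: norm_of_nat)
    finally show "y + of_nat (Suc n) \<in> C" using assms by (simp add: C_def)
  qed
  also have "\<dots> \<le> real k * ((ln (real n + (R + 1)) + pi) ^ (k - 1) / real n) * (R + 1)"
  proof (rule mult_left_mono)
    show "norm (of_nat n - (y + of_nat (Suc n)) :: complex) \<le> R + 1"
      using norm_triangle_ineq[of y 1] assms(3) by (simp add: norm_minus_commute algebra_simps)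
    have "0 \<le> ln (real n + (R + 1))" using R by (intro ln_ge_zero) simp
    then show "0 \<le> real k * ((ln (real n + (R + 1)) + pi) ^ (k - 1) / real n)" by simp
  qed
  finally show ?thesis .
qed

text \<open>Cauchy's estimate on the circle of radius 1/2 about 1, where Re s >= 1/2 gives the
  exponent 5/2 = 1/2 + 2 and |s| <= 3/2 the constant \<open>S\<close>. Uniformity in y is what makes
  the differentiated series converge uniformly.\<close>

lemma em_term_deriv_bound:
  assumes "0 < \<delta>"
  shows "\<exists>K. \<forall>y j. \<delta> \<le> Re y \<longrightarrow>
    norm ((deriv ^^ m) (\<lambda>s. em_term s (y + of_nat j)) 1) \<le> K * real (Suc j) powr (-(5/2))"
proof -
  define c where "c = min 1 \<delta>"
  have c: "0 < c" "c \<le> 1" "c \<le> \<delta>" using assms by (auto simp: c_def)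
  define S where "S = (3/2 :: real)"
  define K where "K = S * (S + 1) / 2 * (exp (pi * (S + 2)) * c powr (-(S + 2)))"
  have "norm ((deriv ^^ m) (\<lambda>s. em_term s (y + of_nat j)) 1) \<le>
      (fact m * K / (1/2) ^ m) * real (Suc j) powr (-(5/2))" if y: "\<delta> \<le> Re y" for y j
  proof -
    have pos: "Re (y + of_nat j) > 0" using y assms by (simp add: add_pos_nonneg)
    have "norm ((deriv ^^ m) (\<lambda>s. em_term s (y + of_nat j)) 1) \<le>
            fact m * (K * real (Suc j) powr (-(1/2 + 2))) / (1/2) ^ m"
    proof (rule Cauchy_inequality)
      show "(\<lambda>s. em_term s (y + of_nat j)) holomorphic_on ball 1 (1/2)"
        by (rule holomorphic_em_term[OF pos])
      show "continuous_on (cball 1 (1/2)) (\<lambda>s. em_term s (y + of_nat j))"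
        by (rule holomorphic_on_imp_continuous_on[OF holomorphic_em_term[OF pos]])
      fix s :: complex assume s: "norm (1 - s) = 1/2"
      have "1/2 \<le> Re s" using complex_Re_le_cmod[of "1 - s"] s by simp
      moreover have "norm s \<le> norm (1 - (1 - s))" by simp
      then have "norm s \<le> 3/2" using norm_triangle_ineq4[of 1 "1 - s"] s by simp
      ultimately show "norm (em_term s (y + of_nat j)) \<le> K * real (Suc j) powr (-(1/2 + 2))"
        unfolding K_def by (intro em_term_shift_bound) (use c y in \<open>auto simp: S_def\<close>)
    qed simp
    then show ?thesis by (simp add: mult_ac)
  qed
  then show ?thesis by blast
qed

text \<open>The exponents \<open>f n\<close> of the approximating products have derivatives
  \<open>f' n\<close>, which converge uniformly to \<open>g'\<close> by Euler-Maclaurin summation.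
  With convergence at one point, limit and derivative may be exchanged, and the logarithmic
  derivative of the limit is \<open>g'\<close>.\<close>

lemma gen_psi_eq:
  assumes "y > 0"
  shows "gen_psi K (of_real y) =
    (-1) ^ Suc K * (deriv ^^ K) (\<lambda>s. em_tail s (of_real y)) 1
      - Ln (of_real y) ^ K / (2 * of_real y) + Ln (of_real y) ^ Suc K / of_nat (Suc K)"
proof -
  \<comment> \<open>The region must be bounded, keep a distance from the imaginary axis for uniform
    remainder bounds, and contain y as well as the point 1 at which convergence is checked by
    hand.\<close>
  define \<delta> where "\<delta> = min 1 y / 2"
  define R where "R = y + 2"
  have \<delta>: "0 < \<delta>" "\<delta> < 1" "\<delta> < y" using assms by (auto simp: \<delta>_def min_def)
  define S where "S = {z. Re z > \<delta>} \<inter> ball 0 R"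
  have S: "convex S" "open S" "of_real y \<in> S" "1 \<in> S"
    using \<delta> assms unfolding S_def
    by (auto intro!: convex_Int convex_halfspace_Re_gt open_Int open_halfspace_Re_gt simp: R_def)
  have nz: "z + of_nat j \<notin> \<real>\<^sub>\<le>\<^sub>0" "z + of_nat j \<noteq> 0" "Re z > 0" "\<delta> \<le> Re z" "norm z \<le> R" if "z \<in> S" for z j
    using that \<delta> by (auto simp: S_def complex_nonpos_Reals_iff complex_eq_iff)
  define f where "f = (\<lambda>n x. Ln (of_nat n) ^ Suc K / of_nat (Suc K) * x
      + (\<Sum>j=1..n. Ln (of_nat j) ^ Suc K / of_nat (Suc K)) - (\<Sum>j<Suc n. Ln (x + of_nat j) ^ Suc K / of_nat (Suc K)))"
  define f' where "f' = (\<lambda>n x. Ln (of_nat n) ^ Suc K / of_nat (Suc K)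
      - (\<Sum>j<Suc n. Ln (x + of_nat j) ^ K / (x + of_nat j)))"
  define D where "D = (\<lambda>x. (deriv ^^ K) (\<lambda>s. em_tail s x) 1)"
  define D' where "D' = (\<lambda>n x. \<Sum>j<n. (deriv ^^ K) (\<lambda>s. em_term s (x + of_nat j)) 1)"
  define g' where "g' = (\<lambda>x. (-1) ^ Suc K * D x - Ln x ^ K / x / 2 + Ln x ^ Suc K / of_nat (Suc K))"
  have unif_D: "uniform_limit S D' D sequentially"
  proof -
    obtain C where C: "\<And>x j. \<delta> \<le> Re x \<Longrightarrow>
        norm ((deriv ^^ K) (\<lambda>s. em_term s (x + of_nat j)) 1) \<le> C * real (Suc j) powr (-(5/2))"
      using em_term_deriv_bound[OF \<delta>(1), of K] by blast
    have "uniform_limit S D' (\<lambda>x. suminf (\<lambda>j. (deriv ^^ K) (\<lambda>s. em_term s (x + of_nat j)) 1)) sequentially"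
      unfolding D'_def
    proof (rule Weierstrass_m_test)
      show "summable (\<lambda>j. C * real (Suc j) powr (-(5/2)))"
        by (intro summable_mult summable_Suc_powr) simp
    qed (use C nz in blast)
    also have "?this \<longleftrightarrow> uniform_limit S D' D sequentially"
    proof (rule uniform_limit_cong')
      fix x assume "x \<in> S"
      then show "suminf (\<lambda>j. (deriv ^^ K) (\<lambda>s. em_term s (x + of_nat j)) 1) = D x"
        unfolding D_def using higher_deriv_em_tail[of x 1 K] nz(3) by (simp add: sums_iff)
    qed simp
    finally show ?thesis .
  qed
  define e where "e = (\<lambda>n. (ln (real n + (R + 1)) + pi) ^ K / real n)"
  have e: "e \<longlonglongrightarrow> 0" unfolding e_def by (rule ln_power_over_id_tendsto_0)
  \<comment> \<open>Besides the tail of the remainder series there are two errors: the half-weighted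
    last node of the trapezoidal rule, and the replacement of the logarithm of x + n + 1 by that of
    n. Both are controlled by \<open>e n\<close>.\<close>
  have diff_bound: "norm (f' n x - g' x) \<le> norm (D' (Suc n) x - D x) + e n * (R + 2)"
    if "x \<in> S" "1 \<le> n" for n x
  proof -
    have "(-1) ^ K * D' (Suc n) x = (\<Sum>j<Suc n. Ln (x + of_nat j) ^ K / (x + of_nat j)) - Ln x ^ K / x / 2
        + Ln (x + of_nat (Suc n)) ^ K / (x + of_nat (Suc n)) / 2
        + (Ln x ^ Suc K - Ln (x + of_nat (Suc n)) ^ Suc K) / of_nat (Suc K)"
      using deriv_em_partial_sum[OF nz(3)[OF that(1)], of "Suc K" "Suc n"]
      unfolding D'_def by (simp only: diff_Suc_1 of_nat_0 add_0_right)
    then have "f' n x - g' x = (-1) ^ Suc K * (D' (Suc n) x - D x)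
        + Ln (x + of_nat (Suc n)) ^ K / (x + of_nat (Suc n)) / 2
        + (Ln (of_nat n) ^ Suc K - Ln (x + of_nat (Suc n)) ^ Suc K) / of_nat (Suc K)"
      unfolding f'_def g'_def by (simp only: right_diff_distrib power_Suc mult_minus1 diff_divide_distrib minus_mult_left[symmetric]) (simp add: algebra_simps)
    also have "norm \<dots> \<le> norm ((-1) ^ Suc K * (D' (Suc n) x - D x))
        + norm (Ln (x + of_nat (Suc n)) ^ K / (x + of_nat (Suc n)) / 2)
        + norm ((Ln (of_nat n) ^ Suc K - Ln (x + of_nat (Suc n)) ^ Suc K) / of_nat (Suc K))"
      by (rule norm_triangle_le) (rule add_right_mono, rule norm_triangle_ineq)
    also have "norm ((-1) ^ Suc K * (D' (Suc n) x - D x)) = norm (D' (Suc n) x - D x)"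
      by (simp add: norm_mult norm_power)
    also have "norm (Ln (x + of_nat (Suc n)) ^ K / (x + of_nat (Suc n)) / 2) \<le> e n"
    proof -
      have "norm (x + of_nat (Suc n)) \<le> norm x + real (Suc n)"
        by (rule norm_triangle_le) (simp only: norm_of_nat order_refl)
      then have "norm (Ln (x + of_nat (Suc n)) ^ K / (x + of_nat (Suc n))) \<le> e n"
        unfolding e_def
        by (intro norm_Ln_power_div_le) (use that nz[OF that(1)] in auto)
      moreover have "norm (Ln (x + of_nat (Suc n)) ^ K / (x + of_nat (Suc n)) / 2) =
          norm (Ln (x + of_nat (Suc n)) ^ K / (x + of_nat (Suc n))) / 2"
        by (subst norm_divide) simp
      ultimately show ?thesis using norm_ge_zero[of "Ln (x + of_nat (Suc n)) ^ K / (x + of_nat (Suc n))"] by linarith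
    qed
    also have "norm ((Ln (of_nat n) ^ Suc K - Ln (x + of_nat (Suc n)) ^ Suc K) / of_nat (Suc K)) \<le> e n * (R + 1)"
    proof -
      have "norm (Ln (of_nat n) ^ Suc K - Ln (x + of_nat (Suc n)) ^ Suc K) \<le> real (Suc K) * e n * (R + 1)"
        using norm_Ln_power_diff_le[OF that(2), of x R "Suc K"] nz[OF that(1)] by (simp add: e_def)
      then have "norm (Ln (of_nat n) ^ Suc K - Ln (x + of_nat (Suc n)) ^ Suc K) / real (Suc K) \<le> e n * (R + 1)"
        by (subst pos_divide_le_eq) (auto simp: mult_ac)
      then show ?thesis by (simp only: norm_divide norm_of_nat)
    qed
    finally show ?thesis by (simp add: algebra_simps)
  qed
  have "\<exists>g. \<forall>x\<in>S. (\<lambda>n. f n x) \<longlonglongrightarrow> g x \<and> (g has_field_derivative g' x) (at x within S)"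
  proof (rule has_complex_derivative_sequence[OF S(1)])
    fix n x assume x: "x \<in> S"
    show "(f n has_field_derivative f' n x) (at x within S)"
    proof -
      have "((\<lambda>x. Ln (x + of_nat j) ^ Suc K / of_nat (Suc K)) has_field_derivative
          Ln (x + of_nat j) ^ K / (x + of_nat j)) (at x within S)" for j
      proof -
        have "((\<lambda>x. Ln (x + of_nat j)) has_field_derivative 1 / (x + of_nat j)) (at x within S)"
          using nz(1,2)[OF x, of j] by (auto intro!: derivative_eq_intros simp: field_simps)
        from DERIV_cdivide[OF DERIV_power[OF this, of "Suc K"], of "of_nat (Suc K)"] show ?thesis
          by (simp del: of_nat_Suc power_Suc)
      qed
      then have "((\<lambda>x. \<Sum>j<Suc n. Ln (x + of_nat j) ^ Suc K / of_nat (Suc K)) has_field_derivative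
          (\<Sum>j<Suc n. Ln (x + of_nat j) ^ K / (x + of_nat j))) (at x within S)"
        by (intro DERIV_sum)
      moreover have "((\<lambda>x. a * x + b) has_field_derivative a) (at x within S)" for a b
        by (auto intro!: derivative_eq_intros)
      ultimately show ?thesis
        unfolding f_def f'_def by (intro DERIV_diff)
    qed
  next
    fix \<epsilon> :: real assume "0 < \<epsilon>"
    have "\<forall>\<^sub>F n in sequentially. \<forall>x\<in>S. dist (D' n x) (D x) < \<epsilon> / 2"
      using unif_D \<open>0 < \<epsilon>\<close> by (auto dest!: uniform_limitD[where e = "\<epsilon> / 2"])
    then have "\<forall>\<^sub>F n in sequentially. \<forall>x\<in>S. dist (D' (Suc n) x) (D x) < \<epsilon> / 2"
      by (rule eventually_compose_filterlim[OF _ filterlim_Suc])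
    moreover have "(\<lambda>n. e n * (R + 2)) \<longlonglongrightarrow> 0"
      using tendsto_mult_right[OF e, of "R + 2"] by simp
    then have "\<forall>\<^sub>F n in sequentially. e n * (R + 2) < \<epsilon> / 2"
      by (rule order_tendstoD(2)) (use \<open>0 < \<epsilon>\<close> in simp)
    ultimately have "\<forall>\<^sub>F n in sequentially. \<forall>x\<in>S. norm (f' n x - g' x) \<le> \<epsilon>"
      using eventually_ge_at_top[of 1]
    proof eventually_elim
      case (elim n)
      show ?case
      proof
        fix x assume "x \<in> S"
        with elim(1) have "norm (D' (Suc n) x - D x) < \<epsilon> / 2" by (simp add: dist_norm)
        with elim(2) diff_bound[OF \<open>x \<in> S\<close> elim(3)] show "norm (f' n x - g' x) \<le> \<epsilon>" by linarith
      qed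
    qed
    then show "\<exists>N. \<forall>n x. N \<le> n \<longrightarrow> x \<in> S \<longrightarrow> norm (f' n x - g' x) \<le> \<epsilon>"
      by (auto simp: eventually_sequentially)
  next
    \<comment> \<open>At x = 1 the two sums cancel except for one last term. The summand 0 matches
      \<open>norm_Ln_power_diff_le\<close> with y = 0.\<close>
    have f1: "f n 1 = (Ln (of_nat n) ^ Suc K - Ln (0 + of_nat (Suc n)) ^ Suc K) / of_nat (Suc K)" for n
    proof -
      have "(\<Sum>j<Suc n. Ln (1 + of_nat j) ^ Suc K / of_nat (Suc K)) =
            (\<Sum>j=1..Suc n. Ln (of_nat j) ^ Suc K / of_nat (Suc K))"
        by (rule sum.reindex_bij_witness[of _ "\<lambda>j. j - 1" Suc]) auto
      then show ?thesis unfolding f_def by (simp add: diff_divide_distrib del: of_nat_Suc power_Suc)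
    qed
    have "(\<lambda>n. f n 1) \<longlonglongrightarrow> 0"
    proof (rule Lim_null_comparison)
      show "\<forall>\<^sub>F n in sequentially. norm (f n 1) \<le> e n * (R + 1)"
        using eventually_ge_at_top[of 1]
      proof eventually_elim
        case (elim n)
        have "norm (Ln (of_nat n) ^ Suc K - Ln (0 + of_nat (Suc n)) ^ Suc K) \<le> real (Suc K) * e n * (R + 1)"
          using norm_Ln_power_diff_le[OF elim, of 0 R "Suc K"] assms by (simp add: e_def R_def)
        then have "norm (Ln (of_nat n) ^ Suc K - Ln (0 + of_nat (Suc n)) ^ Suc K) / real (Suc K) \<le> e n * (R + 1)"
          by (subst pos_divide_le_eq) (auto simp: mult_ac)
        then show ?case by (simp only: f1 norm_divide norm_of_nat)
      qed
      show "(\<lambda>n. e n * (R + 1)) \<longlonglongrightarrow> 0"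
        using tendsto_mult_right[OF e, of "R + 1"] by simp
    qed
    then show "\<exists>x l. x \<in> S \<and> (\<lambda>n. f n x) \<longlonglongrightarrow> l" using S(4) by blast
  qed
  then obtain g where g: "\<And>x. x \<in> S \<Longrightarrow> (\<lambda>n. f n x) \<longlonglongrightarrow> g x"
      "\<And>x. x \<in> S \<Longrightarrow> (g has_field_derivative g' x) (at x within S)" by blast
  have Gamma: "gen_Gamma K x = exp (g x)" if "x \<in> S" for x
  proof -
    have "exp (Ln (of_nat n) ^ (K + 1) / of_nat (K + 1) * x)
       * (\<Prod>j=1..n. exp (Ln (of_nat j) ^ (K + 1) / of_nat (K + 1)))
       / (\<Prod>j=0..n. exp (Ln (of_nat j + x) ^ (K + 1) / of_nat (K + 1))) = exp (f n x)" for n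
    proof -
      have "{0..n} = {..<Suc n}" by auto
      then show ?thesis
        unfolding f_def by (simp only: exp_diff exp_add exp_sum[OF finite_lessThan] exp_sum[OF finite_atLeastAtMost] Suc_eq_plus1 add.commute)
    qed
    then show ?thesis
      unfolding gen_Gamma_def using tendsto_exp[OF g(1)[OF that]] by (simp add: limI)
  qed
  have "((\<lambda>x. exp (g x)) has_field_derivative exp (g (of_real y)) * g' (of_real y)) (at (of_real y))"
    using g(2)[OF S(3)] unfolding at_within_open[OF S(3,2)]
    by (rule DERIV_chain2[OF DERIV_exp])
  then have "(gen_Gamma K has_field_derivative exp (g (of_real y)) * g' (of_real y)) (at (of_real y))"
    by (rule has_field_derivative_transform_within_open[OF _ S(2,3)]) (simp add: Gamma)
  then have "gen_psi K (of_real y) = g' (of_real y)"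
    unfolding gen_psi_def by (simp add: DERIV_imp_deriv Gamma[OF S(3)])
  then show ?thesis by (simp add: g'_def D_def mult.commute)
qed

section \<open>The period function of the Eisenstein series\<close>

definition hurwitz_series :: "complex \<Rightarrow> real \<Rightarrow> complex" where
  "hurwitz_series s y = suminf (\<lambda>j. (of_real y + of_nat j) powr (-s))"

lemma norm_powr_shift:
  assumes "y > 0"
  shows "norm ((of_real y + of_nat j) powr (-s)) = (y + real j) powr (- Re s)"
  using assms by (subst norm_powr_real_powr) auto

lemma hurwitz_series_summable:
  assumes "y > 0" "Re s > 1"
  shows "summable (\<lambda>j. norm ((of_real y + of_nat j) powr (-s)))"
proof (rule summable_comparison_test')
  define c where "c = min 1 y"
  have c: "0 < c" "c \<le> 1" "c \<le> y" using assms(1) by (auto simp: c_def)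
  show "summable (\<lambda>j. c powr (- Re s) * real (Suc j) powr (- Re s))"
    by (intro summable_mult summable_Suc_powr assms)
  fix j
  have "c * real (Suc j) \<le> c + 1 * real j"
    using mult_right_mono[OF c(2), of "real j"] by (simp add: algebra_simps)
  also have "\<dots> \<le> y + real j" using c by simp
  finally have "(y + real j) powr (- Re s) \<le> (c * real (Suc j)) powr (- Re s)"
    using c assms by (intro powr_mono2') auto
  also have "\<dots> = c powr (- Re s) * real (Suc j) powr (- Re s)"
    by (rule powr_mult)
  finally show "norm (norm ((of_real y + of_nat j) powr (-s))) \<le> c powr (- Re s) * real (Suc j) powr (- Re s)"
    by (simp only: real_norm_def norm_powr_shift[OF assms(1)] abs_of_nonneg[OF powr_ge_zero])
qed

lemma powr_shift_tendsto_0: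
  assumes "y > 0" "Re s < 0"
  shows "(\<lambda>n. (of_real y + of_nat n) powr s) \<longlonglongrightarrow> (0 :: complex)"
proof (rule tendsto_norm_zero_cancel)
  have "filterlim (\<lambda>n. y + real n) at_top sequentially"
    using filterlim_tendsto_add_at_top[OF tendsto_const[of y] filterlim_real_sequentially] .
  then have "(\<lambda>n. (y + real n) powr Re s) \<longlonglongrightarrow> 0"
    using assms(2) by (intro tendsto_neg_powr)
  then show "(\<lambda>n. norm ((of_real y + of_nat n) powr s :: complex)) \<longlonglongrightarrow> 0"
    using norm_powr_shift[OF assms(1), of _ "-s"] by simp
qed

lemma em_tail_eq_hurwitz_series:
  assumes "y > 0" "Re s > 1"
  shows "(s - 1) * em_tail s (of_real y) =
    (s - 1) * (hurwitz_series s y - of_real y powr (-s) / 2) - of_real y powr (1 - s)"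
proof -
  have "(\<lambda>M. \<Sum>j<M. em_term s (of_real y + of_nat j)) \<longlonglongrightarrow> em_tail s (of_real y)"
    unfolding em_tail_def by (rule summable_LIMSEQ, rule em_tail_summable) (use assms in auto)
  then have "(\<lambda>M. (s - 1) * (\<Sum>j<M. em_term s (of_real y + of_nat j))) \<longlonglongrightarrow> (s - 1) * em_tail s (of_real y)"
    by (rule tendsto_mult_left)
  moreover have "(\<lambda>M. \<Sum>j<M. (of_real y + of_nat j) powr (-s)) \<longlonglongrightarrow> hurwitz_series s y"
    unfolding hurwitz_series_def
    by (rule summable_LIMSEQ, rule summable_norm_cancel, rule hurwitz_series_summable[OF assms])
  then have "(\<lambda>M. (s - 1) * ((\<Sum>j<M. (of_real y + of_nat j) powr (-s)) -
        (of_real y powr (-s) - (of_real y + of_nat M) powr (-s)) / 2)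
        - (of_real y powr (1 - s) - (of_real y + of_nat M) powr (1 - s)))
      \<longlonglongrightarrow> (s - 1) * (hurwitz_series s y - (of_real y powr (-s) - 0) / 2) - (of_real y powr (1 - s) - 0)"
    by (intro tendsto_intros powr_shift_tendsto_0) (use assms in auto)
  ultimately show ?thesis
    using em_partial_sum[of "of_real y" s] assms(1) by (simp add: LIMSEQ_unique)
qed

lemma hurwitz_series_1:
  assumes "Re s > 1"
  shows "hurwitz_series s 1 = 1 / (s - 1) + zeta_regular s"
  unfolding zeta_series_eq[OF assms, symmetric] hurwitz_series_def
  by (intro arg_cong[where f = suminf] ext) (simp add: powr_minus field_simps)

text \<open>For Re s > 1 this is \<open>em_tail_eq_hurwitz_series\<close> at y = 1, and the identity
  theorem does the rest. The larger half plane contains s = 0, where the remainder vanishes by its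
  factor s, so that zeta(0) can be read off.\<close>

lemma zeta_regular_eq_em_tail:
  assumes "Re s > -1"
  shows "zeta_regular s = 1 / 2 + em_tail s 1"
proof (rule analytic_continuation_open[where s = "{s. Re s > 1}" and s' = "{s. Re s > -1}"
      and f = zeta_regular and g = "\<lambda>s. 1 / 2 + em_tail s 1"])
  show "{s. Re s > 1} \<noteq> {}" by (auto intro!: exI[of _ 2])
  show "(\<lambda>s. 1 / 2 + em_tail s 1) holomorphic_on {s. Re s > -1}"
    by (intro holomorphic_intros holomorphic_em_tail) auto
  fix s :: complex assume s: "s \<in> {s. Re s > 1}"
  then have "s - 1 \<noteq> 0" by auto
  have "(s - 1) * em_tail s 1 = (s - 1) * (1 / (s - 1) + zeta_regular s - 1 / 2) - 1"
    using em_tail_eq_hurwitz_series[of 1 s] hurwitz_series_1[of s] s by simp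
  also have "\<dots> = (s - 1) * (zeta_regular s - 1 / 2)"
    using \<open>s - 1 \<noteq> 0\<close> by (simp add: field_simps)
  finally show "zeta_regular s = 1 / 2 + em_tail s 1" using \<open>s - 1 \<noteq> 0\<close> by simp
qed (use assms in \<open>auto simp: holomorphic_zeta_regular intro!: open_halfspace_Re_gt convex_connected convex_halfspace_Re_gt\<close>)

lemma riemann_zeta_0: "riemann_zeta 0 = - 1 / 2"
proof -
  have "em_tail 0 1 = 0" by (simp add: em_tail_def em_term_def)
  then have "zeta_regular 0 = 1 / 2" using zeta_regular_eq_em_tail[of 0] by simp
  then have "riemann_zeta 0 = 1 / (0 - 1) + 1 / 2" by (simp only: riemann_zeta_eq) simp
  then show ?thesis by simp
qed

lemma holomorphic_riemann_zeta: "riemann_zeta holomorphic_on - {1}"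
proof (rule holomorphic_transform)
  show "(\<lambda>s. 1 / (s - 1) + zeta_regular s) holomorphic_on - {1}"
    by (intro holomorphic_intros holomorphic_zeta_regular) auto
qed (simp add: riemann_zeta_eq)

lemma holomorphic_riemann_zeta_shift:
  assumes "2 \<notin> A"
  shows "(\<lambda>s. riemann_zeta (s - 1)) holomorphic_on A"
  by (rule holomorphic_on_compose_gen[OF _ holomorphic_riemann_zeta, unfolded o_def])
     (use assms in \<open>auto intro!: holomorphic_intros simp: eq_diff_eq\<close>)

text \<open>
  This is \<open>s - 1\<close> times the period function \<open>\<zeta>(s) (1 + x\<^sup>-\<^sup>s) / 2 + \<Sum> (m x + n)\<^sup>-\<^sup>s\<close> (sum over
  \<open>m, n \<ge> 1\<close>) of the nonholomorphic Eisenstein series, continued to \<open>Re s > 0\<close>. The factor removes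
  the quotient \<open>1 / (s - 1)\<close>, whose singularity at \<open>s = 1\<close> is removable because \<open>\<zeta>(0) = -1/2\<close>.
\<close>
definition eisenstein_period :: "complex \<Rightarrow> real \<Rightarrow> complex" where
  "eisenstein_period s x =
     (s - 1) * (lattice_tail s x + zeta_regular s / 2) + of_real x powr (1 - s) * riemann_zeta (s - 1) + 1 / 2"

text \<open>The point 2 is a true pole, with residue 1/x, stemming from zeta(s - 1). It lies on the
  boundary of the region of absolute convergence of the lattice sum and has to be bypassed on the
  way to s = 1.\<close>

lemma holomorphic_eisenstein_period:
  assumes "x > 0"
  shows "(\<lambda>s. eisenstein_period s x) holomorphic_on {s. Re s > 0} - {2}"
proof -
  have "(\<lambda>s. lattice_tail s x) holomorphic_on {s. Re s > 0} - {2}"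
    by (rule holomorphic_on_subset[OF holomorphic_lattice_tail[OF assms]]) auto
  moreover have "(\<lambda>s. riemann_zeta (s - 1)) holomorphic_on {s. Re s > 0} - {2}"
    by (rule holomorphic_riemann_zeta_shift) simp
  moreover have "(\<lambda>s. of_real x powr (1 - s)) holomorphic_on {s. Re s > 0} - {2}"
    by (rule holomorphic_on_powr_diff) (use assms in simp)
  ultimately show ?thesis
    unfolding eisenstein_period_def
    by (intro holomorphic_intros holomorphic_zeta_regular) auto
qed

lemma eisenstein_period_at_1: "x > 0 \<Longrightarrow> eisenstein_period 1 x = 0"
  by (simp add: eisenstein_period_def riemann_zeta_0)

text \<open>The terms added to \<open>gen_psi\<close> in \<open>herglotz0\<close> are the negatives
  of the elementary terms in \<open>gen_psi_eq\<close>, so each summand is, up to sign, the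
  derivative of a single Euler-Maclaurin remainder.\<close>

lemma deriv_lattice_tail_at_1:
  assumes "x > 0" "k \<ge> 1"
  shows "(deriv ^^ (k - 1)) (\<lambda>s. lattice_tail s x) 1 = (-1) ^ k * herglotz0 k (of_real x)"
proof -
  obtain K where k: "k = Suc K" using assms(2) by (cases k) auto
  define h where "h = (\<lambda>m. let y = of_nat (Suc m) * of_real x in
     gen_psi (k - 1) y + Ln y ^ (k - 1) / (2 * y) - Ln y ^ k / of_nat k)"
  have sgn: "(-1) ^ n * ((-1) ^ n * z) = z" for n and z :: complex
    by (simp flip: mult.assoc power_mult_distrib)
  have "h m = (-1) ^ k * (deriv ^^ (k - 1)) (\<lambda>s. em_tail s (of_nat (Suc m) * of_real x)) 1" for m
  proof -
    have y: "of_nat (Suc m) * of_real x = complex_of_real (real (Suc m) * x)" by simp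
    show ?thesis
      unfolding h_def Let_def y using gen_psi_eq[of "real (Suc m) * x" K] assms(1)
      by (simp add: k del: of_nat_Suc power_Suc of_real_mult)
  qed
  then have h: "(-1) ^ k * h m = (deriv ^^ (k - 1)) (\<lambda>s. em_tail s (of_nat (Suc m) * of_real x)) 1" for m
    by (simp only: sgn)
  have "(\<lambda>m. (-1) ^ k * h m) sums (deriv ^^ (k - 1)) (\<lambda>s. lattice_tail s x) 1"
    unfolding h by (rule higher_deriv_lattice_tail) (use assms in auto)
  from sums_mult[OF this, of "(-1) ^ k"]
  have "h sums ((-1) ^ k * (deriv ^^ (k - 1)) (\<lambda>s. lattice_tail s x) 1)"
    by (simp only: sgn)
  then have "herglotz0 k (of_real x) = (-1) ^ k * (deriv ^^ (k - 1)) (\<lambda>s. lattice_tail s x) 1"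
    unfolding herglotz0_def h_def[symmetric] by (simp add: sums_iff)
  then show ?thesis by (simp only: sgn)
qed

text \<open>The parts of \<open>herglotz\<close> arise separately: the lattice tail gives the
  series, \<open>zeta_regular s / 2\<close> the Stieltjes constant, and Leibniz' rule for x^(1-s)
  zeta(s - 1) the derivatives of zeta at 0. The factor k comes from s - 1.\<close>

lemma higher_deriv_eisenstein_period:
  assumes "x > 0"
  shows "(deriv ^^ k) (\<lambda>s. eisenstein_period s x) 1 = - of_nat k * herglotz k (of_real x)"
proof (cases "k = 0")
  case True
  then show ?thesis using assms by (simp add: eisenstein_period_at_1)
next
  case False
  then have k: "k \<ge> 1" by simp
  define A where "A = ({s. Re s > 0} \<inter> ball 1 1 :: complex set)"
  have A: "open A" "1 \<in> A" "2 \<notin> A"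
    unfolding A_def by (auto intro!: open_Int open_halfspace_Re_gt simp: dist_norm)
  have tail: "(\<lambda>s. lattice_tail s x) holomorphic_on A"
    by (rule holomorphic_on_subset[OF holomorphic_lattice_tail[OF assms]]) (auto simp: A_def)
  have zeta: "(\<lambda>s. riemann_zeta (s - 1)) holomorphic_on A"
    by (rule holomorphic_riemann_zeta_shift[OF A(3)])
  have pow: "(\<lambda>s. of_real x powr (1 - s) :: complex) holomorphic_on A"
    by (rule holomorphic_on_powr_diff) (use assms in simp)
  define f where "f = (\<lambda>s. lattice_tail s x + 1 / 2 * zeta_regular s)"
  define h where "h = (\<lambda>s. of_real x powr (1 - s) * riemann_zeta (s - 1))"
  have half: "(\<lambda>s. 1 / 2 * zeta_regular s) holomorphic_on A"
    by (intro holomorphic_on_mult holomorphic_on_const holomorphic_zeta_regular)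
  have f: "f holomorphic_on A" unfolding f_def by (intro holomorphic_on_add tail half)
  have h: "h holomorphic_on A" unfolding h_def by (intro holomorphic_on_mult pow zeta)
  have lf: "(\<lambda>s. (s - 1) * f s) holomorphic_on A" by (intro holomorphic_intros f)
  have "(deriv ^^ k) (\<lambda>s. eisenstein_period s x) 1 = (deriv ^^ k) (\<lambda>s. ((s - 1) * f s + h s) + 1 / 2) 1"
    by (simp add: eisenstein_period_def f_def h_def)
  also have "\<dots> = (deriv ^^ k) (\<lambda>s. (s - 1) * f s + h s) 1 + (deriv ^^ k) (\<lambda>_. 1 / 2) 1"
    by (rule higher_deriv_add[where S = A]) (intro holomorphic_on_add lf h holomorphic_on_const A)+
  also have "(deriv ^^ k) (\<lambda>s. (s - 1) * f s + h s) 1 = (deriv ^^ k) (\<lambda>s. (s - 1) * f s) 1 + (deriv ^^ k) h 1"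
    by (rule higher_deriv_add[where S = A]) (intro lf h A)+
  also have "(deriv ^^ k) (\<lambda>s. (s - 1) * f s) 1 = of_nat k * (deriv ^^ (k - 1)) f 1"
    by (rule higher_deriv_times_linear[OF f A(1,2)])
  also have "(deriv ^^ (k - 1)) f 1 = (deriv ^^ (k - 1)) (\<lambda>s. lattice_tail s x) 1
      + (deriv ^^ (k - 1)) (\<lambda>s. 1 / 2 * zeta_regular s) 1"
    unfolding f_def by (rule higher_deriv_add[OF tail half A(1,2)])
  also have "(deriv ^^ (k - 1)) (\<lambda>s. 1 / 2 * zeta_regular s) 1 = 1 / 2 * (deriv ^^ (k - 1)) zeta_regular 1"
    by (rule higher_deriv_cmult[OF holomorphic_zeta_regular A(2,1)])
  also have "(deriv ^^ (k - 1)) (\<lambda>s. lattice_tail s x) 1 = (-1) ^ k * herglotz0 k (of_real x)"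
    by (rule deriv_lattice_tail_at_1[OF assms k])
  also have "(deriv ^^ k) h 1 = (\<Sum>l=0..k. of_nat (k choose l) * (- Ln (of_real x)) ^ l * (deriv ^^ (k - l)) riemann_zeta 0)"
  proof -
    have "(deriv ^^ j) (\<lambda>s. riemann_zeta (s - 1)) 1 = (deriv ^^ j) riemann_zeta 0" for j
      using higher_deriv_compose_linear'[OF holomorphic_riemann_zeta A(1) _ A(2), of 1 "-1" j] A(3) by auto
    then show ?thesis
      unfolding h_def using assms
      by (subst higher_deriv_mult[OF pow zeta A(1,2)]) (simp add: higher_deriv_powr_diff)
  qed
  also have "\<dots> = of_nat k * (\<Sum>l=0..k. (-1) ^ l / of_nat k * of_nat (k choose l) * Ln (of_real x) ^ l
                   * (deriv ^^ (k - l)) riemann_zeta 0)"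
    unfolding sum_distrib_left using k
    by (intro sum.cong refl) (simp add: power_minus[of "Ln _"])
  also have "(deriv ^^ (k - 1)) zeta_regular 1 = (-1) ^ (k - 1) * stieltjes (k - 1)"
    by (simp add: stieltjes_eq flip: mult.assoc power_mult_distrib)
  also have "(-1) ^ k * herglotz0 k (of_real x) = - ((-1) ^ (k - 1) * herglotz0 k (of_real x))"
    using k by (cases k) simp_all
  also have "(deriv ^^ k) (\<lambda>_. 1 / 2) 1 = 0" using k by simp
  finally show ?thesis
    unfolding herglotz_def by (simp add: algebra_simps)
qed

section \<open>Lattice sums\<close>

text \<open>Interior points have weight 2, nonzero points on the axes 1, the origin 0: twice the
  weights in the period function, and the same sum of signs as in
  \<open>hecke_row_weight\<close>.\<close>

definition quadrant_term :: "complex \<Rightarrow> real \<Rightarrow> nat \<times> nat \<Rightarrow> complex" where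
  "quadrant_term s x = (\<lambda>(m, n). of_int (sgn (int m) + sgn (int n)) * of_real (real m * x + real n) powr (-s))"

text \<open>Away from the origin m + n is at least half of N = m + n + 1, whence the 2 dividing
  \<open>min 1 x\<close>. The exponent is again shared between the two indices.\<close>

lemma norm_quadrant_term_le:
  assumes "x > 0" "Re s > 0"
  shows "norm (quadrant_term s x (m, n)) \<le>
    2 * (min 1 x / 2) powr (- Re s) * (real (Suc m) powr (- (Re s / 2)) * real (Suc n) powr (- (Re s / 2)))"
proof (cases "m = 0 \<and> n = 0")
  case True
  then show ?thesis by (simp add: quadrant_term_def)
next
  case False
  define c where "c = min 1 x"
  define N where "N = real m + real n + 1"
  have c: "0 < c" "c \<le> 1" "c \<le> x" using assms(1) by (auto simp: c_def)
  have mn: "real m + real n \<ge> 1" using False by linarith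
  have "c * 1 \<le> c * (real m + real n)" using c mn by (intro mult_left_mono) auto
  then have "c / 2 * N \<le> c * (real m + real n)" by (simp add: N_def field_simps)
  also have "\<dots> \<le> x * real m + 1 * real n"
    unfolding distrib_left by (intro add_mono mult_right_mono) (use c in auto)
  finally have le: "c / 2 * N \<le> real m * x + real n" by (simp add: mult.commute)
  have pos: "0 < c / 2 * N" using c by (simp add: N_def)
  have "norm (of_real (real m * x + real n) powr (-s) :: complex) = (real m * x + real n) powr (- Re s)"
    using le pos by (subst norm_powr_real_powr) auto
  also have "\<dots> \<le> (c / 2 * N) powr (- Re s)"
    by (rule powr_mono2') (use le pos assms in auto)
  also have "\<dots> = (c / 2) powr (- Re s) * (N powr (- (Re s / 2)) * N powr (- (Re s / 2)))"
    by (subst powr_mult) (simp flip: powr_add)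
  also have "\<dots> \<le> (c / 2) powr (- Re s) * (real (Suc m) powr (- (Re s / 2)) * real (Suc n) powr (- (Re s / 2)))"
    by (intro mult_left_mono mult_mono powr_mono2') (use assms in \<open>auto simp: N_def\<close>)
  finally have *: "norm (of_real (real m * x + real n) powr (-s) :: complex) \<le> \<dots>" .
  have "norm (of_int (sgn (int m) + sgn (int n)) :: complex) \<le> 2"
    unfolding norm_of_int by (auto simp: sgn_if)
  from mult_mono[OF this *] show ?thesis
    by (simp add: quadrant_term_def norm_mult c_def mult.assoc)
qed

lemma quadrant_term_summable:
  assumes "x > 0" "Re s > 2"
  shows "(\<lambda>p. norm (quadrant_term s x p)) summable_on UNIV"
    and "summable (\<lambda>n. norm (quadrant_term s x (m, n)))"
proof -
  let ?C = "2 * (min 1 x / 2) powr (- Re s)" and ?h = "\<lambda>n. real (Suc n) powr (- (Re s / 2))"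
  have h: "summable ?h" by (rule summable_Suc_powr) (use assms(2) in simp)
  have le: "norm (quadrant_term s x (m, n)) \<le> ?C * (?h m * ?h n)" for m n
    by (rule norm_quadrant_term_le) (use assms in auto)
  show "summable (\<lambda>n. norm (quadrant_term s x (m, n)))"
    by (rule summable_comparison_test'[where g = "\<lambda>n. ?C * (?h m * ?h n)" and N = 0])
       (use le h in \<open>auto intro!: summable_mult\<close>)
  have "(\<lambda>(m, n). ?C * (?h m * ?h n)) summable_on Sigma UNIV (\<lambda>_. UNIV)"
  proof (rule summable_on_SigmaI)
    fix m
    have "(\<lambda>n. ?C * (?h m * ?h n)) sums (?C * (?h m * suminf ?h))"
      by (intro sums_mult summable_sums h)
    then show "((\<lambda>n. case (m, n) of (m, n) \<Rightarrow> ?C * (?h m * ?h n)) has_sum ?C * (?h m * suminf ?h)) UNIV"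
      unfolding case_prod_conv
      by (intro norm_summable_imp_has_sum) (auto intro!: summable_mult h simp: abs_mult simp del: of_nat_Suc)
  next
    have "summable (\<lambda>m. ?C * (?h m * suminf ?h))" by (intro summable_mult summable_mult2 h)
    moreover have "0 \<le> suminf ?h" by (rule suminf_nonneg[OF h]) simp
    ultimately show "(\<lambda>m. ?C * (?h m * suminf ?h)) summable_on UNIV"
      by (subst summable_on_UNIV_nonneg_real_iff) auto
  qed auto
  then have "(\<lambda>(m, n). ?C * (?h m * ?h n)) summable_on UNIV" by simp
  then show "(\<lambda>p. norm (quadrant_term s x p)) summable_on UNIV"
    by (rule Infinite_Sum.abs_summable_on_comparison_test') (use le in \<open>auto simp del: of_nat_Suc\<close>)
qed

text \<open>Summation by rows. The row m = 0 is zeta(s). A row m >= 1 counts its first node once and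
  all others twice, hence is twice a trapezoidal sum with a main term proportional to (m x)^(1-s),
  and these add up to x^(1-s) zeta(s - 1). The sum is unconditional, as needed for the later
  reindexing.\<close>

lemma quadrant_term_has_sum:
  assumes "x > 0" "Re s > 2"
  shows "(quadrant_term s x has_sum (2 * eisenstein_period s x / (s - 1))) UNIV"
proof -
  have s1: "Re s > 1" "s - 1 \<noteq> 0" using assms(2) by auto
  define T where "T = infsum (quadrant_term s x) UNIV"
  define y where "y = (\<lambda>m. real (Suc m) * x)"
  have y: "y m > 0" for m using assms(1) by (simp add: y_def)
  define \<zeta> where "\<zeta> = hurwitz_series s 1"
  define G where "G = (\<lambda>m. case m of 0 \<Rightarrow> \<zeta> | Suc m \<Rightarrow> 2 * hurwitz_series s (y m) - of_real (y m) powr (-s))"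
  have H: "(\<lambda>n. (of_real u + of_nat n) powr (-s)) sums hurwitz_series s u" if "u > 0" for u
    unfolding hurwitz_series_def
    by (rule summable_sums, rule summable_norm_cancel, rule hurwitz_series_summable[OF that s1(1)])
  have T: "(quadrant_term s x has_sum T) UNIV"
    unfolding T_def by (rule has_sum_infsum, rule abs_summable_summable, rule quadrant_term_summable[OF assms])
  have inner: "((\<lambda>n. quadrant_term s x (m, n)) has_sum G m) UNIV" for m
  proof (rule norm_summable_imp_has_sum[OF quadrant_term_summable(2)[OF assms]])
    show "(\<lambda>n. quadrant_term s x (m, n)) sums G m"
    proof (cases m)
      case 0
      have "quadrant_term s x (0, Suc n) = (of_real 1 + of_nat n) powr (-s)" for n
        by (simp add: quadrant_term_def add_ac)
      then have "(\<lambda>n. quadrant_term s x (0, Suc n)) sums \<zeta>"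
        using H[of 1] by (simp add: \<zeta>_def)
      then have "(\<lambda>n. quadrant_term s x (0, n)) sums (\<zeta> + quadrant_term s x (0, 0))"
        by (subst (asm) sums_Suc_iff)
      then show ?thesis by (simp add: 0 G_def quadrant_term_def)
    next
      case (Suc M)
      have "quadrant_term s x (Suc M, n) = 2 * (of_real (y M) + of_nat n) powr (-s) - (if n = 0 then of_real (y M) powr (-s) else 0)" for n
        by (cases n) (simp_all add: quadrant_term_def y_def)
      moreover have "(\<lambda>n. 2 * (of_real (y M) + of_nat n) powr (-s) - (if n = 0 then of_real (y M) powr (-s) else 0))
          sums (2 * hurwitz_series s (y M) - of_real (y M) powr (-s))"
        by (intro sums_diff sums_mult H y sums_single)
      ultimately show ?thesis by (simp add: Suc G_def)
    qed
  qed
  have "(quadrant_term s x has_sum T) (Sigma UNIV (\<lambda>_. UNIV))" using T by simp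
  from has_sum_SigmaD[OF this inner] have "G sums T" by (rule has_sum_imp_sums)
  then have G: "(\<lambda>m. G (Suc m)) sums (T - \<zeta>)"
    by (subst sums_Suc_iff) (simp add: G_def)
  have "(\<lambda>m. of_nat (Suc m) powr (1 - s)) sums riemann_zeta (s - 1)"
  proof -
    have "Re (s - 1) > 1" using assms(2) by simp
    then have "(\<lambda>m. 1 / of_nat (Suc m) powr (s - 1)) sums riemann_zeta (s - 1)"
      using summable_sums[OF zeta_series_summable, of "s - 1"] zeta_series_eq[of "s - 1"]
      by (auto simp: riemann_zeta_eq simp del: of_nat_Suc)
    moreover have "1 / of_nat (Suc m) powr (s - 1) = of_nat (Suc m) powr (1 - s)" for m
      using powr_minus[of "of_nat (Suc m)" "s - 1"] by (simp add: field_simps del: of_nat_Suc)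
    ultimately show ?thesis by simp
  qed
  from sums_mult2[OF this, of "of_real x powr (1 - s)"]
  have "(\<lambda>m. (s - 1) / 2 * G (Suc m) - of_nat (Suc m) powr (1 - s) * of_real x powr (1 - s)) sums
          ((s - 1) / 2 * (T - \<zeta>) - riemann_zeta (s - 1) * of_real x powr (1 - s))"
    by (intro sums_diff sums_mult G)
  moreover have "(s - 1) / 2 * G (Suc m) - of_nat (Suc m) powr (1 - s) * of_real x powr (1 - s) =
      (s - 1) * em_tail s (of_nat (Suc m) * of_real x)" for m
  proof -
    have "of_nat (Suc m) powr (1 - s) * of_real x powr (1 - s) = of_real (y m) powr (1 - s)"
      unfolding y_def of_real_mult of_real_of_nat_eq using assms(1)
      by (subst powr_times_real) auto
    moreover have "(s - 1) / 2 * G (Suc m) = (s - 1) * (hurwitz_series s (y m) - of_real (y m) powr (-s) / 2)"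
      by (simp add: G_def field_simps)
    moreover have "of_nat (Suc m) * of_real x = complex_of_real (y m)"
      by (simp add: y_def)
    ultimately show ?thesis
      by (simp only: em_tail_eq_hurwitz_series[OF y s1(1)])
  qed
  moreover have "(\<lambda>m. (s - 1) * em_tail s (of_nat (Suc m) * of_real x)) sums ((s - 1) * lattice_tail s x)"
    unfolding lattice_tail_def
    by (intro sums_mult summable_sums lattice_tail_summable) (use assms in auto)
  ultimately have "(s - 1) * lattice_tail s x = (s - 1) / 2 * (T - \<zeta>) - riemann_zeta (s - 1) * of_real x powr (1 - s)"
    by (simp only: sums_unique2)
  then have "eisenstein_period s x = (s - 1) / 2 * (T - \<zeta>) + (s - 1) * (zeta_regular s / 2) + 1 / 2"
    by (simp add: eisenstein_period_def distrib_left)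
  also have "\<dots> = (s - 1) / 2 * T"
    unfolding \<zeta>_def hurwitz_series_1[OF s1(1)] using s1(2) by (simp add: field_simps)
  finally have "T = 2 * eisenstein_period s x / (s - 1)" using s1(2) by (simp add: field_simps)
  with T show ?thesis by simp
qed

section \<open>Reindexing the lattice by a matrix with non-negative entries\<close>

lemma rows_nonzero:
  fixes a b c d n :: nat
  assumes "int a * int d - int b * int c = int n" "n > 0"
  shows "c > 0 \<or> d > 0" "a > 0 \<or> b > 0"
    and "lex_sgn (int c) (int d) = 1" "lex_sgn (int a) (int b) = 1"
proof -
  show cd: "c > 0 \<or> d > 0" using assms by (cases "c = 0"; cases "d = 0") simp_all
  show ab: "a > 0 \<or> b > 0" using assms by (cases "a = 0"; cases "b = 0") simp_all
  show "lex_sgn (int c) (int d) = 1" "lex_sgn (int a) (int b) = 1"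
    using cd ab by (auto simp: lex_sgn_def)
qed

lemma row_weight_quadrant:
  fixes a b c d n q1 q2 :: nat
  assumes "int a * int d - int b * int c = int n" "n > 0"
  shows "row_weight n (int (q1 * a + q2 * c)) (int (q1 * b + q2 * d)) (pmat2 (int a) (int b) (int c) (int d)) =
           of_int (sgn (int q1) + sgn (int q2))"
proof -
  note rows_nonzero(3,4)[OF assms]
  moreover have "int (q1 * a + q2 * c) * int d - int (q1 * b + q2 * d) * int c = int q1 * int n"
    unfolding assms(1)[symmetric] by (simp add: algebra_simps)
  moreover have "int (q1 * b + q2 * d) * int a - int (q1 * a + q2 * c) * int b = int q2 * int n"
    unfolding assms(1)[symmetric] by (simp add: algebra_simps)
  ultimately show ?thesis
    using assms(2) by (simp only: row_weight_pmat2) (simp add: sgn_mult)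
qed

text \<open>If p has integral coefficients at all, they cannot both be non-positive: p would then be
  0, which q = 0 represents. So outside the image they have strictly opposite signs, and the weight
  cancels.\<close>

lemma row_weight_outside:
  fixes a b c d n p1 p2 :: nat
  assumes "int a * int d - int b * int c = int n" "n > 0"
    and "\<And>q1 q2. (p1, p2) \<noteq> (q1 * a + q2 * c, q1 * b + q2 * d)"
  shows "row_weight n (int p1) (int p2) (pmat2 (int a) (int b) (int c) (int d)) = 0"
proof (cases "int n dvd int p1 * int d - int p2 * int c \<and> int n dvd int p2 * int a - int p1 * int b")
  case False
  then show ?thesis by (simp only: row_weight_pmat2 if_False)
next
  case True
  then obtain q1 q2 where q: "int p1 * int d - int p2 * int c = int n * q1"
      "int p2 * int a - int p1 * int b = int n * q2" by (auto elim!: dvdE)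
  have "int n * (q1 * int a + q2 * int c) = int n * int p1"
    unfolding distrib_left mult.assoc[symmetric] q[symmetric] unfolding assms(1)[symmetric]
    by (simp add: algebra_simps)
  then have p1: "q1 * int a + q2 * int c = int p1" using assms(2) by simp
  have "int n * (q1 * int b + q2 * int d) = int n * int p2"
    unfolding distrib_left mult.assoc[symmetric] q[symmetric] unfolding assms(1)[symmetric]
    by (simp add: algebra_simps)
  then have p2: "q1 * int b + q2 * int d = int p2" using assms(2) by simp
  have "\<not> (q1 \<ge> 0 \<and> q2 \<ge> 0)"
  proof
    assume "q1 \<ge> 0 \<and> q2 \<ge> 0"
    then obtain r1 r2 where r: "q1 = int r1" "q2 = int r2" by (metis nonneg_int_cases)
    have "p1 = r1 * a + r2 * c" "p2 = r1 * b + r2 * d"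
      using p1 p2 unfolding r by (metis of_nat_add of_nat_eq_iff of_nat_mult)+
    then show False using assms(3) by blast
  qed
  moreover have "\<not> (q1 \<le> 0 \<and> q2 \<le> 0)"
  proof
    assume neg: "q1 \<le> 0 \<and> q2 \<le> 0"
    then have "q1 * int a + q2 * int c \<le> 0" "q1 * int b + q2 * int d \<le> 0"
      by (auto intro!: add_nonpos_nonpos mult_nonpos_nonneg)
    then have "p1 = 0" "p2 = 0" using p1 p2 by auto
    then show False using assms(3)[of 0 0] by simp
  qed
  ultimately have "sgn q1 + sgn q2 = 0" by (auto simp: sgn_if)
  moreover note rows_nonzero(3,4)[OF assms(1,2)]
  ultimately show ?thesis
    using assms(2) by (simp only: row_weight_pmat2 q) (simp add: sgn_mult)
qed

text \<open>The map q -> q \<gamma> embeds the quadrant into itself and carries (c x + d) (q1 u +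
  q2), where u = \<gamma> x, to p1 x + p2. Off its image the weight is 0, so the sums for all
  \<gamma> run over the same index set.\<close>

lemma slash_period_has_sum:
  fixes a b c d n :: nat
  assumes "int a * int d - int b * int c = int n" "n > 0" "x > 0" "Re s > 2"
  shows "((\<lambda>(p1, p2). of_rat (row_weight n (int p1) (int p2) (pmat2 (int a) (int b) (int c) (int d))) *
             of_real (real p1 * x + real p2) powr (-s)) has_sum
          (of_real (real c * x + real d) powr (-s) *
             (2 * eisenstein_period s ((real a * x + real b) / (real c * x + real d)) / (s - 1)))) UNIV"
proof -
  define j where "j = real c * x + real d"
  define u where "u = (real a * x + real b) / j"
  define \<phi> where "\<phi> = (\<lambda>(q1, q2). (q1 * a + q2 * c, q1 * b + q2 * d))"
  define g where "g = (\<lambda>(p1, p2). of_rat (row_weight n (int p1) (int p2) (pmat2 (int a) (int b) (int c) (int d))) *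
             complex_of_real (real p1 * x + real p2) powr (-s))"
  have j: "j > 0" and num: "real a * x + real b > 0"
    using rows_nonzero(1,2)[OF assms(1,2)] assms(3) by (auto simp: j_def intro: add_pos_nonneg add_nonneg_pos)
  have u: "u > 0" using j num by (simp add: u_def)
  have "((\<lambda>q. of_real j powr (-s) * quadrant_term s u q) has_sum
          (of_real j powr (-s) * (2 * eisenstein_period s u / (s - 1)))) UNIV"
    by (rule has_sum_cmult_right[OF quadrant_term_has_sum[OF u assms(4)]])
  moreover have "of_real j powr (-s) * quadrant_term s u q = (g \<circ> \<phi>) q" for q
  proof -
    obtain q1 q2 where q: "q = (q1, q2)" by (cases q)
    have "j * (real q1 * u + real q2) = real q1 * (j * u) + real q2 * j"
      by (simp add: algebra_simps)
    also have "j * u = real a * x + real b" using j by (simp add: u_def)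
    finally have "real (q1 * a + q2 * c) * x + real (q1 * b + q2 * d) = j * (real q1 * u + real q2)"
      by (simp add: j_def algebra_simps)
    then have "of_real (real (q1 * a + q2 * c) * x + real (q1 * b + q2 * d)) powr (-s) =
        (of_real j powr (-s) * of_real (real q1 * u + real q2) powr (-s) :: complex)"
      using j u by (simp only: of_real_mult) (subst powr_times_real, auto)
    then show ?thesis
      using row_weight_quadrant[OF assms(1,2), of q1 q2]
      by (simp only: o_def q \<phi>_def g_def quadrant_term_def case_prod_conv) (simp add: of_rat_add)
  qed
  moreover have "inj \<phi>"
  proof (rule injI)
    fix q q' assume eq: "\<phi> q = \<phi> q'"
    obtain q1 q2 r1 r2 where q: "q = (q1, q2)" "q' = (r1, r2)" by (cases q, cases q')
    have e: "int q1 * int a + int q2 * int c = int r1 * int a + int r2 * int c"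
         "int q1 * int b + int q2 * int d = int r1 * int b + int r2 * int d"
      using eq unfolding q \<phi>_def by (simp_all flip: of_nat_mult of_nat_add)
    have "int q1 * int n = (int q1 * int a + int q2 * int c) * int d - (int q1 * int b + int q2 * int d) * int c"
      unfolding assms(1)[symmetric] by (simp add: algebra_simps)
    also have "\<dots> = int r1 * int n"
      unfolding e assms(1)[symmetric] by (simp add: algebra_simps)
    finally have 1: "q1 = r1" using assms(2) by simp
    have "int q2 * int n = (int q1 * int b + int q2 * int d) * int a - (int q1 * int a + int q2 * int c) * int b"
      unfolding assms(1)[symmetric] by (simp add: algebra_simps)
    also have "\<dots> = int r2 * int n"
      unfolding e assms(1)[symmetric] by (simp add: algebra_simps)
    finally have "q2 = r2" using assms(2) by simp
    with 1 show "q = q'" by (simp add: q)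
  qed
  ultimately have "(g has_sum (of_real j powr (-s) * (2 * eisenstein_period s u / (s - 1)))) (range \<phi>)"
    by (simp only: has_sum_reindex o_def)
  also have "?this \<longleftrightarrow> (g has_sum (of_real j powr (-s) * (2 * eisenstein_period s u / (s - 1)))) UNIV"
  proof (rule has_sum_cong_neutral)
    fix p assume p: "p \<in> UNIV - range \<phi>"
    obtain p1 p2 where p12: "p = (p1, p2)" by (cases p)
    have "(p1, p2) \<noteq> (q1 * a + q2 * c, q1 * b + q2 * d)" for q1 q2
      using p by (auto simp: p12 \<phi>_def image_iff)
    from row_weight_outside[OF assms(1,2) this] show "g p = 0" by (simp add: p12 g_def)
  qed auto
  finally show ?thesis by (simp only: g_def u_def j_def)
qed

text \<open>The case of the scalar matrix e I, of determinant e * e: it fixes x, has automorphy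
  factor e, and its rows span the points with both coordinates divisible by e.\<close>

lemma dilated_period_has_sum:
  fixes e :: nat
  assumes "e > 0" "x > 0" "Re s > 2"
  shows "((\<lambda>(p1, p2). of_int (sgn (int p1) + sgn (int p2)) * (if e dvd p1 \<and> e dvd p2 then 1 else 0) *
             of_real (real p1 * x + real p2) powr (-s)) has_sum
          (of_nat e powr (-s) * (2 * eisenstein_period s x / (s - 1)))) UNIV"
proof -
  have "of_rat (row_weight (e * e) (int p1) (int p2) (pmat2 (int e) (int 0) (int 0) (int e))) =
      (of_int (sgn (int p1) + sgn (int p2)) * (if e dvd p1 \<and> e dvd p2 then 1 else 0) :: complex)" for p1 p2
    using assms(1) by (simp add: row_weight_pmat2 lex_sgn_def sgn_mult of_rat_add)
  then show ?thesis
    using slash_period_has_sum[of e e 0 0 "e * e" x s] assms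
    by (simp only: case_prod_unfold) simp
qed

section \<open>The Hecke action\<close>

lemma has_sum_finite_sum:
  fixes f :: "'i \<Rightarrow> 'a \<Rightarrow> complex"
  assumes "\<And>i. i \<in> I \<Longrightarrow> (f i has_sum S i) A"
  shows "((\<lambda>x. \<Sum>i\<in>I. f i x) has_sum (\<Sum>i\<in>I. S i)) A"
  using assms
  by (induction I rule: infinite_finite_induct) (auto intro!: has_sum_add)

section \<open>The slash operator on non-negative representatives\<close>

lemma nonneg_rep_cases:
  assumes "pnonneg \<gamma>" "pdet \<gamma> = int n" "n > 0"
  obtains a b c d :: nat where
    "nonneg_rep \<gamma> = mat2 (int a) (int b) (int c) (int d)"
    "\<gamma> = pmat2 (int a) (int b) (int c) (int d)"
    "int a * int d - int b * int c = int n"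
proof -
  obtain A where A: "abs_pmat A = \<gamma>" "mat_nonneg A"
  proof -
    obtain B where B: "\<gamma> = abs_pmat B" by (metis Quotient_abs_rep[OF Quotient_pmat])
    have "mat_nonneg B \<or> mat_nonneg (- B)" using assms(1) unfolding B by (simp add: pnonneg.abs_eq)
    moreover have "abs_pmat (- B) = \<gamma>" unfolding B by (simp add: pmat.abs_eq_iff)
    ultimately show thesis using that[of B] that[of "- B"] by (auto simp: B)
  qed
  have rep: "nonneg_rep \<gamma> = A"
    unfolding nonneg_rep_def
  proof (rule the_equality)
    fix B assume B: "abs_pmat B = \<gamma> \<and> mat_nonneg B"
    with A(1) have "abs_pmat B = abs_pmat A" by simp
    then have "B = A \<or> B = - A" by (simp only: pmat.abs_eq_iff)
    then show "B = A"
    proof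
      assume "B = - A"
      have "A $ i $ j = 0" for i j
      proof -
        have "0 \<le> A $ i $ j" using A(2) by (simp add: mat_nonneg_def)
        moreover have "0 \<le> B $ i $ j" using B by (simp add: mat_nonneg_def)
        ultimately show ?thesis by (simp add: \<open>B = - A\<close>)
      qed
      then show "B = A" by (simp add: \<open>B = - A\<close> vec_eq_iff)
    qed
  qed (use A in simp)
  have entries: "A $ i $ j = int (nat (A $ i $ j))" for i j
    using A(2) by (simp add: mat_nonneg_def)
  have mat: "A = mat2 (int (nat (A $ 1 $ 1))) (int (nat (A $ 1 $ 2))) (int (nat (A $ 2 $ 1))) (int (nat (A $ 2 $ 2)))"
    unfolding entries[symmetric] by (rule mat2_eta[symmetric])
  have \<gamma>: "\<gamma> = pmat2 (int (nat (A $ 1 $ 1))) (int (nat (A $ 1 $ 2))) (int (nat (A $ 2 $ 1))) (int (nat (A $ 2 $ 2)))"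
    unfolding pmat2.abs_eq mat[symmetric] by (rule A(1)[symmetric])
  show thesis
  proof (rule that)
    show "nonneg_rep \<gamma> = mat2 (int (nat (A $ 1 $ 1))) (int (nat (A $ 1 $ 2))) (int (nat (A $ 2 $ 1))) (int (nat (A $ 2 $ 2)))"
      unfolding rep by (rule mat)
    show "int (nat (A $ 1 $ 1)) * int (nat (A $ 2 $ 2)) - int (nat (A $ 1 $ 2)) * int (nat (A $ 2 $ 1)) = int n"
      using assms(2) unfolding \<gamma> pdet_pmat2 .
  qed (rule \<gamma>)
qed

definition automorphy_factor :: "pmat \<Rightarrow> real \<Rightarrow> real" where
  "automorphy_factor \<gamma> x = of_int (nonneg_rep \<gamma> $ 2 $ 1) * x + of_int (nonneg_rep \<gamma> $ 2 $ 2)"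

definition moebius_action :: "pmat \<Rightarrow> real \<Rightarrow> real" where
  "moebius_action \<gamma> x =
     (of_int (nonneg_rep \<gamma> $ 1 $ 1) * x + of_int (nonneg_rep \<gamma> $ 1 $ 2)) / automorphy_factor \<gamma> x"

lemma nonneg_action_pos:
  assumes "pnonneg \<gamma>" "pdet \<gamma> = int n" "n > 0" "x > 0"
  shows "automorphy_factor \<gamma> x > 0" "moebius_action \<gamma> x > 0"
proof -
  obtain a b c d :: nat where
    rep: "nonneg_rep \<gamma> = mat2 (int a) (int b) (int c) (int d)" and
    det: "int a * int d - int b * int c = int n"
    by (rule nonneg_rep_cases[OF assms(1-3)])
  have num: "real a * x + real b > 0" and den: "real c * x + real d > 0"
    using rows_nonzero(1,2)[OF det assms(3)] assms(4)
    by (auto intro: add_pos_nonneg add_nonneg_pos)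
  show "automorphy_factor \<gamma> x > 0" "moebius_action \<gamma> x > 0"
    using num den by (simp_all add: automorphy_factor_def moebius_action_def rep)
qed

text \<open>For J > 0 the principal logarithm of 1/J is -Ln J. Then (- Ln J)^l / J is the l-th
  derivative of J^(-s) at s = 1, so the slash operators of the claim are the terms of Leibniz'
  rule.\<close>

lemma slash_mat_nonneg_rep:
  assumes "pnonneg \<gamma>" "pdet \<gamma> = int n" "n > 0" "x > 0"
  shows "slash_mat f l (nonneg_rep \<gamma>) (of_real x) =
    of_real (sqrt (real n)) / of_real (automorphy_factor \<gamma> x) * (- Ln (of_real (automorphy_factor \<gamma> x))) ^ l
      * f (of_real (moebius_action \<gamma> x))"
proof -
  obtain a b c d :: nat where
    rep: "nonneg_rep \<gamma> = mat2 (int a) (int b) (int c) (int d)" and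
    det: "int a * int d - int b * int c = int n"
    by (rule nonneg_rep_cases[OF assms(1-3)])
  define J where "J = automorphy_factor \<gamma> x"
  have J: "J > 0" unfolding J_def by (rule nonneg_action_pos[OF assms])
  have J_eq: "of_nat c * of_real x + of_nat d = complex_of_real J"
    by (simp add: J_def automorphy_factor_def rep)
  have act: "(of_nat a * of_real x + of_nat b) / complex_of_real J = complex_of_real (moebius_action \<gamma> x)"
    by (simp add: moebius_action_def rep flip: J_def)
  have "of_nat a * of_nat d - of_nat b * of_nat c = complex_of_int (int a * int d - int b * int c)" by simp
  also have "\<dots> = complex_of_real (real n)" unfolding det by simp
  finally have root: "csqrt (of_nat a * of_nat d - of_nat b * of_nat c) = complex_of_real (sqrt (real n))"
    by (simp only: of_real_sqrt of_nat_0_le_iff)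
  have "1 / complex_of_real J = of_real (1 / J)" by simp
  then have "Ln (1 / complex_of_real J) = of_real (ln (1 / J))"
    using J by (simp only: Ln_of_real zero_less_divide_1_iff)
  also have "\<dots> = - Ln (of_real J)" using J by (simp add: Ln_of_real ln_div)
  finally have "Ln (1 / complex_of_real J) = - Ln (of_real J)" .
  then show ?thesis
    unfolding slash_mat_def Let_def rep
    by (simp add: J_eq act root flip: J_def)
qed

lemma slash_pnonneg:
  assumes "v \<in> hecke_module n" "\<forall>\<gamma>\<in>Poly_Mapping.keys v. pnonneg \<gamma>" "n > 0" "x > 0"
  shows "slash f l v (of_real x) = of_real (sqrt (real n)) * (\<Sum>\<gamma>\<in>Poly_Mapping.keys v. of_rat (Poly_Mapping.lookup v \<gamma>) *
     ((- Ln (of_real (automorphy_factor \<gamma> x))) ^ l / of_real (automorphy_factor \<gamma> x) * f (of_real (moebius_action \<gamma> x))))"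
  unfolding slash_def sum_distrib_left
proof (intro sum.cong refl)
  fix \<gamma> assume "\<gamma> \<in> Poly_Mapping.keys v"
  then have "pnonneg \<gamma>" "pdet \<gamma> = int n"
    using assms(1,2) by (auto simp: hecke_module_def hecke_mats_def)
  from slash_mat_nonneg_rep[OF this assms(3,4), of f l]
  show "of_rat (Poly_Mapping.lookup v \<gamma>) * slash_mat f l (nonneg_rep \<gamma>) (of_real x) =
     of_real (sqrt (real n)) * (of_rat (Poly_Mapping.lookup v \<gamma>) *
     ((- Ln (of_real (automorphy_factor \<gamma> x))) ^ l / of_real (automorphy_factor \<gamma> x) * f (of_real (moebius_action \<gamma> x))))"
    by (simp add: mult_ac)
qed

text \<open>The finite sum over matrices is exchanged with the lattice sum, and
  \<open>hecke_row_weight\<close> identifies the coefficient at each p. A divisor e contributes e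
  times the sum over the points divisible by e, hence the factor e * e^(-s) = e^(1-s).\<close>

lemma eisenstein_period_hecke_half_plane:
  assumes "n > 0" "acts_like_hecke n v" "\<forall>\<gamma>\<in>Poly_Mapping.keys v. pnonneg \<gamma>" "x > 0" "Re s > 2"
  shows "(\<Sum>\<gamma>\<in>Poly_Mapping.keys v. of_rat (Poly_Mapping.lookup v \<gamma>) *
      (of_real (automorphy_factor \<gamma> x) powr (-s) * eisenstein_period s (moebius_action \<gamma> x))) =
    (\<Sum>e | e dvd n. of_nat e powr (1 - s)) * eisenstein_period s x"
proof -
  define C where "C = 2 / (s - 1)"
  have "s - 1 \<noteq> 0" using assms(5) by auto
  then have C: "C \<noteq> 0" "2 * z / (s - 1) = C * z" for z by (simp_all add: C_def)
  define f where "f = (\<lambda>p :: nat \<times> nat. complex_of_real (real (fst p) * x + real (snd p)) powr (-s))"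
  define wt where "wt = (\<lambda>\<gamma> p. complex_of_rat (row_weight n (int (fst p)) (int (snd p)) \<gamma>))"
  define sg where "sg = (\<lambda>p :: nat \<times> nat. complex_of_int (sgn (int (fst p)) + sgn (int (snd p))))"
  let ?K = "Poly_Mapping.keys v"
  have lhs: "((\<lambda>p. \<Sum>\<gamma>\<in>?K. of_rat (Poly_Mapping.lookup v \<gamma>) * (wt \<gamma> p * f p)) has_sum
      (\<Sum>\<gamma>\<in>?K. of_rat (Poly_Mapping.lookup v \<gamma>) *
        (of_real (automorphy_factor \<gamma> x) powr (-s) * (C * eisenstein_period s (moebius_action \<gamma> x))))) UNIV"
  proof (intro has_sum_finite_sum has_sum_cmult_right)
    fix \<gamma> assume "\<gamma> \<in> ?K"
    then have \<gamma>: "pnonneg \<gamma>" "pdet \<gamma> = int n"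
      using assms(2,3) by (auto simp: acts_like_hecke_def hecke_module_def hecke_mats_def)
    obtain a b c d :: nat where
      rep: "nonneg_rep \<gamma> = mat2 (int a) (int b) (int c) (int d)" and
      \<gamma>_eq: "\<gamma> = pmat2 (int a) (int b) (int c) (int d)" and
      det: "int a * int d - int b * int c = int n"
      by (rule nonneg_rep_cases[OF \<gamma> assms(1)])
    have "automorphy_factor \<gamma> x = real c * x + real d"
         "moebius_action \<gamma> x = (real a * x + real b) / (real c * x + real d)"
      by (simp_all add: automorphy_factor_def moebius_action_def rep)
    then show "((\<lambda>p. wt \<gamma> p * f p) has_sum
        (of_real (automorphy_factor \<gamma> x) powr (-s) * (C * eisenstein_period s (moebius_action \<gamma> x)))) UNIV"
      using slash_period_has_sum[OF det assms(1,4,5)]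
      by (simp only: wt_def f_def case_prod_unfold C(2) \<gamma>_eq[symmetric])
  qed
  have rhs: "((\<lambda>p. \<Sum>e | e dvd n. of_nat e * (sg p * (if e dvd fst p \<and> e dvd snd p then 1 else 0) * f p)) has_sum
      (\<Sum>e | e dvd n. of_nat e * (of_nat e powr (-s) * (C * eisenstein_period s x)))) UNIV"
  proof (intro has_sum_finite_sum has_sum_cmult_right)
    fix e assume "e \<in> {e. e dvd n}"
    then have "e > 0" using assms(1) by (cases e) auto
    from dilated_period_has_sum[OF this assms(4,5)]
    show "((\<lambda>p. sg p * (if e dvd fst p \<and> e dvd snd p then 1 else 0) * f p) has_sum
        (of_nat e powr (-s) * (C * eisenstein_period s x))) UNIV"
      by (simp only: sg_def f_def case_prod_unfold C(2))
  qed
  have "(\<Sum>\<gamma>\<in>?K. of_rat (Poly_Mapping.lookup v \<gamma>) * (wt \<gamma> p * f p)) =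
        (\<Sum>e | e dvd n. of_nat e * (sg p * (if e dvd fst p \<and> e dvd snd p then 1 else 0) * f p))" for p
  proof -
    have "(\<Sum>\<gamma>\<in>?K. of_rat (Poly_Mapping.lookup v \<gamma>) * (wt \<gamma> p * f p)) =
          of_rat (lin_ext (row_weight n (int (fst p)) (int (snd p))) v) * f p"
      by (simp add: lin_ext_def wt_def of_rat_sum of_rat_mult sum_distrib_right mult.assoc)
    also have "lin_ext (row_weight n (int (fst p)) (int (snd p))) v =
        of_int (sgn (int (fst p)) + sgn (int (snd p))) *
        (\<Sum>e | e dvd n \<and> int e dvd int (fst p) \<and> int e dvd int (snd p). of_nat e)"
      by (rule hecke_row_weight[OF assms(1,2)])
    also have "(\<Sum>e | e dvd n \<and> int e dvd int (fst p) \<and> int e dvd int (snd p). of_nat e :: rat) =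
        (\<Sum>e\<in>{e. e dvd n} \<inter> {e. e dvd fst p \<and> e dvd snd p}. of_nat e)"
      by (intro sum.cong) auto
    also have "\<dots> = (\<Sum>e | e dvd n. of_nat e * (if e dvd fst p \<and> e dvd snd p then 1 else 0))"
      using assms(1) by (subst sum.inter_restrict) (auto intro!: sum.cong)
    also have "of_rat (of_int (sgn (int (fst p)) + sgn (int (snd p))) *
        (\<Sum>e | e dvd n. of_nat e * (if e dvd fst p \<and> e dvd snd p then 1 else 0))) =
        sg p * (\<Sum>e | e dvd n. of_nat e * (if e dvd fst p \<and> e dvd snd p then 1 else 0))"
      unfolding of_rat_mult of_rat_sum sg_def of_rat_of_int_eq
      by (intro arg_cong2[where f = "(*)"] refl sum.cong) auto
    finally show ?thesis
      by (simp add: sum_distrib_left sum_distrib_right mult_ac)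
  qed
  then have "(\<Sum>\<gamma>\<in>?K. of_rat (Poly_Mapping.lookup v \<gamma>) *
        (of_real (automorphy_factor \<gamma> x) powr (-s) * (C * eisenstein_period s (moebius_action \<gamma> x)))) =
      (\<Sum>e | e dvd n. of_nat e * (of_nat e powr (-s) * (C * eisenstein_period s x)))"
    using has_sum_unique[OF lhs] rhs by simp
  then have "C * (\<Sum>\<gamma>\<in>?K. of_rat (Poly_Mapping.lookup v \<gamma>) *
        (of_real (automorphy_factor \<gamma> x) powr (-s) * eisenstein_period s (moebius_action \<gamma> x))) =
      C * ((\<Sum>e | e dvd n. of_nat e * of_nat e powr (-s)) * eisenstein_period s x)"
    by (simp add: sum_distrib_left sum_distrib_right mult_ac)
  also have "(\<Sum>e | e dvd n. of_nat e * of_nat e powr (-s)) = (\<Sum>e | e dvd n. of_nat e powr (1 - s) :: complex)"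
  proof (intro sum.cong refl)
    fix e assume "e \<in> {e. e dvd n}"
    then have "e > 0" using assms(1) by (cases e) auto
    then show "of_nat e * of_nat e powr (-s) = (of_nat e powr (1 - s) :: complex)"
      by (simp add: powr_diff powr_minus field_simps)
  qed
  finally show ?thesis using C(1) by simp
qed

section \<open>Continuation to s = 1 and differentiation\<close>

lemma holomorphic_sum_divisors_powr:
  assumes "n > 0"
  shows "(\<lambda>s. \<Sum>e | e dvd n. of_nat e powr (1 - s) :: complex) holomorphic_on A"
  by (intro holomorphic_on_sum holomorphic_on_powr_diff) (use assms in \<open>auto intro!: Nat.gr0I\<close>)

lemma holomorphic_slash_period:
  assumes "J > 0" "u > 0"
  shows "(\<lambda>s. of_real J powr (-s) * eisenstein_period s u) holomorphic_on {s. Re s > 0} - {2}"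
  by (intro holomorphic_on_mult holomorphic_on_powr_minus holomorphic_eisenstein_period) (use assms in auto)

text \<open>Removing the pole at 2 leaves the half plane connected, so the identity theorem still
  reaches s = 1.\<close>

lemma eisenstein_period_hecke:
  assumes "n > 0" "acts_like_hecke n v" "\<forall>\<gamma>\<in>Poly_Mapping.keys v. pnonneg \<gamma>" "x > 0" "Re s > 0" "s \<noteq> 2"
  shows "(\<Sum>\<gamma>\<in>Poly_Mapping.keys v. of_rat (Poly_Mapping.lookup v \<gamma>) *
      (of_real (automorphy_factor \<gamma> x) powr (-s) * eisenstein_period s (moebius_action \<gamma> x))) =
    (\<Sum>e | e dvd n. of_nat e powr (1 - s)) * eisenstein_period s x"
    (is "?f s = ?g s")
proof (rule analytic_continuation_open[where s = "{s. Re s > 2}" and s' = "{s. Re s > 0} - {2}" and f = ?f and g = ?g])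
  show "open ({s. Re s > 0} - {2 :: complex})"
    by (intro open_delete open_halfspace_Re_gt)
  show "connected ({s. Re s > 0} - {2 :: complex})"
    by (intro connected_open_delete open_halfspace_Re_gt convex_connected convex_halfspace_Re_gt) simp
  show "{s. Re s > 2} \<noteq> {}" by (auto intro!: exI[of _ 3])
  show "?f holomorphic_on {s. Re s > 0} - {2}"
  proof (intro holomorphic_on_sum holomorphic_on_mult[OF holomorphic_on_const] holomorphic_slash_period)
    fix \<gamma> assume "\<gamma> \<in> Poly_Mapping.keys v"
    then have "pnonneg \<gamma>" "pdet \<gamma> = int n"
      using assms(2,3) by (auto simp: acts_like_hecke_def hecke_module_def hecke_mats_def)
    then show "automorphy_factor \<gamma> x > 0" "moebius_action \<gamma> x > 0"
      using nonneg_action_pos assms(1,4) by blast+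
  qed
  show "?g holomorphic_on {s. Re s > 0} - {2}"
    by (intro holomorphic_on_mult holomorphic_sum_divisors_powr holomorphic_eisenstein_period assms(1,4))
  show "?f z = ?g z" if "z \<in> {s. Re s > 2}" for z
    by (rule eisenstein_period_hecke_half_plane[OF assms(1-4)]) (use that in simp)
qed (use assms in \<open>auto simp: open_halfspace_Re_gt\<close>)

text \<open>The absorption identity j C(k, j) = k C(k - 1, j - 1) after substituting i = k - j. The
  term j = 0, which has no counterpart on the right, vanishes by its factor j.\<close>

lemma sum_binomial_shift:
  fixes a h :: "nat \<Rightarrow> complex"
  assumes "k \<ge> 1"
  shows "(\<Sum>i=0..k. of_nat (k choose i) * a i * (- of_nat (k - i) * h (k - i))) =
         - of_nat k * (\<Sum>j=1..k. of_nat ((k - 1) choose (j - 1)) * (a (k - j) * h j))"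
proof -
  have "(\<Sum>i=0..k. of_nat (k choose i) * a i * (- of_nat (k - i) * h (k - i))) =
        (\<Sum>j=0..k. of_nat (k choose (k - j)) * a (k - j) * (- of_nat j * h j))"
    by (rule sum.reindex_bij_witness[of _ "\<lambda>j. k - j" "\<lambda>i. k - i"]) auto
  also have "\<dots> = (\<Sum>j=1..k. of_nat (k choose (k - j)) * a (k - j) * (- of_nat j * h j))"
    by (rule sum.mono_neutral_right) (auto simp: not_le)
  also have "\<dots> = (\<Sum>j=1..k. - of_nat k * (of_nat ((k - 1) choose (j - 1)) * (a (k - j) * h j)))"
  proof (intro sum.cong refl)
    fix j assume j: "j \<in> {1..k}"
    then have "k choose (k - j) = k choose j" by (auto intro: binomial_symmetric[symmetric])
    moreover have "j * (k choose j) = k * ((k - 1) choose (j - 1))"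
      by (rule times_binomial_minus1_eq) (use j in simp)
    then have "of_nat j * of_nat (k choose j) = (of_nat k * of_nat ((k - 1) choose (j - 1)) :: complex)"
      by (simp only: flip: of_nat_mult)
    ultimately show "of_nat (k choose (k - j)) * a (k - j) * (- of_nat j * h j) =
        - of_nat k * (of_nat ((k - 1) choose (j - 1)) * (a (k - j) * h j))"
      by (simp add: algebra_simps)
  qed
  finally show ?thesis by (simp only: sum_distrib_left)
qed

lemma higher_deriv_mult_eisenstein_period:
  assumes "x > 0" "k \<ge> 1" "g holomorphic_on {s. Re s > 0} - {2}"
  shows "(deriv ^^ k) (\<lambda>s. g s * eisenstein_period s x) 1 =
    - of_nat k * (\<Sum>j=1..k. of_nat ((k - 1) choose (j - 1)) * ((deriv ^^ (k - j)) g 1 * herglotz j (of_real x)))"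
proof -
  have "(deriv ^^ k) (\<lambda>s. g s * eisenstein_period s x) 1 =
      (\<Sum>i=0..k. of_nat (k choose i) * (deriv ^^ i) g 1 * (deriv ^^ (k - i)) (\<lambda>s. eisenstein_period s x) 1)"
    by (rule higher_deriv_mult[OF assms(3) holomorphic_eisenstein_period[OF assms(1)]])
       (auto intro!: open_delete open_halfspace_Re_gt)
  then show ?thesis
    unfolding higher_deriv_eisenstein_period[OF assms(1)]
    by (rule trans) (rule sum_binomial_shift[OF assms(2)])
qed

theorem theorem1p4:
  fixes n k :: nat and Tn :: "pmat \<Rightarrow>\<^sub>0 rat" and x :: real
  assumes "n \<ge> 1" and "k \<ge> 1"
    and "acts_like_hecke n Tn"
    and "\<forall>\<gamma> \<in> Poly_Mapping.keys Tn. pnonneg \<gamma>"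
    and "x > 0"
  shows "(\<Sum>j=1..k. of_nat ((k - 1) choose (j - 1))
             * slash (herglotz j) (k - j) Tn (complex_of_real x))
       = complex_of_real (sqrt (real n))
         * (\<Sum>j=1..k. of_nat ((k - 1) choose (j - 1))
               * sigma0_deriv (k - j) n * herglotz j (complex_of_real x))"
proof -
  let ?K = "Poly_Mapping.keys Tn" and ?D = "{s. Re s > 0} - {2 :: complex}"
  let ?v = "\<lambda>\<gamma>. complex_of_rat (Poly_Mapping.lookup Tn \<gamma>)" and ?J = "\<lambda>\<gamma>. automorphy_factor \<gamma> x"
    and ?u = "\<lambda>\<gamma>. moebius_action \<gamma> x" and ?b = "\<lambda>j. complex_of_nat ((k - 1) choose (j - 1))"
  have n: "n > 0" using assms(1) by simp
  have D: "open ?D" "1 \<in> ?D" by (auto intro!: open_delete open_halfspace_Re_gt)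
  have module: "Tn \<in> hecke_module n" using assms(3) by (simp add: acts_like_hecke_def)
  have pos: "?J \<gamma> > 0" "?u \<gamma> > 0" if "\<gamma> \<in> ?K" for \<gamma>
  proof -
    have "pnonneg \<gamma>" "pdet \<gamma> = int n"
      using that assms(4) module by (auto simp: hecke_module_def hecke_mats_def)
    then show "?J \<gamma> > 0" "?u \<gamma> > 0" using nonneg_action_pos n assms(5) by blast+
  qed
  define f where "f = (\<lambda>s. \<Sum>\<gamma>\<in>?K. ?v \<gamma> * (of_real (?J \<gamma>) powr (-s) * eisenstein_period s (?u \<gamma>)))"
  define \<sigma> where "\<sigma> = (\<lambda>s. \<Sum>e | e dvd n. of_nat e powr (1 - s) :: complex)"
  have slash_holo: "(\<lambda>s. of_real (?J \<gamma>) powr (-s) * eisenstein_period s (?u \<gamma>)) holomorphic_on ?D" if "\<gamma> \<in> ?K" for \<gamma>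
    by (rule holomorphic_slash_period[OF pos[OF that]])
  have vslash_holo: "(\<lambda>s. ?v \<gamma> * (of_real (?J \<gamma>) powr (-s) * eisenstein_period s (?u \<gamma>))) holomorphic_on ?D" if "\<gamma> \<in> ?K" for \<gamma>
    by (rule holomorphic_on_mult[OF holomorphic_on_const slash_holo[OF that]])
  have \<sigma>_holo: "\<sigma> holomorphic_on ?D" unfolding \<sigma>_def by (rule holomorphic_sum_divisors_powr[OF n])
  \<comment> \<open>The order is k and not k - 1 because \<open>eisenstein_period\<close> includes
    the factor s - 1.\<close>
  have "(deriv ^^ k) f 1 = (deriv ^^ k) (\<lambda>s. \<sigma> s * eisenstein_period s x) 1"
  proof (rule higher_deriv_transform_within_open[OF _ _ D])
    show "f holomorphic_on ?D" unfolding f_def by (rule holomorphic_on_sum) (rule vslash_holo)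
    show "(\<lambda>s. \<sigma> s * eisenstein_period s x) holomorphic_on ?D"
      by (intro holomorphic_on_mult \<sigma>_holo holomorphic_eisenstein_period assms(5))
    show "f s = \<sigma> s * eisenstein_period s x" if "s \<in> ?D" for s
      unfolding f_def \<sigma>_def by (rule eisenstein_period_hecke[OF n assms(3,4,5)]) (use that in auto)
  qed
  also have "\<dots> = - of_nat k * (\<Sum>j=1..k. ?b j * ((deriv ^^ (k - j)) \<sigma> 1 * herglotz j (of_real x)))"
    by (rule higher_deriv_mult_eisenstein_period[OF assms(5,2) \<sigma>_holo])
  also have "(deriv ^^ k) f 1 = - of_nat k * (\<Sum>\<gamma>\<in>?K. ?v \<gamma> * (\<Sum>j=1..k. ?b j *
      ((- Ln (of_real (?J \<gamma>))) ^ (k - j) / of_real (?J \<gamma>) * herglotz j (of_real (?u \<gamma>)))))"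
  proof -
    have "(deriv ^^ k) f 1 = (\<Sum>\<gamma>\<in>?K. (deriv ^^ k) (\<lambda>s. ?v \<gamma> * (of_real (?J \<gamma>) powr (-s) * eisenstein_period s (?u \<gamma>))) 1)"
      unfolding f_def by (rule higher_deriv_sum[OF vslash_holo D])
    also have "\<dots> = (\<Sum>\<gamma>\<in>?K. ?v \<gamma> * (- of_nat k * (\<Sum>j=1..k. ?b j *
      ((- Ln (of_real (?J \<gamma>))) ^ (k - j) / of_real (?J \<gamma>) * herglotz j (of_real (?u \<gamma>))))))"
    proof (intro sum.cong refl)
      fix \<gamma> assume \<gamma>: "\<gamma> \<in> ?K"
      have J: "complex_of_real (?J \<gamma>) \<noteq> 0" using pos(1)[OF \<gamma>] by simp
      have "(deriv ^^ k) (\<lambda>s. of_real (?J \<gamma>) powr (-s) * eisenstein_period s (?u \<gamma>)) 1 =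
          - of_nat k * (\<Sum>j=1..k. ?b j * ((deriv ^^ (k - j)) (\<lambda>s. of_real (?J \<gamma>) powr (-s)) 1 * herglotz j (of_real (?u \<gamma>))))"
        by (rule higher_deriv_mult_eisenstein_period[OF pos(2)[OF \<gamma>] assms(2) holomorphic_on_powr_minus[OF J]])
      moreover have "(deriv ^^ m) (\<lambda>s. of_real (?J \<gamma>) powr (-s)) 1 = (- Ln (of_real (?J \<gamma>))) ^ m / of_real (?J \<gamma>)" for m
        using J by (subst higher_deriv_powr_minus[OF J]) (simp add: powr_minus field_simps)
      ultimately show "(deriv ^^ k) (\<lambda>s. ?v \<gamma> * (of_real (?J \<gamma>) powr (-s) * eisenstein_period s (?u \<gamma>))) 1 =
          ?v \<gamma> * (- of_nat k * (\<Sum>j=1..k. ?b j *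
            ((- Ln (of_real (?J \<gamma>))) ^ (k - j) / of_real (?J \<gamma>) * herglotz j (of_real (?u \<gamma>)))))"
        by (simp only: higher_deriv_cmult[OF slash_holo[OF \<gamma>] D(2,1)])
    qed
    finally show ?thesis by (simp add: sum_distrib_left mult_ac)
  qed
  \<comment> \<open>The common factor -k, which comes from the multiplication by s - 1, is
    cancelled.\<close>
  finally have eq: "(\<Sum>\<gamma>\<in>?K. ?v \<gamma> * (\<Sum>j=1..k. ?b j *
      ((- Ln (of_real (?J \<gamma>))) ^ (k - j) / of_real (?J \<gamma>) * herglotz j (of_real (?u \<gamma>))))) =
      (\<Sum>j=1..k. ?b j * ((deriv ^^ (k - j)) \<sigma> 1 * herglotz j (of_real x)))"
    using assms(2) by simp
  have "(\<Sum>j=1..k. ?b j * slash (herglotz j) (k - j) Tn (of_real x)) =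
      (\<Sum>j=1..k. \<Sum>\<gamma>\<in>?K. of_real (sqrt (real n)) * (?v \<gamma> * (?b j *
        ((- Ln (of_real (?J \<gamma>))) ^ (k - j) / of_real (?J \<gamma>) * herglotz j (of_real (?u \<gamma>))))))"
    unfolding slash_pnonneg[OF module assms(4) n assms(5)] sum_distrib_left
    by (intro sum.cong refl) (simp only: mult_ac)
  also have "\<dots> = of_real (sqrt (real n)) * (\<Sum>\<gamma>\<in>?K. ?v \<gamma> * (\<Sum>j=1..k. ?b j *
      ((- Ln (of_real (?J \<gamma>))) ^ (k - j) / of_real (?J \<gamma>) * herglotz j (of_real (?u \<gamma>)))))"
    by (subst sum.swap) (simp only: sum_distrib_left)
  finally show ?thesis
    unfolding eq sigma0_deriv_def \<sigma>_def[symmetric] by (simp only: mult.assoc)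
qed

end
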